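(* For all $N_0,N_1,N_2,L_0,L_1,L_2>0$ and all choices of signs $\pm_0,\pm_1,\pm_2\in\{+,-\}$, the estimate $$\left\| \mathbf P_{K^{\pm_0}_{N_0,L_0}}\left(\mathbf P_{K^{\pm_1}_{N_1,L_1}}u_1\cdot \mathbf P_{K^{\pm_2}_{N_2,L_2}}u_2\right)\right\|\le C\,\|u_1\|\,\|u_2\|\qquad \forall\, u_1,u_2\in\mathcal S(\mathbb R^{1+2})$$ holds with $C$ equal to an absolute constant (independent of the $N_j$, $L_j$ and the signs) times each one of the following quantities: $$\bigl(N_{\min}^{012}L_{\min}^{12}\bigr)^{1/2}\bigl(N_{\min}^{12}L_{\max}^{12}\bigr)^{1/4},$$ $$\bigl(N_{\min}^{012}L_{\min}^{0j}\bigr)^{1/2}\bigl(N_{\min}^{0j}L_{\max}^{0j}\bigr)^{1/4}\qquad (j=1,2),$$ $$\bigl((N_{\min}^{012})^2L_{\min}^{012}\bigr)^{1/2}.$$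
   Context: Points of $\mathbb R^{1+2}$ are written $(\tau,\xi)$ with $\tau\in\mathbb R$, $\xi\in\mathbb R^2$. $\|\cdot\|$ is the norm on $L^2(\mathbb R^{1+2})$, $\widehat u(\tau,\xi)=\iint e^{-i(t\tau+x\cdot\xi)}u(t,x)\,dt\,dx$ is the space-time Fourier transform, and for measurable $A\subset\mathbb R^{1+2}$ the multiplier $\mathbf P_A$ is defined by $\widehat{\mathbf P_Au}=\chi_A\widehat u$. $\mathcal S$ denotes the Schwartz space. Thickened truncated null cones: for $N,L>0$ and a sign $\pm$, $$K^{\pm}_{N,L}=\{(\tau,\xi)\in\mathbb R^{1+2}: |\xi|\lesssim N,\ \tau=\pm|\xi|+O(L)\},$$ i.e. $|\xi|\le MN$ and $|\tau\mp|\xi||\le ML$ for some fixed absolute constant $M\ge1$; the absolute constant in the claim may depend on $M$ only. $N_{\min}^{012}=\min(N_0,N_1,N_2)$, $N_{\min}^{jk}=\min(N_j,N_k)$, $L_{\min}^{012}=\min(L_0,L_1,L_2)$, $L_{\min}^{jk}=\min(L_j,L_k)$, $L_{\max}^{jk}=\max(L_j,L_k)$. *)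

theory Defs
  imports "HOL-Analysis.Analysis"
begin

text \<open>
  Points \<open>(\<tau>, \<xi>)\<close> of \<open>\<real>\<^sup>1\<^sup>+\<^sup>2\<close>.  The library inner product on this type is
  \<open>(t, x) \<bullet> (\<tau>, \<xi>) = t * \<tau> + x \<bullet> \<xi>\<close>.
\<close>
type_synonym spacetime = "real \<times> (real^2)"

text \<open>
  Iterated partial derivatives along a list of directions.  A function is smooth iff all of its
  iterated partial derivatives along basis vectors are differentiable everywhere.
\<close>
fun iter_partial ::
  "'a::euclidean_space list \<Rightarrow> ('a \<Rightarrow> complex) \<Rightarrow> 'a \<Rightarrow> complex" where
  "iter_partial [] f = f"
| "iter_partial (b # bs) f = (\<lambda>z. frechet_derivative (iter_partial bs f) (at z) b)"

definition schwartz :: "('a::euclidean_space \<Rightarrow> complex) set" where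
  "schwartz = {f. \<forall>bs. set bs \<subseteq> Basis \<longrightarrow>
      (\<forall>z. iter_partial bs f differentiable (at z)) \<and>
      (\<forall>k::nat. bounded (range (\<lambda>z. norm z ^ k *\<^sub>R iter_partial bs f z)))}"

text \<open>
  Square-integrable functions, as Borel representatives of the elements of \<open>L\<^sup>2\<close>.
  \<open>L2_norm f\<close> is the \<open>L\<^sup>2\<close> norm only for \<open>f \<in> L2_space\<close>: the Bochner integral is 0 when the
  integrand is not integrable.
\<close>
definition L2_space :: "('a::euclidean_space \<Rightarrow> complex) set" where
  "L2_space = {f. f \<in> borel_measurable lborel \<and> integrable lborel (\<lambda>z. (cmod (f z))\<^sup>2)}"

definition L2_norm :: "('a::euclidean_space \<Rightarrow> complex) \<Rightarrow> real" where
  "L2_norm f = sqrt (LINT z|lborel. (cmod (f z))\<^sup>2)"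

definition fourier :: "('a::euclidean_space \<Rightarrow> complex) \<Rightarrow> 'a \<Rightarrow> complex" where
  "fourier f w = (LINT z|lborel. exp (- \<i> * complex_of_real (z \<bullet> w)) * f z)"

text \<open>
  The Fourier transform on \<open>L\<^sup>2\<close>, where the integral defining \<^const>\<open>fourier\<close> need not converge:
  \<open>g\<close> is the transform of \<open>u\<close> as a tempered distribution.  The relation determines \<open>g\<close> from \<open>u\<close>,
  and \<open>u\<close> from \<open>g\<close>, up to null sets, and for Schwartz \<open>u\<close> it holds with \<open>g = fourier u\<close>.
\<close>
definition has_fourier_L2 ::
  "('a::euclidean_space \<Rightarrow> complex) \<Rightarrow> ('a \<Rightarrow> complex) \<Rightarrow> bool" where
  "has_fourier_L2 u g \<longleftrightarrow> u \<in> L2_space \<and> g \<in> L2_space \<and>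
     (\<forall>\<phi>\<in>schwartz. (LINT z|lborel. u z * fourier \<phi> z) = (LINT w|lborel. g w * \<phi> w))"

text \<open>
  The Fourier multiplier with symbol \<open>\<chi>\<^sub>A\<close>, for Borel \<open>A\<close> and \<open>u \<in> L2_space\<close>.  The choice operator
  only selects a representative: the function is determined almost everywhere.
\<close>
definition multiplier ::
  "'a::euclidean_space set \<Rightarrow> ('a \<Rightarrow> complex) \<Rightarrow> 'a \<Rightarrow> complex" where
  "multiplier A u =
     (SOME v. \<exists>g. has_fourier_L2 u g \<and> has_fourier_L2 v (\<lambda>w. indicator A w * g w))"

text \<open>
  The thickened truncated null cone with implied constant \<open>M\<close>; the sign is \<open>s = 1\<close> or \<open>s = -1\<close>.
\<close>
definition null_cone :: "real \<Rightarrow> real \<Rightarrow> real \<Rightarrow> real \<Rightarrow> spacetime set" where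
  "null_cone M s N L = {(\<tau>, \<xi>). norm \<xi> \<le> M * N \<and> \<bar>\<tau> - s * norm \<xi>\<bar> \<le> M * L}"

end

theory Submission
  imports Defs "HOL-Probability.Characteristic_Functions"
begin

text \<open>
  By Plancherel the estimate is a bound, with non-negative functions \<open>f\<^sub>j\<close> supported in the three cones,
  for the form \<open>\<integral>\<integral> f\<^sub>0(x) f\<^sub>1(y) f\<^sub>2(-x-y) dx dy\<close>, which is symmetric in the three functions; this reduces
  the second and third quantities to the first.  Two applications of Cauchy--Schwarz bound its square by
  the product of the \<open>\<parallel>f\<^sub>j\<parallel>\<^sup>2\<close> and the supremum over \<open>x\<close> of the volume of
  \<open>K\<^sub>1 \<inter> (x - K\<^sub>2)\<close>.  Since \<open>\<parallel>v\<^sub>1 v\<^sub>2\<parallel> = \<parallel>v\<^sub>1 cnj v\<^sub>2\<parallel>\<close>, the signs of these two cones may be taken equal.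
  The intersection then lies over a thickened ellipse with foci \<open>0\<close> and the spatial part of \<open>x\<close>, whose
  sections perpendicular to the major axis have length \<open>O((N\<^sub>m\<^sub>i\<^sub>n L\<^sub>m\<^sub>a\<^sub>x)\<^sup>1\<^sup>/\<^sup>2)\<close>.
  When \<open>N\<^sub>0\<close> is the smallest frequency, \<open>f\<^sub>1\<close> and \<open>f\<^sub>2\<close> are first localised to discs of radius
  \<open>O(N\<^sub>0)\<close> centred at \<open>a\<close> and \<open>-a\<close>, and the localised estimates are integrated over \<open>a\<close>.
\<close>

section \<open>Gaussians\<close>

text \<open>Equal signs matter because the two cone conditions on the time variable can then be
  added: eliminating it bounds the sum of the distances to the foci. Away from the axis both
  distances grow, so a bound on the sum bounds each increment; for opposite signs a difference would
  appear, in which the increments can cancel. The fibre in time over a fixed frequency has length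
  comparable to the smaller thickness, while the larger one is the thickness of the elliptic shell.
  This is how the minimum receives the exponent 1/2 and the maximum 1/4. Using the area of a disc in
  place of the shell gives the fourth quantity.

  On the analytic side a multiplier is known only through duality with Schwartz functions and only
  up to null sets. The cones are bounded, so truncated transforms are integrable and multipliers
  become inverse Fourier integrals almost everywhere. The uniqueness behind this rests on Gaussians,
  which are explicit Schwartz functions with explicit transforms. The geometric part takes place in
  \<open>ennreal\<close>, after passing to absolute values on the Fourier side.\<close>

lemma prod_lborel:
  fixes f :: "'a::euclidean_space \<Rightarrow> real \<Rightarrow> complex"
  assumes f: "\<And>b. b \<in> Basis \<Longrightarrow> integrable lborel (f b)"
  shows integrable_prod_lborel: "integrable lborel (\<lambda>x::'a. \<Prod>b\<in>Basis. f b (x \<bullet> b))"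
    and integral_prod_lborel:
      "(LINT x|lborel. (\<Prod>b\<in>Basis. f b ((x::'a) \<bullet> b))) = (\<Prod>b\<in>Basis. LINT t|lborel. f b t)"
proof -
  interpret product_sigma_finite "\<lambda>_::'a. lborel :: real measure" ..
  let ?P = "\<Pi>\<^sub>M b\<in>(Basis::'a set). (lborel :: real measure)"
  have eq: "(\<Prod>b\<in>Basis. f b ((\<Sum>c\<in>Basis. g c *\<^sub>R c) \<bullet> b)) = (\<Prod>b\<in>Basis. f b (g b))" for g :: "'a \<Rightarrow> real"
    by (intro prod.cong) (auto simp: inner_sum_left inner_Basis if_distrib sum.If_cases cong: if_cong)
  have m[measurable]: "f b \<in> borel_measurable borel" if "b \<in> Basis" for b
    using f[OF that] by auto
  have m2[measurable]: "(\<lambda>x::'a. \<Prod>b\<in>Basis. f b (x \<bullet> b)) \<in> borel_measurable borel"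
    by (intro borel_measurable_prod measurable_compose[OF _ m]) auto
  have m3[measurable]: "(\<lambda>g. \<Sum>b\<in>Basis. g b *\<^sub>R b) \<in> measurable ?P (borel :: 'a measure)"
    by measurable
  show "integrable lborel (\<lambda>x::'a. \<Prod>b\<in>Basis. f b (x \<bullet> b))"
    apply (subst lborel_eq, subst integrable_distr_eq)
      apply (rule m3, rule m2)
    unfolding eq by (intro product_integrable_prod) (auto intro: f)
  show "(LINT x|lborel. (\<Prod>b\<in>Basis. f b ((x::'a) \<bullet> b))) = (\<Prod>b\<in>Basis. LINT t|lborel. f b t)"
    apply (subst lborel_eq, subst integral_distr)
      apply (rule m3, rule m2)
    unfolding eq by (intro product_integral_prod) (auto intro: f)
qed

text \<open>Rescaling by \<open>sqrt e\<close> reduces both claims to the characteristic function of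
  the standard normal law.\<close>

lemma gaussian_1d:
  fixes e t :: real
  assumes e: "e > 0"
  shows "integrable lborel (\<lambda>x. exp (- \<i> * complex_of_real (x * t)) * exp (- (e/2) * x\<^sup>2))"
    and "(LINT x|lborel. exp (- \<i> * complex_of_real (x * t)) * exp (- (e/2) * x\<^sup>2)) =
         sqrt (2*pi/e) * exp (- t\<^sup>2 / (2*e))"
proof -
  let ?s = "1 / sqrt e"
  let ?h = "\<lambda>t x. std_normal_density x *\<^sub>R iexp (t * x)"
  have int: "integrable lborel (?h t)" for t
  proof -
    have "integrable lborel std_normal_density"
      by (rule integrable_normal_density) simp
    then have "integrable lborel (\<lambda>x. complex_of_real (std_normal_density x))" by simp
    then show ?thesis
      by (rule Bochner_Integration.integrable_bound) (auto simp: norm_mult)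
  qed
  have val: "(LINT x|lborel. ?h t x) = exp (- t\<^sup>2/2)" for t
  proof -
    have "(LINT x|lborel. ?h t x) = char std_normal_distribution t"
      unfolding char_def
      by (subst integral_density) (auto simp: normal_density_nonneg)
    then show ?thesis by (simp add: char_std_normal_distribution)
  qed
  have eq: "complex_of_real (sqrt (2*pi)) * ?h (- t * ?s) (0 + sqrt e * x)
     = exp (- \<i> * complex_of_real (x * t)) * exp (- (e/2) * x\<^sup>2)" for x
    using e
    by (simp add: normal_density_def power_mult_distrib scaleR_conv_of_real exp_of_real
          flip: of_real_mult mult.assoc) (simp add: mult_ac exp_minus)
  have "integrable lborel (\<lambda>x. complex_of_real (sqrt (2*pi)) * ?h (- t * ?s) (0 + sqrt e * x))"
    by (intro integrable_mult_right lborel_integrable_real_affine int) (use e in auto)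
  then show "integrable lborel (\<lambda>x. exp (- \<i> * complex_of_real (x * t)) * exp (- (e/2) * x\<^sup>2))"
    unfolding eq .
  have "(LINT x|lborel. ?h (- t * ?s) x) = sqrt e *\<^sub>R (LINT x|lborel. ?h (- t * ?s) (0 + sqrt e * x))"
    using lborel_integral_real_affine[of "sqrt e" "?h (- t * ?s)" 0] e by simp
  then have A: "complex_of_real (sqrt e) * (LINT x|lborel. ?h (- t * ?s) (0 + sqrt e * x)) = exp (- (- t * ?s)\<^sup>2/2)"
    unfolding val by (simp only: scaleR_conv_of_real)
  have B: "(LINT x|lborel. ?h (- t * ?s) (0 + sqrt e * x)) = exp (- (- t * ?s)\<^sup>2/2) / sqrt e"
  proof -
    have *: "I = complex_of_real (y / r)" if "complex_of_real r * I = complex_of_real y" "r \<noteq> 0" for I r y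
      using that by (simp add: nonzero_eq_divide_eq mult.commute)
    show ?thesis by (rule *[OF A]) (use e in auto)
  qed
  have "- (- t * ?s)\<^sup>2 / 2 = - t\<^sup>2 / (2*e)"
    using e by (simp add: power_divide)
  then have C: "sqrt (2*pi) * (exp (- (- t * ?s)\<^sup>2/2) / sqrt e) = sqrt (2*pi/e) * exp (- t\<^sup>2 / (2*e))"
    by (simp only: real_sqrt_divide) simp
  have "(LINT x|lborel. complex_of_real (sqrt (2*pi)) * ?h (- t * ?s) (0 + sqrt e * x))
     = complex_of_real (sqrt (2*pi) * (exp (- (- t * ?s)\<^sup>2/2) / sqrt e))"
    by (subst integral_mult_right_zero, subst B) (simp only: of_real_mult)
  then show "(LINT x|lborel. exp (- \<i> * complex_of_real (x * t)) * exp (- (e/2) * x\<^sup>2)) =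
         sqrt (2*pi/e) * exp (- t\<^sup>2 / (2*e))"
    unfolding eq C .
qed

definition gauss :: "real \<Rightarrow> 'a::euclidean_space \<Rightarrow> real" where
  "gauss e x = exp (- (e/2) * (norm x)\<^sup>2)"

text \<open>The Fourier transform of \<open>gauss e\<close>. Its mass
  \<open>(2*pi) ^ DIM('a)\<close> does not depend on \<open>e\<close> and sits at scale
  \<open>sqrt e\<close>, so up to this factor it is an approximate identity as \<open>e\<close>
  tends to 0.\<close>

definition gauss_hat :: "real \<Rightarrow> 'a::euclidean_space \<Rightarrow> real" where
  "gauss_hat e x = sqrt (2*pi/e) ^ DIM('a) * gauss (1/e) x"

lemma gauss_measurable[measurable]: "gauss e \<in> borel_measurable borel"
  unfolding gauss_def by measurable

lemma gauss_hat_measurable[measurable]: "gauss_hat e \<in> borel_measurable borel"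
  unfolding gauss_hat_def by measurable

lemma norm_sq_Basis: "(norm (x::'a::euclidean_space))\<^sup>2 = (\<Sum>b\<in>Basis. (x \<bullet> b)\<^sup>2)"
  unfolding power2_norm_eq_inner by (subst euclidean_inner) (simp add: power2_eq_square)

lemma gauss_eq_prod: "gauss e (x::'a::euclidean_space) = (\<Prod>b\<in>Basis. exp (- (e/2) * (x \<bullet> b)\<^sup>2))"
  unfolding gauss_def norm_sq_Basis by (simp add: exp_sum sum_distrib_left flip: sum_negf)

lemma gauss_pos: "gauss e x > 0"
  by (simp add: gauss_def)

lemma gauss_hat_nonneg: "e > 0 \<Longrightarrow> gauss_hat e x \<ge> 0"
  unfolding gauss_hat_def by (simp add: less_imp_le[OF gauss_pos])

lemma gauss_le_1: "e > 0 \<Longrightarrow> gauss e x \<le> 1"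
  by (simp add: gauss_def)

lemma fourier_gauss:
  fixes w :: "'a::euclidean_space"
  assumes e: "e > 0"
  shows integrable_exp_gauss: "integrable lborel (\<lambda>x. exp (- \<i> * complex_of_real (x \<bullet> w)) * gauss e x)"
    and "fourier (\<lambda>x. complex_of_real (gauss e x)) w = gauss_hat e w"
proof -
  have eq: "exp (- \<i> * complex_of_real (x \<bullet> w)) * gauss e x =
     (\<Prod>b\<in>Basis. exp (- \<i> * complex_of_real ((x \<bullet> b) * (w \<bullet> b))) * exp (- (e/2) * (x \<bullet> b)\<^sup>2))" for x
    by (subst euclidean_inner)
       (simp add: gauss_eq_prod prod.distrib exp_sum sum_distrib_left flip: sum_negf)
  show "integrable lborel (\<lambda>x. exp (- \<i> * complex_of_real (x \<bullet> w)) * gauss e x)"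
    unfolding eq using gaussian_1d(1)[OF e] by (rule integrable_prod_lborel)
  have "fourier (\<lambda>x. complex_of_real (gauss e x)) w = (\<Prod>b\<in>Basis. complex_of_real (sqrt (2*pi/e) * exp (- (w \<bullet> b)\<^sup>2 / (2*e))))"
    unfolding fourier_def eq
    by (subst integral_prod_lborel[OF gaussian_1d(1)[OF e]]) (simp only: gaussian_1d(2)[OF e])
  also have "\<dots> = of_real (\<Prod>b\<in>Basis. sqrt (2*pi/e) * exp (- (1/e/2) * (w \<bullet> b)\<^sup>2))"
    using e by (simp only: of_real_prod) (simp add: mult.commute[of _ 2])
  also have "\<dots> = gauss_hat e w"
    unfolding gauss_hat_def gauss_eq_prod prod.distrib by simp
  finally show "fourier (\<lambda>x. complex_of_real (gauss e x)) w = gauss_hat e w" .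
qed

lemma integrable_gauss: "e > 0 \<Longrightarrow> integrable lborel (gauss e :: 'a::euclidean_space \<Rightarrow> real)"
  using integrable_exp_gauss[of e "0::'a"] by (simp add: complex_of_real_integrable_eq)

lemma integral_gauss:
  assumes "e > 0"
  shows "(LINT x|lborel. gauss e (x::'a::euclidean_space)) = sqrt (2*pi/e) ^ DIM('a)"
proof -
  have "complex_of_real (LINT x|lborel. gauss e (x::'a)) = complex_of_real (sqrt (2*pi/e) ^ DIM('a))"
    using fourier_gauss(2)[OF assms, of "0::'a"]
    by (simp add: fourier_def gauss_hat_def gauss_def del: of_real_power)
  then show ?thesis by (simp only: of_real_eq_iff)
qed

lemma integrable_gauss_hat: "e > 0 \<Longrightarrow> integrable lborel (gauss_hat e :: 'a::euclidean_space \<Rightarrow> real)"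
  unfolding gauss_hat_def by (intro integrable_mult_right integrable_gauss) simp

lemma integral_gauss_hat:
  assumes e: "e > 0"
  shows "(LINT x|lborel. gauss_hat e (x::'a::euclidean_space)) = (2*pi) ^ DIM('a)"
proof -
  have "2*pi/e * (2*pi/(1/e)) = (2*pi)\<^sup>2"
    using e by (simp add: power2_eq_square)
  then have "sqrt (2*pi/e) * sqrt (2*pi/(1/e)) = 2*pi"
    by (simp only: real_sqrt_mult[symmetric] real_sqrt_abs) simp
  then have "sqrt (2*pi/e) ^ DIM('a) * sqrt (2*pi/(1/e)) ^ DIM('a) = (2*pi) ^ DIM('a)"
    by (simp only: power_mult_distrib[symmetric])
  then show ?thesis
    unfolding gauss_hat_def using integral_gauss[of "1/e", where 'a='a] e
    by (simp only: integral_mult_right_zero) simp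
qed

section \<open>Plancherel and Parseval\<close>

lemma nn_integral_lborel_shift:
  fixes c :: "'a::euclidean_space"
  assumes [measurable]: "f \<in> borel_measurable borel"
  shows "(\<integral>\<^sup>+x. f (x - c) \<partial>lborel) = (\<integral>\<^sup>+x. f x \<partial>lborel)"
  using lborel_distr_plus[of "-c"] nn_integral_distr[of "(+) (-c)" lborel borel f] by simp

lemma nn_integral_lborel_reflect:
  fixes c :: "'a::euclidean_space"
  assumes [measurable]: "f \<in> borel_measurable borel"
  shows "(\<integral>\<^sup>+x. f (c - x) \<partial>lborel) = (\<integral>\<^sup>+x. f x \<partial>lborel)"
  by (subst (2) lborel_affine[of "-1" c]) (simp_all add: nn_integral_density nn_integral_distr)

lemma integral_lborel_shift:
  fixes c :: "'a::euclidean_space" and f :: "'a \<Rightarrow> complex"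
  assumes [measurable]: "f \<in> borel_measurable borel"
  shows "(LINT x|lborel. f (x - c)) = (LINT x|lborel. f x)"
  using lborel_distr_plus[of "-c"] integral_distr[of "(+) (-c)" lborel borel f] by simp

lemma integrable_lborel_shift:
  fixes c :: "'a::euclidean_space" and f :: "'a \<Rightarrow> 'b::{banach, second_countable_topology}"
  assumes "integrable lborel f"
  shows "integrable lborel (\<lambda>x. f (x - c))"
  using lborel_distr_plus[of "-c"] integrable_distr[of "(+) (-c)" lborel borel f] assms by simp

lemma fourier_measurable[measurable]:
  assumes [measurable]: "f \<in> borel_measurable borel"
  shows "fourier f \<in> borel_measurable borel"
  unfolding fourier_def by measurable

lemma integrable_mult_exp:
  fixes f :: "'a::euclidean_space \<Rightarrow> complex"
  assumes "integrable lborel f"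
  shows "integrable lborel (\<lambda>z. exp (- \<i> * complex_of_real (z \<bullet> w)) * f z)"
  using assms by (rule Bochner_Integration.integrable_bound) (use assms in \<open>auto simp: norm_mult\<close>)

lemma norm_fourier_le:
  fixes f :: "'a::euclidean_space \<Rightarrow> complex"
  shows "cmod (fourier f w) \<le> (LINT z|lborel. cmod (f z))"
  unfolding fourier_def
  by (rule order_trans[OF integral_norm_bound]) (simp add: norm_mult)

lemma integrable_fourier_mult:
  fixes f g :: "'a::euclidean_space \<Rightarrow> complex"
  assumes f: "integrable lborel f" and g: "integrable lborel g"
  shows "integrable lborel (\<lambda>z. fourier f z * g z)"
proof (rule Bochner_Integration.integrable_bound)
  show "integrable lborel (\<lambda>z. (LINT z|lborel. cmod (f z)) *\<^sub>R g z)"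
    using g by simp
  show "AE z in lborel. norm (fourier f z * g z) \<le> norm ((LINT z|lborel. cmod (f z)) *\<^sub>R g z)"
    by (auto simp: norm_mult intro!: mult_right_mono norm_fourier_le order_trans[OF norm_fourier_le abs_ge_self])
qed (use f g in measurable)

lemma integrable_prod_mult:
  fixes f :: "'a::euclidean_space \<Rightarrow> complex" and g :: "'b::euclidean_space \<Rightarrow> complex"
  assumes f: "integrable lborel f" and g: "integrable lborel g"
  shows "integrable (lborel \<Otimes>\<^sub>M lborel) (\<lambda>(x, y). f x * g y)"
proof (rule lborel_pair.Fubini_integrable)
  show "(\<lambda>(x, y). f x * g y) \<in> borel_measurable (lborel \<Otimes>\<^sub>M lborel)"
    using f g by measurable
qed (use f g in \<open>auto simp: norm_mult\<close>)

text \<open>Fubini for the exponential kernel, which is symmetric in the two variables. The scale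
  \<open>s\<close> is 1 for duality and -1 where a transform is evaluated at reflected
  frequencies.\<close>

lemma fourier_multiplication_formula:
  fixes f g :: "'a::euclidean_space \<Rightarrow> complex" and s :: real
  assumes f: "integrable lborel f" and g: "integrable lborel g"
  shows "(LINT z|lborel. fourier f (s *\<^sub>R z) * g z) = (LINT w|lborel. f w * fourier g (s *\<^sub>R w))"
proof -
  have [measurable]: "f \<in> borel_measurable borel" "g \<in> borel_measurable borel"
    using f g by auto
  let ?k = "\<lambda>w z. exp (- \<i> * complex_of_real (s * (w \<bullet> z))) * (f w * g z)"
  have int: "integrable (lborel \<Otimes>\<^sub>M lborel) (\<lambda>(w, z). ?k w z)"
    by (rule Bochner_Integration.integrable_bound[OF integrable_prod_mult[OF f g]])
       (auto simp: norm_mult)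
  have "(LINT z|lborel. fourier f (s *\<^sub>R z) * g z) = (LINT z|lborel. (LINT w|lborel. ?k w z))"
    unfolding fourier_def by (simp add: mult.assoc flip: integral_mult_left_zero)
  also have "\<dots> = (LINT w|lborel. (LINT z|lborel. ?k w z))"
    by (rule lborel_pair.Fubini_integral[OF int])
  also have "\<dots> = (LINT w|lborel. f w * fourier g (s *\<^sub>R w))"
    unfolding fourier_def by (simp add: mult_ac inner_commute flip: integral_mult_right_zero)
  finally show ?thesis .
qed

section \<open>Gaussian summability and the Plancherel inequality\<close>

lemma fourier_gauss_weight:
  fixes \<phi> :: "'a::euclidean_space \<Rightarrow> complex"
  assumes \<phi>: "integrable lborel \<phi>" and e: "e > 0"
  shows "fourier (\<lambda>z. fourier \<phi> z * gauss e z) (- x) = (LINT y|lborel. gauss_hat e (y - x) * \<phi> y)"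
proof -
  \<comment> \<open>Modulating the Gaussian translates its transform by \<open>x\<close>, so the
    multiplication formula produces an average of \<open>\<phi>\<close> around
    \<open>x\<close>.\<close>
  let ?h = "\<lambda>z. exp (- \<i> * complex_of_real (z \<bullet> (- x))) * complex_of_real (gauss e z)"
  have h: "integrable lborel ?h"
    by (rule integrable_exp_gauss[OF e])
  have h': "fourier ?h y = gauss_hat e (y - x)" for y
    unfolding fourier_gauss(2)[OF e, of "y - x", symmetric] fourier_def
    by (intro Bochner_Integration.integral_cong refl)
       (simp add: inner_diff_right algebra_simps flip: exp_add mult.assoc)
  have "fourier (\<lambda>z. fourier \<phi> z * gauss e z) (- x) = (LINT z|lborel. fourier \<phi> (1 *\<^sub>R z) * ?h z)"
    unfolding fourier_def[of "\<lambda>z. fourier \<phi> z * gauss e z"]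
    by (intro Bochner_Integration.integral_cong refl) simp
  also have "\<dots> = (LINT y|lborel. \<phi> y * fourier ?h (1 *\<^sub>R y))"
    by (rule fourier_multiplication_formula[OF \<phi> h])
  finally show ?thesis
    unfolding scaleR_one h' by (simp add: mult.commute)
qed

lemma integrable_fourier_gauss:
  fixes \<phi> :: "'a::euclidean_space \<Rightarrow> complex"
  assumes \<phi>: "integrable lborel \<phi>" and e: "e > 0"
  shows "integrable lborel (\<lambda>z. fourier \<phi> z * gauss e z)"
  by (intro integrable_fourier_mult \<phi>) (simp add: complex_of_real_integrable_eq integrable_gauss[OF e])

text \<open>The multiplication formula at scale -1, applied to \<open>f\<close> and the weighted
  transform of \<open>\<phi>\<close>. The Gaussian weight makes the left integral absolutely
  convergent for all integrable \<open>f\<close> and \<open>\<phi>\<close>.\<close>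

lemma parseval_gauss:
  fixes f \<phi> :: "'a::euclidean_space \<Rightarrow> complex"
  assumes f: "integrable lborel f" and \<phi>: "integrable lborel \<phi>" and e: "e > 0"
  shows "(LINT z|lborel. fourier f (- z) * (fourier \<phi> z * gauss e z)) =
    (LINT x|lborel. f x * (LINT y|lborel. gauss_hat e (y - x) * \<phi> y))"
  using fourier_multiplication_formula[OF f integrable_fourier_gauss[OF \<phi> e], of "-1"]
  by (simp add: fourier_gauss_weight[OF \<phi> e])

lemma norm_integral_le_nn_integral:
  fixes f :: "'a \<Rightarrow> 'b::{banach, second_countable_topology}"
  shows "ennreal (norm (LINT x|M. f x)) \<le> (\<integral>\<^sup>+x. ennreal (norm (f x)) \<partial>M)"
  by (cases "integrable M f") (auto simp: integral_norm_bound_ennreal not_integrable_integral_eq)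

lemma cnj_fourier: "cnj (fourier f z) = fourier (\<lambda>x. cnj (f x)) (- z)"
  unfolding fourier_def by (subst Bochner_Integration.integral_cnj[symmetric]) (simp add: exp_cnj)

lemma nn_integral_gauss_hat:
  assumes e: "e > 0"
  shows "(\<integral>\<^sup>+y. ennreal (gauss_hat e (y::'a::euclidean_space)) \<partial>lborel) = ennreal ((2*pi) ^ DIM('a))"
  by (subst nn_integral_eq_integral[OF integrable_gauss_hat[OF e]])
     (auto simp: gauss_hat_nonneg[OF e] integral_gauss_hat[OF e])

text \<open>
  Schur's test for the kernel \<open>gauss_hat e (y - x)\<close>, which is non-negative with integral \<open>(2\<pi>)\<^sup>n\<close>.
\<close>

lemma plancherel_gauss_le:
  fixes f :: "'a::euclidean_space \<Rightarrow> complex"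
  assumes f: "integrable lborel f" and e: "e > 0"
  shows "(\<integral>\<^sup>+z. ennreal ((cmod (fourier f z))\<^sup>2 * gauss e z) \<partial>lborel) \<le>
    ennreal ((2*pi) ^ DIM('a)) * (\<integral>\<^sup>+x. ennreal ((cmod (f x))\<^sup>2) \<partial>lborel)"
proof -
  have [measurable]: "f \<in> borel_measurable borel"
    using f by auto
  let ?c = "ennreal ((2*pi) ^ DIM('a))" and ?F = "\<lambda>x. ennreal ((cmod (f x))\<^sup>2)"
  let ?g = "\<lambda>z. ennreal (gauss_hat e z)"
  have cf: "integrable lborel (\<lambda>x. cnj (f x))"
    using f by simp
  \<comment> \<open>With \<open>cnj f\<close> as the first function the reflected transform becomes
    a conjugate, and the left side of \<open>parseval_gauss\<close> turns into a weighted
    square.\<close>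
  have eq: "fourier (\<lambda>x. cnj (f x)) (- z) * (fourier f z * gauss e z) = complex_of_real ((cmod (fourier f z))\<^sup>2 * gauss e z)" for z
    unfolding cnj_fourier[symmetric] of_real_mult complex_norm_square by (simp add: mult_ac)
  have "integrable lborel (\<lambda>z. fourier f z * (cnj (fourier f z * gauss e z)))"
    using integrable_fourier_gauss[OF f e] by (intro integrable_fourier_mult[OF f]) (simp only: complex_integrable_cnj)
  also have "(\<lambda>z. fourier f z * (cnj (fourier f z * gauss e z))) = (\<lambda>z. complex_of_real ((cmod (fourier f z))\<^sup>2 * gauss e z))"
    unfolding of_real_mult complex_norm_square by (simp add: mult_ac)
  finally have int: "integrable lborel (\<lambda>z. (cmod (fourier f z))\<^sup>2 * gauss e z)"
    by (simp only: complex_of_real_integrable_eq)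
  let ?I = "LINT z|lborel. (cmod (fourier f z))\<^sup>2 * gauss e z"
  have g0: "0 \<le> gauss e z" for z :: 'a by (simp add: less_imp_le gauss_pos)
  have "?I \<ge> 0" by (intro integral_nonneg_AE) (auto simp: g0)
  have I_eq: "complex_of_real ?I = (LINT x|lborel. cnj (f x) * (LINT y|lborel. gauss_hat e (y - x) * f y))"
    unfolding parseval_gauss[OF cf f e, symmetric] eq by (rule integral_complex_of_real[symmetric])
  have "cmod (complex_of_real ?I) = ?I"
    using \<open>?I \<ge> 0\<close> by (simp only: norm_of_real abs_of_nonneg)
  then have "?I = cmod (LINT x|lborel. cnj (f x) * (LINT y|lborel. gauss_hat e (y - x) * f y))"
    unfolding I_eq[symmetric] by (rule sym)
  then have "ennreal ?I \<le> (\<integral>\<^sup>+x. ennreal (cmod (cnj (f x) * (LINT y|lborel. gauss_hat e (y - x) * f y))) \<partial>lborel)"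
    by (simp only: norm_integral_le_nn_integral)
  also have "\<dots> \<le> (\<integral>\<^sup>+x. (\<integral>\<^sup>+y. ?g (y - x) * ennreal (cmod (f x) * cmod (f y)) \<partial>lborel) \<partial>lborel)"
  proof (rule nn_integral_mono)
    fix x :: 'a
    have "ennreal (cmod (LINT y|lborel. gauss_hat e (y - x) * f y)) \<le> (\<integral>\<^sup>+y. ?g (y - x) * ennreal (cmod (f y)) \<partial>lborel)"
      by (rule order_trans[OF norm_integral_le_nn_integral])
         (simp add: norm_mult gauss_hat_nonneg[OF e] ennreal_mult)
    then have "ennreal (cmod (f x)) * ennreal (cmod (LINT y|lborel. gauss_hat e (y - x) * f y)) \<le>
       ennreal (cmod (f x)) * (\<integral>\<^sup>+y. ?g (y - x) * ennreal (cmod (f y)) \<partial>lborel)"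
      by (rule mult_left_mono) simp
    then show "ennreal (cmod (cnj (f x) * (LINT y|lborel. gauss_hat e (y - x) * f y))) \<le>
       (\<integral>\<^sup>+y. ?g (y - x) * ennreal (cmod (f x) * cmod (f y)) \<partial>lborel)"
      by (subst (asm) nn_integral_cmult[symmetric]) (auto simp: norm_mult ennreal_mult mult_ac)
  qed
  also have "\<dots> \<le> (\<integral>\<^sup>+x. (\<integral>\<^sup>+y. ?g (y - x) * (?F x / 2) + ?g (y - x) * (?F y / 2) \<partial>lborel) \<partial>lborel)"
  proof (intro nn_integral_mono)
    fix x y :: 'a
    have "cmod (f x) * cmod (f y) \<le> (cmod (f x))\<^sup>2 / 2 + (cmod (f y))\<^sup>2 / 2"
      using sum_squares_bound[of "cmod (f x)" "cmod (f y)"] by simp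
    then have "ennreal (cmod (f x) * cmod (f y)) \<le> ?F x / 2 + ?F y / 2"
      by (simp add: ennreal_leI ennreal_divide_numeral flip: ennreal_plus)
    then show "?g (y - x) * ennreal (cmod (f x) * cmod (f y)) \<le> ?g (y - x) * (?F x / 2) + ?g (y - x) * (?F y / 2)"
      unfolding distrib_left[symmetric] by (rule mult_left_mono) simp
  qed
  also have "\<dots> = (\<integral>\<^sup>+x. (\<integral>\<^sup>+y. ?g (y - x) * (?F x / 2) \<partial>lborel) \<partial>lborel) + (\<integral>\<^sup>+x. (\<integral>\<^sup>+y. ?g (y - x) * (?F y / 2) \<partial>lborel) \<partial>lborel)"
    by (simp add: nn_integral_add)
  also have "(\<integral>\<^sup>+x. (\<integral>\<^sup>+y. ?g (y - x) * (?F y / 2) \<partial>lborel) \<partial>lborel) = (\<integral>\<^sup>+y. (\<integral>\<^sup>+x. ?g (y - x) * (?F y / 2) \<partial>lborel) \<partial>lborel)"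
    by (rule lborel_pair.Fubini') measurable
  also have "(\<integral>\<^sup>+y. (\<integral>\<^sup>+x. ?g (y - x) * (?F y / 2) \<partial>lborel) \<partial>lborel) = (\<integral>\<^sup>+y. ?c * (?F y / 2) \<partial>lborel)"
    by (simp add: nn_integral_multc nn_integral_lborel_reflect[of ?g] nn_integral_gauss_hat[OF e])
  also have "(\<integral>\<^sup>+x. (\<integral>\<^sup>+y. ?g (y - x) * (?F x / 2) \<partial>lborel) \<partial>lborel) = (\<integral>\<^sup>+y. ?c * (?F y / 2) \<partial>lborel)"
    by (simp add: nn_integral_multc nn_integral_lborel_shift[of ?g] nn_integral_gauss_hat[OF e])
  also have "(\<integral>\<^sup>+y. ?c * (?F y / 2) \<partial>lborel) + (\<integral>\<^sup>+y. ?c * (?F y / 2) \<partial>lborel) = (\<integral>\<^sup>+y. ?c * ?F y \<partial>lborel)"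
    by (subst nn_integral_add[symmetric]) (simp_all add: ennreal_divide_numeral flip: distrib_left ennreal_plus)
  finally have "ennreal ?I \<le> ?c * (\<integral>\<^sup>+y. ?F y \<partial>lborel)"
    by (simp add: nn_integral_cmult)
  then show ?thesis
    by (subst nn_integral_eq_integral[OF int]) (auto simp: g0)
qed

lemma gauss_tendsto_1: "(\<lambda>k. gauss (1 / real (Suc k)) z) \<longlonglongrightarrow> 1"
proof -
  have "(\<lambda>k. exp (- ((1 / real (Suc k))/2) * (norm z)\<^sup>2)) \<longlonglongrightarrow> exp (- (0/2) * (norm z)\<^sup>2)"
    by (intro tendsto_intros LIMSEQ_Suc[OF lim_1_over_n]) simp
  then show ?thesis by (simp add: gauss_def)
qed

text \<open>Fatou's lemma removes the Gaussian weight. The bound is later applied to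
  \<open>fourier\<close> and, after a reflection, to \<open>ifourier\<close>, so it controls norms
  in both directions.\<close>

theorem plancherel_le:
  fixes f :: "'a::euclidean_space \<Rightarrow> complex"
  assumes f: "integrable lborel f"
  shows "(\<integral>\<^sup>+z. ennreal ((cmod (fourier f z))\<^sup>2) \<partial>lborel) \<le>
    ennreal ((2*pi) ^ DIM('a)) * (\<integral>\<^sup>+x. ennreal ((cmod (f x))\<^sup>2) \<partial>lborel)" (is "_ \<le> ?R")
proof -
  have [measurable]: "f \<in> borel_measurable borel"
    using f by auto
  let ?G = "\<lambda>k z. ennreal ((cmod (fourier f z))\<^sup>2 * gauss (1 / real (Suc k)) z)"
  have "(\<lambda>k. ?G k z) \<longlonglongrightarrow> ennreal ((cmod (fourier f z))\<^sup>2 * 1)" for z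
    by (intro tendsto_intros gauss_tendsto_1)
  then have "liminf (\<lambda>k. ?G k z) = ennreal ((cmod (fourier f z))\<^sup>2)" for z
    using lim_imp_Liminf[OF sequentially_bot] by (metis mult.right_neutral)
  then have "(\<integral>\<^sup>+z. ennreal ((cmod (fourier f z))\<^sup>2) \<partial>lborel) = (\<integral>\<^sup>+z. liminf (\<lambda>k. ?G k z) \<partial>lborel)"
    by simp
  also have "\<dots> \<le> liminf (\<lambda>k. \<integral>\<^sup>+z. ?G k z \<partial>lborel)"
    by (intro nn_integral_liminf) measurable
  also have "\<dots> \<le> ?R"
    by (intro Liminf_le always_eventually allI plancherel_gauss_le f) auto
  finally show ?thesis .
qed

section \<open>Gaussian mollification and the Parseval identity\<close>

lemma gauss_hat_scale:
  assumes e: "e > 0"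
  shows "gauss_hat e (sqrt e *\<^sub>R u :: 'a::euclidean_space) * sqrt e ^ DIM('a) = gauss_hat 1 u"
proof -
  have "sqrt (2*pi/e) * sqrt e = sqrt (2*pi)"
    using e by (simp add: real_sqrt_divide)
  then have "sqrt (2*pi/e) ^ DIM('a) * sqrt e ^ DIM('a) = sqrt (2*pi) ^ DIM('a)"
    by (simp only: power_mult_distrib[symmetric])
  moreover have "gauss (1/e) (sqrt e *\<^sub>R u) = gauss 1 u"
    using e by (simp add: gauss_def power_mult_distrib)
  ultimately show ?thesis
    by (simp add: gauss_hat_def mult_ac)
qed

text \<open>Substituting \<open>y = x + sqrt e *\<^sub>R u\<close> moves the dependence on
  \<open>e\<close> from the kernel into the argument of \<open>\<phi>\<close>. The kernel is then
  fixed and serves as a majorant for dominated convergence.\<close>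

lemma integral_gauss_hat_rescale:
  fixes \<phi> :: "'a::euclidean_space \<Rightarrow> complex"
  assumes [measurable]: "\<phi> \<in> borel_measurable borel" and e: "e > 0"
  shows "(LINT y|lborel. gauss_hat e (y - x) * \<phi> y) = (LINT u|lborel. gauss_hat 1 u * \<phi> (x + sqrt e *\<^sub>R u))"
proof -
  have "(LINT y|lborel. gauss_hat e (y - x) * \<phi> y) =
     (LINT y|density (distr lborel borel (\<lambda>u::'a. x + sqrt e *\<^sub>R u)) (\<lambda>_. ennreal (\<bar>sqrt e\<bar>^DIM('a))). gauss_hat e (y - x) * \<phi> y)"
    using e by (subst lborel_affine[of "sqrt e" x, symmetric]) auto
  also have "\<dots> = (LINT y|distr lborel borel (\<lambda>u::'a. x + sqrt e *\<^sub>R u). \<bar>sqrt e\<bar>^DIM('a) *\<^sub>R (gauss_hat e (y - x) * \<phi> y))"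
    by (intro integral_density) (use e in auto)
  also have "\<dots> = (LINT u|lborel. \<bar>sqrt e\<bar>^DIM('a) *\<^sub>R (gauss_hat e (x + sqrt e *\<^sub>R u - x) * \<phi> (x + sqrt e *\<^sub>R u)))"
    by (intro integral_distr) auto
  also have "\<dots> = (LINT u|lborel. gauss_hat 1 u * \<phi> (x + sqrt e *\<^sub>R u))"
  proof (intro Bochner_Integration.integral_cong refl)
    fix u :: 'a
    have "complex_of_real (gauss_hat 1 u) = of_real (gauss_hat e (sqrt e *\<^sub>R u)) * of_real (sqrt e ^ DIM('a))"
      unfolding gauss_hat_scale[OF e, symmetric] of_real_mult ..
    then show "\<bar>sqrt e\<bar>^DIM('a) *\<^sub>R (gauss_hat e (x + sqrt e *\<^sub>R u - x) * \<phi> (x + sqrt e *\<^sub>R u))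
      = gauss_hat 1 u * \<phi> (x + sqrt e *\<^sub>R u)"
      using e by (simp add: scaleR_conv_of_real)
  qed
  finally show ?thesis .
qed

lemma gauss_hat_mollify_bound:
  fixes \<phi> :: "'a::euclidean_space \<Rightarrow> complex"
  assumes [measurable]: "\<phi> \<in> borel_measurable borel" and e: "e > 0" and B: "\<And>x. cmod (\<phi> x) \<le> B"
  shows "cmod (LINT y|lborel. gauss_hat e (y - x) * \<phi> y) \<le> (2*pi) ^ DIM('a) * B"
proof -
  have "cmod (LINT y|lborel. gauss_hat e (y - x) * \<phi> y) \<le> (LINT u|lborel. gauss_hat 1 (u::'a) * B)"
    unfolding integral_gauss_hat_rescale[OF assms(1) e]
    by (rule Bochner_Integration.integral_norm_bound_integral)
       (auto intro!: mult_left_mono B gauss_hat_nonneg integrable_gauss_hat AE_I2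
          Bochner_Integration.integrable_bound[OF integrable_mult_left[OF integrable_gauss_hat[of 1], of B]]
          simp: norm_mult gauss_hat_nonneg abs_mult order_trans[OF B abs_ge_self])
  also have "\<dots> = (2*pi) ^ DIM('a) * B"
    using integral_gauss_hat[of 1, where 'a='a] by simp
  finally show ?thesis .
qed

lemma gauss_hat_mollify_tendsto:
  fixes \<phi> :: "'a::euclidean_space \<Rightarrow> complex"
  assumes cont: "continuous_on UNIV \<phi>" and B: "\<And>x. cmod (\<phi> x) \<le> B"
  shows "(\<lambda>k. LINT y|lborel. gauss_hat (1 / real (Suc k)) (y - x) * \<phi> y) \<longlonglongrightarrow> (2*pi) ^ DIM('a) * \<phi> x"
proof -
  have [measurable]: "\<phi> \<in> borel_measurable borel"
    using cont by (rule borel_measurable_continuous_onI)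
  have "(\<lambda>k. LINT u|lborel. gauss_hat 1 u * \<phi> (x + sqrt (1 / real (Suc k)) *\<^sub>R u)) \<longlonglongrightarrow>
    (LINT u|lborel. gauss_hat 1 (u::'a) * \<phi> x)"
  proof (rule integral_dominated_convergence)
    show "integrable lborel (\<lambda>u::'a. gauss_hat 1 u * B)"
      by (intro integrable_mult_left integrable_gauss_hat) simp
    show "AE u in lborel. (\<lambda>k. complex_of_real (gauss_hat 1 u) * \<phi> (x + sqrt (1 / real (Suc k)) *\<^sub>R u)) \<longlonglongrightarrow> gauss_hat 1 u * \<phi> x"
    proof (rule AE_I2)
      fix u :: 'a
      have "(\<lambda>k. x + sqrt (1 / real (Suc k)) *\<^sub>R u) \<longlonglongrightarrow> x + sqrt 0 *\<^sub>R u"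
        by (intro tendsto_intros LIMSEQ_Suc[OF lim_1_over_n])
      then have "(\<lambda>k. \<phi> (x + sqrt (1 / real (Suc k)) *\<^sub>R u)) \<longlonglongrightarrow> \<phi> x"
        using continuous_on_tendsto_compose[OF cont] by simp
      then show "(\<lambda>k. complex_of_real (gauss_hat 1 u) * \<phi> (x + sqrt (1 / real (Suc k)) *\<^sub>R u)) \<longlonglongrightarrow> gauss_hat 1 u * \<phi> x"
        by (intro tendsto_intros)
    qed
  qed (auto simp: norm_mult gauss_hat_nonneg intro!: mult_left_mono B)
  also have "(LINT u|lborel. complex_of_real (gauss_hat 1 (u::'a)) * \<phi> x) = (2*pi) ^ DIM('a) * \<phi> x"
    by (simp add: integral_gauss_hat)
  finally show ?thesis
    by (simp add: integral_gauss_hat_rescale)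
qed

text \<open>The limit of \<open>parseval_gauss\<close> as the Gaussian parameter tends to 0. On the
  left \<open>prod\<close> supplies the majorant; on the right the mollified \<open>\<phi>\<close>
  stays bounded and converges pointwise by continuity. All regularity is asked of
  \<open>\<phi>\<close>, so that \<open>f\<close> may be a sharply truncated transform.\<close>

theorem parseval:
  fixes f \<phi> :: "'a::euclidean_space \<Rightarrow> complex"
  assumes f: "integrable lborel f" and \<phi>: "integrable lborel \<phi>"
    and cont: "continuous_on UNIV \<phi>" and B: "\<And>x. cmod (\<phi> x) \<le> B"
    and prod: "integrable lborel (\<lambda>z. fourier f (- z) * fourier \<phi> z)"
  shows "(LINT z|lborel. fourier f (- z) * fourier \<phi> z) = (2*pi) ^ DIM('a) * (LINT x|lborel. f x * \<phi> x)"
proof -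
  have [measurable]: "f \<in> borel_measurable borel" "\<phi> \<in> borel_measurable borel"
    using f \<phi> by auto
  let ?e = "\<lambda>k. 1 / real (Suc k)"
  have "(\<lambda>k. LINT z|lborel. fourier f (- z) * (fourier \<phi> z * gauss (?e k) z)) \<longlonglongrightarrow> (LINT z|lborel. fourier f (- z) * fourier \<phi> z)"
  proof (rule integral_dominated_convergence)
    show "integrable lborel (\<lambda>z. cmod (fourier f (- z) * fourier \<phi> z))"
      using prod by simp
    show "AE z in lborel. (\<lambda>k. fourier f (- z) * (fourier \<phi> z * gauss (?e k) z)) \<longlonglongrightarrow> fourier f (- z) * fourier \<phi> z"
    proof (rule AE_I2)
      fix z :: 'a
      have "(\<lambda>k. fourier f (- z) * (fourier \<phi> z * gauss (?e k) z)) \<longlonglongrightarrow> fourier f (- z) * (fourier \<phi> z * of_real 1)"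
        by (intro tendsto_intros gauss_tendsto_1)
      then show "(\<lambda>k. fourier f (- z) * (fourier \<phi> z * gauss (?e k) z)) \<longlonglongrightarrow> fourier f (- z) * fourier \<phi> z"
        by simp
    qed
    show "AE z in lborel. norm (fourier f (- z) * (fourier \<phi> z * gauss (?e k) z)) \<le> cmod (fourier f (- z) * fourier \<phi> z)" for k
      by (auto simp: norm_mult abs_of_pos[OF gauss_pos] gauss_le_1 intro!: mult_left_mono mult_right_le_one_le less_imp_le[OF gauss_pos])
  qed auto
  moreover have "(\<lambda>k. LINT x|lborel. f x * (LINT y|lborel. gauss_hat (?e k) (y - x) * \<phi> y)) \<longlonglongrightarrow>
     (LINT x|lborel. f x * ((2*pi) ^ DIM('a) * \<phi> x))"
  proof (rule integral_dominated_convergence)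
    show "integrable lborel (\<lambda>x. cmod (f x) * ((2*pi) ^ DIM('a) * B))"
      using f by simp
    show "AE x in lborel. (\<lambda>k. f x * (LINT y|lborel. gauss_hat (?e k) (y - x) * \<phi> y)) \<longlonglongrightarrow> f x * ((2*pi) ^ DIM('a) * \<phi> x)"
      by (intro AE_I2 tendsto_mult tendsto_const gauss_hat_mollify_tendsto[where B=B] cont B)
    show "AE x in lborel. norm (f x * (LINT y|lborel. gauss_hat (?e k) (y - x) * \<phi> y)) \<le> cmod (f x) * ((2*pi) ^ DIM('a) * B)" for k
      unfolding norm_mult by (intro AE_I2 mult_left_mono gauss_hat_mollify_bound B) auto
  qed auto
  moreover have "(LINT z|lborel. fourier f (- z) * (fourier \<phi> z * gauss (?e k) z)) =
     (LINT x|lborel. f x * (LINT y|lborel. gauss_hat (?e k) (y - x) * \<phi> y))" for k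
    by (rule parseval_gauss[OF f \<phi>]) simp
  ultimately have "(LINT z|lborel. fourier f (- z) * fourier \<phi> z) = (LINT x|lborel. f x * ((2*pi) ^ DIM('a) * \<phi> x))"
    using LIMSEQ_unique by auto
  also have "\<dots> = (LINT x|lborel. (2*pi) ^ DIM('a) * (f x * \<phi> x))"
    by (simp add: mult_ac)
  also have "\<dots> = (2*pi) ^ DIM('a) * (LINT x|lborel. f x * \<phi> x)"
    by (rule integral_mult_right_zero)
  finally show ?thesis .
qed

section \<open>Injectivity of the Fourier transform on integrable functions\<close>

lemma integral_closed_eq_0_imp_AE_0:
  fixes h :: "'a::euclidean_space \<Rightarrow> complex"
  assumes h: "integrable lborel h"
    and 0: "\<And>S. closed S \<Longrightarrow> (LINT x|lborel. indicator S x *\<^sub>R h x) = 0"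
  shows "AE x in lborel. h x = 0"
proof (rule sigma_finite_measure.density_zero[OF sigma_finite_lborel h])
  have int: "integrable lborel (\<lambda>x. indicator A x *\<^sub>R h x)" if "A \<in> sets borel" for A
    using h that by (intro integrable_mult_indicator) auto
  fix A :: "'a set"
  assume "A \<in> sets lborel"
  then have A: "A \<in> sigma_sets UNIV (Collect closed)"
    by (simp add: borel_eq_closed)
  \<comment> \<open>Dynkin argument: closed sets are stable under intersection and generate the
    Borel sets, and the sets over which \<open>h\<close> integrates to 0 are closed under
    complements and disjoint unions.\<close>
  have "Int_stable (Collect closed :: 'a set set)" "Collect closed \<subseteq> Pow (UNIV :: 'a set)"
    by (auto simp: Int_stable_def)
  from this A have "(LINT x|lborel. indicator A x *\<^sub>R h x) = 0"
  proof (induction rule: sigma_sets_induct_disjoint)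
    case (compl A)
    then have [measurable]: "A \<in> sets borel"
      by (simp add: borel_eq_closed)
    have "(LINT x|lborel. indicator (UNIV - A) x *\<^sub>R h x) = (LINT x|lborel. indicator UNIV x *\<^sub>R h x - indicator A x *\<^sub>R h x)"
      by (intro Bochner_Integration.integral_cong) (auto split: split_indicator)
    also have "\<dots> = (LINT x|lborel. indicator UNIV x *\<^sub>R h x) - (LINT x|lborel. indicator A x *\<^sub>R h x)"
      by (intro Bochner_Integration.integral_diff int) auto
    also have "\<dots> = 0"
      using 0[of UNIV] compl by simp
    finally show ?case .
  next
    case (union A)
    then have [measurable]: "A i \<in> sets lborel" for i
      by (auto simp: borel_eq_closed)
    moreover have "(\<Union>i. A i) \<in> sets borel"
      using calculation by (intro sets.countable_UN) auto
    ultimately have "set_lebesgue_integral lborel (\<Union>i. A i) h = (\<Sum>i. set_lebesgue_integral lborel (A i) h)"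
      using union(1) by (intro lebesgue_integral_countable_add)
        (auto simp: disjoint_family_on_def set_integrable_def intro!: int)
    then show ?case
      using union by (simp add: set_lebesgue_integral_def)
  qed (auto intro: 0)
  then show "set_lebesgue_integral lborel A h = 0"
    by (simp add: set_lebesgue_integral_def)
qed

text \<open>By Parseval, \<open>h\<close> integrates to 0 against every bounded continuous
  integrable function. Continuous cut-offs times a Gaussian are of this kind even when the closed
  set is unbounded, and they approximate its indicator times the Gaussian.\<close>

theorem fourier_eq_0_imp_AE_0:
  fixes h :: "'a::euclidean_space \<Rightarrow> complex"
  assumes h: "integrable lborel h" and 0: "\<And>w. fourier h w = 0"
  shows "AE x in lborel. h x = 0"
proof -
  have [measurable]: "h \<in> borel_measurable borel"
    using h by auto
  have hg: "integrable lborel (\<lambda>x. h x * gauss 1 x)"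
    by (rule Bochner_Integration.integrable_bound[OF h])
       (auto simp: norm_mult abs_of_pos[OF gauss_pos] gauss_le_1 intro!: mult_right_le_one_le less_imp_le[OF gauss_pos])
  have "AE x in lborel. h x * gauss 1 x = 0"
  proof (rule integral_closed_eq_0_imp_AE_0[OF hg])
    fix S :: "'a set"
    assume S: "closed S"
    show "(LINT x|lborel. indicator S x *\<^sub>R (h x * gauss 1 x)) = 0"
    \<comment> \<open>\<open>infdist x {}\<close> is 0 by convention, so the cut-offs below would be
      constantly 1 for the empty set.\<close>
    proof (cases "S = {}")
      case False
      define p where "p n x = max 0 (1 - real n * infdist x S)" for n and x :: 'a
      have p01: "0 \<le> p n x" "p n x \<le> 1" for n x
        by (auto simp: p_def infdist_nonneg)
      have pc: "continuous_on UNIV (p n)" for n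
        unfolding p_def by (intro continuous_intros)
      then have [measurable]: "p n \<in> borel_measurable borel" for n
        by (rule borel_measurable_continuous_onI)
      have bound: "\<bar>p n x * gauss 1 x\<bar> \<le> gauss 1 x" for n x
        using p01[of n x] gauss_pos[of 1 x] by (simp add: abs_mult mult_left_le_one_le)
      have "(LINT x|lborel. h x * complex_of_real (p n x * gauss 1 x)) = 0" for n
      proof -
        have "integrable lborel (\<lambda>x. p n x * gauss 1 x)"
          using bound by (intro Bochner_Integration.integrable_bound[OF integrable_gauss[of 1]]) (auto intro: order_trans[OF _ abs_ge_self])
        then have int: "integrable lborel (\<lambda>x. complex_of_real (p n x * gauss 1 x))"
          by (simp only: complex_of_real_integrable_eq)
        have "continuous_on UNIV (\<lambda>x. complex_of_real (p n x * gauss 1 x))"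
          unfolding gauss_def by (intro continuous_intros pc)
        moreover have "cmod (complex_of_real (p n x * gauss 1 x)) \<le> 1" for x
          unfolding norm_of_real using bound[of n x] gauss_le_1[of 1 x] by linarith
        \<comment> \<open>The product of transforms is integrable because the transform of
          \<open>h\<close> is identically 0; the same fact makes the left side vanish.\<close>
        ultimately have "0 = (2*pi) ^ DIM('a) * (LINT x|lborel. h x * complex_of_real (p n x * gauss 1 x))"
          using parseval[OF h int, of 1] by (simp add: 0)
        then show ?thesis
          by simp
      qed
      moreover have "(\<lambda>n. LINT x|lborel. h x * complex_of_real (p n x * gauss 1 x)) \<longlonglongrightarrow>
         (LINT x|lborel. indicator S x *\<^sub>R (h x * gauss 1 x))"
      proof (rule integral_dominated_convergence)
        show "integrable lborel (\<lambda>x. cmod (h x * gauss 1 x))"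
          using hg by simp
        show "AE x in lborel. norm (h x * complex_of_real (p n x * gauss 1 x)) \<le> cmod (h x * gauss 1 x)" for n
          unfolding norm_mult norm_of_real
          by (intro AE_I2 mult_left_mono order_trans[OF bound abs_ge_self]) auto
        show "AE x in lborel. (\<lambda>n. h x * complex_of_real (p n x * gauss 1 x)) \<longlonglongrightarrow> indicator S x *\<^sub>R (h x * gauss 1 x)"
        proof (rule AE_I2)
          fix x
          have "(\<lambda>n. p n x) \<longlonglongrightarrow> indicator S x"
          proof (cases "x \<in> S")
            case True
            then show ?thesis by (simp add: p_def)
          next
            case x: False
            then have d: "infdist x S > 0"
              using S False by (metis in_closed_iff_infdist_zero infdist_nonneg less_eq_real_def)
            obtain n0 :: nat where n0: "1 < real n0 * infdist x S"
              using reals_Archimedean3[OF d] by blast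
            have "p n x = 0" if "n \<ge> n0" for n
            proof -
              have "real n0 * infdist x S \<le> real n * infdist x S"
                using that d by simp
              then show ?thesis using n0 by (simp add: p_def)
            qed
            then have "(\<lambda>n. p n x) \<longlonglongrightarrow> 0"
              by (intro tendsto_eventually eventually_sequentiallyI)
            then show ?thesis using x by simp
          qed
          then have "(\<lambda>n. h x * complex_of_real (p n x * gauss 1 x)) \<longlonglongrightarrow> h x * complex_of_real (indicator S x * gauss 1 x)"
            by (intro tendsto_intros)
          then show "(\<lambda>n. h x * complex_of_real (p n x * gauss 1 x)) \<longlonglongrightarrow> indicator S x *\<^sub>R (h x * gauss 1 x)"
            by (simp add: scaleR_conv_of_real mult_ac)
        qed
      qed (use S in auto)
      ultimately have "(\<lambda>n::nat. 0) \<longlonglongrightarrow> (LINT x|lborel. indicator S x *\<^sub>R (h x * gauss 1 x))"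
        by (simp only:)
      then show ?thesis
        by (rule LIMSEQ_unique[OF _ tendsto_const])
    qed auto
  qed
  then show ?thesis
    by eventually_elim (simp add: less_imp_neq[OF gauss_pos, symmetric])
qed

section \<open>Schwartz functions and square-integrable functions\<close>

lemma integrable_inverse_1_plus_square: "integrable lborel (\<lambda>x::real. 1 / (1 + x\<^sup>2))"
proof -
  have "set_integrable lborel (einterval (-\<infinity>) \<infinity>) (\<lambda>x::real. 1 / (1 + x\<^sup>2))"
  proof (rule interval_integral_FTC_nonneg(1)[where F = arctan and A = "-(pi/2)" and B = "pi/2"])
    fix x :: real
    show "DERIV arctan x :> 1 / (1 + x\<^sup>2)"
      using DERIV_arctan[of x] by (simp add: inverse_eq_divide)
    show "isCont (\<lambda>x. 1 / (1 + x\<^sup>2)) x"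
      by (intro continuous_intros) (simp add: add_nonneg_eq_0_iff)
    show "((arctan \<circ> real_of_ereal) \<longlongrightarrow> - (pi / 2)) (at_right (-\<infinity>))"
      using tendsto_arctan_at_bot by (simp add: ereal_tendsto_simps)
    show "((arctan \<circ> real_of_ereal) \<longlongrightarrow> pi / 2) (at_left \<infinity>)"
      using tendsto_arctan_at_top by (simp add: ereal_tendsto_simps)
  qed auto
  then show ?thesis
    by (simp add: set_integrable_def einterval_def)
qed

lemma schwartzD:
  fixes f :: "'a::euclidean_space \<Rightarrow> complex"
  assumes f: "f \<in> schwartz"
  shows schwartz_continuous: "continuous_on UNIV f"
    and schwartz_bounded_moment: "\<exists>B. \<forall>z. norm z ^ k * cmod (f z) \<le> B"
proof -
  have "f differentiable at z" and "bounded (range (\<lambda>z. norm z ^ k *\<^sub>R f z))" for z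
    using f by (auto simp: schwartz_def dest!: spec[of _ "[]"])
  then show "continuous_on UNIV f" "\<exists>B. \<forall>z. norm z ^ k * cmod (f z) \<le> B"
    by (auto simp: continuous_on_eq_continuous_at differentiable_imp_continuous_within bounded_iff)
qed

lemma schwartz_measurable: "f \<in> schwartz \<Longrightarrow> f \<in> borel_measurable borel"
  by (intro borel_measurable_continuous_onI schwartz_continuous)

lemma schwartz_bounded: "f \<in> schwartz \<Longrightarrow> \<exists>B. \<forall>z. cmod (f z) \<le> B"
  using schwartz_bounded_moment[of f 0] by simp

text \<open>The majorant is a tensor product of one-dimensional functions
  \<open>1 / (1 + t\<^sup>2)\<close>. Each factor \<open>1 + (z \<bullet> b)\<^sup>2\<close> is at
  most \<open>1 + (norm z)\<^sup>2\<close>, so the moments of order 0 and \<open>2 * DIM('a)\<close>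
  are enough to compare with it.\<close>

lemma schwartz_integrable:
  fixes f :: "'a::euclidean_space \<Rightarrow> complex"
  assumes f: "f \<in> schwartz"
  shows "integrable lborel f"
proof -
  let ?n = "DIM('a)"
  obtain B0 Bn where B0: "\<And>z. cmod (f z) \<le> B0" and Bn: "\<And>z. norm z ^ (2 * ?n) * cmod (f z) \<le> Bn"
    using schwartz_bounded[OF f] schwartz_bounded_moment[OF f] by blast
  let ?p = "\<lambda>z. \<Prod>b\<in>Basis. 1 + (z \<bullet> b)\<^sup>2"
  have p1: "?p z \<ge> 1" for z :: 'a
    by (intro prod_ge_1) simp
  have "cmod (f z) \<le> 2 ^ ?n * (B0 + Bn) * norm (\<Prod>b\<in>Basis. complex_of_real (1 / (1 + (z \<bullet> b)\<^sup>2)))" for z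
  proof -
    have "?p z \<le> (\<Prod>b\<in>(Basis::'a set). 1 + (norm z)\<^sup>2)"
      by (intro prod_mono) (simp add: abs_le_square_iff[symmetric] Basis_le_norm)
    also have "\<dots> \<le> (2 * max 1 ((norm z)\<^sup>2)) ^ ?n"
      unfolding prod_constant by (intro power_mono) auto
    also have "\<dots> \<le> 2 ^ ?n * (1 + norm z ^ (2 * ?n))"
      by (auto simp: power_mult_distrib max_def power_mult)
    finally have "?p z * cmod (f z) \<le> 2 ^ ?n * (1 + norm z ^ (2 * ?n)) * cmod (f z)"
      by (rule mult_right_mono) simp
    also have "\<dots> = 2 ^ ?n * (cmod (f z) + norm z ^ (2 * ?n) * cmod (f z))"
      by (simp add: algebra_simps)
    also have "\<dots> \<le> 2 ^ ?n * (B0 + Bn)"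
      by (intro mult_left_mono add_mono B0 Bn) simp
    finally have "cmod (f z) \<le> 2 ^ ?n * (B0 + Bn) / ?p z"
      using p1[of z] by (simp add: field_simps)
    also have "\<dots> = 2 ^ ?n * (B0 + Bn) * norm (\<Prod>b\<in>Basis. complex_of_real (1 / (1 + (z \<bullet> b)\<^sup>2)))"
      unfolding of_real_prod[symmetric] norm_of_real using p1[of z]
      by (simp add: prod_dividef abs_of_pos)
    finally show ?thesis .
  qed
  moreover have "integrable lborel (\<lambda>z::'a. \<Prod>b\<in>Basis. complex_of_real (1 / (1 + (z \<bullet> b)\<^sup>2)))"
    using integrable_inverse_1_plus_square
    by (intro integrable_prod_lborel[of "\<lambda>_ t. complex_of_real (1 / (1 + t\<^sup>2))"]) (simp only: complex_of_real_integrable_eq)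
  then have "integrable lborel (\<lambda>z::'a. 2 ^ ?n * (B0 + Bn) * norm (\<Prod>b\<in>Basis. complex_of_real (1 / (1 + (z \<bullet> b)\<^sup>2))))"
    by (intro integrable_mult_right integrable_norm)
  ultimately show ?thesis
    using schwartz_measurable[OF f]
    by (intro Bochner_Integration.integrable_bound[of lborel "\<lambda>z::'a. 2 ^ ?n * (B0 + Bn) * norm (\<Prod>b\<in>Basis. complex_of_real (1 / (1 + (z \<bullet> b)\<^sup>2)))" f])
       (auto intro!: AE_I2 order_trans[OF _ abs_ge_self])
qed

lemma bounded_integrable_imp_L2:
  fixes f :: "'a::euclidean_space \<Rightarrow> complex"
  assumes f: "integrable lborel f" and B: "\<And>z. cmod (f z) \<le> B"
  shows "f \<in> L2_space"
proof -
  have "integrable lborel (\<lambda>z. (cmod (f z))\<^sup>2)"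
  proof (rule Bochner_Integration.integrable_bound)
    show "integrable lborel (\<lambda>z. B *\<^sub>R f z)"
      using f by simp
    show "AE z in lborel. norm ((cmod (f z))\<^sup>2) \<le> norm (B *\<^sub>R f z)"
      using B by (auto simp: power2_eq_square intro!: mult_right_mono order_trans[OF _ abs_ge_self])
  qed (use f in auto)
  then show ?thesis
    using f by (simp add: L2_space_def)
qed

lemma schwartz_L2: "f \<in> schwartz \<Longrightarrow> f \<in> L2_space"
  using schwartz_bounded schwartz_integrable bounded_integrable_imp_L2 by metis

section \<open>Gaussian wave packets as Schwartz functions\<close>

inductive cpoly :: "('a::euclidean_space \<Rightarrow> complex) \<Rightarrow> bool" where
  const: "cpoly (\<lambda>_. k)"
| inner: "cpoly (\<lambda>z. complex_of_real (z \<bullet> v))"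
| add: "cpoly p \<Longrightarrow> cpoly q \<Longrightarrow> cpoly (\<lambda>z. p z + q z)"
| mult: "cpoly p \<Longrightarrow> cpoly q \<Longrightarrow> cpoly (\<lambda>z. p z * q z)"

lemma cpoly_derivative:
  assumes "cpoly p"
  shows "\<exists>D. (\<forall>z. (p has_derivative D z) (at z)) \<and> (\<forall>b. cpoly (\<lambda>z. D z b))"
  using assms
proof induction
  case (const k)
  show ?case by (intro exI[of _ "\<lambda>_ _. 0"]) (auto intro: cpoly.const)
next
  case (inner v)
  show ?case by (intro exI[of _ "\<lambda>_ h. complex_of_real (h \<bullet> v)"])
    (auto intro!: cpoly.const derivative_eq_intros)
next
  case (add p q)
  then obtain D E where "\<And>z. (p has_derivative D z) (at z)" "\<And>b. cpoly (\<lambda>z. D z b)"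
    "\<And>z. (q has_derivative E z) (at z)" "\<And>b. cpoly (\<lambda>z. E z b)" by blast
  then show ?case by (intro exI[of _ "\<lambda>z h. D z h + E z h"]) (auto intro!: cpoly.add derivative_eq_intros)
next
  case (mult p q)
  then obtain D E where "\<And>z. (p has_derivative D z) (at z)" "\<And>b. cpoly (\<lambda>z. D z b)"
    "\<And>z. (q has_derivative E z) (at z)" "\<And>b. cpoly (\<lambda>z. E z b)" by blast
  then show ?case using mult.hyps
    by (intro exI[of _ "\<lambda>z h. p z * E z h + D z h * q z"]) (auto intro!: cpoly.add cpoly.mult derivative_eq_intros)
qed

lemma cpoly_bound:
  assumes "cpoly p"
  shows "\<exists>C m. C \<ge> 0 \<and> (\<forall>z. cmod (p z) \<le> C * (1 + norm z) ^ m)"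
  using assms
proof induction
  case (const k)
  show ?case by (intro exI[of _ "cmod k"] exI[of _ 0]) auto
next
  case (inner v)
  have "\<bar>z \<bullet> v\<bar> \<le> norm v * (1 + norm z) ^ 1" for z
    using Cauchy_Schwarz_ineq2[of z v] norm_ge_zero[of v] by (simp add: algebra_simps del: norm_ge_zero)
  then show ?case by (intro exI[of _ "norm v"] exI[of _ 1]) auto
next
  case (add p q)
  then obtain C m D k where C: "C \<ge> 0" "\<And>z. cmod (p z) \<le> C * (1 + norm z) ^ m"
    and D: "D \<ge> 0" "\<And>z. cmod (q z) \<le> D * (1 + norm z) ^ k" by blast
  have "cmod (p z + q z) \<le> (C + D) * (1 + norm z) ^ (m + k)" for z
  proof -
    have "cmod (p z + q z) \<le> C * (1 + norm z) ^ m + D * (1 + norm z) ^ k"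
      by (rule order_trans[OF norm_triangle_ineq add_mono[OF C(2) D(2)]])
    also have "\<dots> \<le> C * (1 + norm z) ^ (m + k) + D * (1 + norm z) ^ (m + k)"
      using C(1) D(1) by (intro add_mono mult_left_mono power_increasing) auto
    finally show ?thesis by (simp add: algebra_simps)
  qed
  then show ?case using C D by (intro exI[of _ "C + D"] exI[of _ "m + k"]) auto
next
  case (mult p q)
  then obtain C m D k where C: "C \<ge> 0" "\<And>z. cmod (p z) \<le> C * (1 + norm z) ^ m"
    and D: "D \<ge> 0" "\<And>z. cmod (q z) \<le> D * (1 + norm z) ^ k" by blast
  have "cmod (p z * q z) \<le> (C * D) * (1 + norm z) ^ (m + k)" for z
    using mult_mono[OF C(2)[of z] D(2)[of z]] C(1) by (simp add: norm_mult power_add mult_ac)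
  then show ?case using C D by (intro exI[of _ "C * D"] exI[of _ "m + k"]) auto
qed

text \<open>One family for two kinds of test function: \<open>c = 0\<close> gives the modulated
  Gaussians, and \<open>d = 0\<close> gives the translated ones up to a constant, by completing the
  square.\<close>

definition wave_packet :: "'a::euclidean_space \<Rightarrow> 'a \<Rightarrow> 'a \<Rightarrow> complex" where
  "wave_packet c d z = exp (complex_of_real (- (z \<bullet> z) / 2 + z \<bullet> c) + \<i> * complex_of_real (z \<bullet> d))"

lemma cpoly_wave_packet_derivative:
  assumes "cpoly p"
  shows "\<exists>D. (\<forall>z. ((\<lambda>z. p z * wave_packet c d z) has_derivative (\<lambda>h. D h z * wave_packet c d z)) (at z)) \<and> (\<forall>b. cpoly (D b))"
proof -
  obtain P where P: "\<And>z. (p has_derivative P z) (at z)" "\<And>b. cpoly (\<lambda>z. P z b)"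
    using cpoly_derivative[OF assms] by blast
  let ?L = "\<lambda>b z. complex_of_real (z \<bullet> (- b)) + complex_of_real (b \<bullet> c) + \<i> * complex_of_real (b \<bullet> d)"
  have "(wave_packet c d has_derivative (\<lambda>h. ?L h z * wave_packet c d z)) (at z)" for z
  proof -
    let ?q = "\<lambda>z. complex_of_real (- (z \<bullet> z) / 2 + z \<bullet> c) + \<i> * complex_of_real (z \<bullet> d)"
    have "(?q has_derivative (\<lambda>h. ?L h z)) (at z)"
      by (auto intro!: derivative_eq_intros simp: inner_commute field_simps)
    from has_derivative_compose[OF this DERIV_exp[unfolded has_field_derivative_def]]
    show ?thesis
      unfolding wave_packet_def[abs_def] by (simp only: mult.commute)
  qed
  then have "((\<lambda>z. p z * wave_packet c d z) has_derivative (\<lambda>h. (P z h + p z * ?L h z) * wave_packet c d z)) (at z)" for z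
    by (auto intro!: derivative_eq_intros P(1) simp: algebra_simps)
  moreover have "cpoly (\<lambda>z. P z b + p z * ?L b z)" for b
    using P assms by (intro cpoly.intros) auto
  ultimately show ?thesis
    by (intro exI[of _ "\<lambda>h z. P z h + p z * ?L h z"]) auto
qed

text \<open>Differentiating a wave packet multiplies it by an affine function, so polynomial
  multiples of a fixed packet form a class closed under all partial derivatives.\<close>

lemma iter_partial_wave_packet:
  assumes "cpoly p"
  shows "\<exists>q. cpoly q \<and> iter_partial bs (\<lambda>z. p z * wave_packet c d z) = (\<lambda>z. q z * wave_packet c d z)"
proof (induction bs)
  case Nil
  then show ?case using assms by auto
next
  case (Cons b bs)
  then obtain q where q: "cpoly q" "iter_partial bs (\<lambda>z. p z * wave_packet c d z) = (\<lambda>z. q z * wave_packet c d z)"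
    by blast
  obtain D where D: "\<And>z. ((\<lambda>z. q z * wave_packet c d z) has_derivative (\<lambda>h. D h z * wave_packet c d z)) (at z)" "\<And>b. cpoly (D b)"
    using cpoly_wave_packet_derivative[OF q(1)] by blast
  show ?case
    using D(2)[of b] frechet_derivative_at[OF D(1), symmetric] by (auto simp: q(2))
qed

lemma wave_packet_schwartz: "(\<lambda>z. k * wave_packet c d z) \<in> schwartz"
  unfolding schwartz_def mem_Collect_eq
proof (intro allI impI conjI)
  fix bs :: "'a list" and z :: 'a and m :: nat
  obtain q where q: "cpoly q" "iter_partial bs (\<lambda>z. k * wave_packet c d z) = (\<lambda>z. q z * wave_packet c d z)"
    using iter_partial_wave_packet[OF cpoly.const] by blast
  show "iter_partial bs (\<lambda>z. k * wave_packet c d z) differentiable at z"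
    using cpoly_wave_packet_derivative[OF q(1)] unfolding q(2) differentiable_def by blast
  obtain C j where C: "C \<ge> 0" "\<And>z. cmod (q z) \<le> C * (1 + norm z) ^ j"
    using cpoly_bound[OF q(1)] by blast
  \<comment> \<open>The polynomial factors are absorbed in
    \<open>exp (real (m + j) * norm z)\<close> and the linear term of the packet adds
    \<open>norm c\<close>. Completing the square bounds the exponent by
    \<open>?a\<^sup>2 / 2\<close>.\<close>
  let ?a = "real (m + j) + norm c"
  have "norm (norm z ^ m *\<^sub>R (q z * wave_packet c d z)) \<le> C * exp (?a\<^sup>2 / 2)" for z
  proof -
    have 1: "cmod (wave_packet c d z) \<le> exp (- (norm z)\<^sup>2 / 2 + norm z * norm c)"
      unfolding wave_packet_def by (simp add: power2_norm_eq_inner norm_cauchy_schwarz)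
    have "(1 + norm z) ^ (m + j) \<le> exp (norm z) ^ (m + j)"
      by (intro power_mono) auto
    then have 2: "(1 + norm z) ^ (m + j) \<le> exp (real (m + j) * norm z)"
      by (simp only: exp_of_nat_mult)
    have "norm (norm z ^ m *\<^sub>R (q z * wave_packet c d z)) = norm z ^ m * (cmod (q z) * cmod (wave_packet c d z))"
      by (simp add: norm_mult)
    also have "\<dots> \<le> (1 + norm z) ^ m * ((C * (1 + norm z) ^ j) * cmod (wave_packet c d z))"
      using C by (intro mult_mono power_mono) auto
    also have "\<dots> = C * ((1 + norm z) ^ (m + j) * cmod (wave_packet c d z))"
      by (simp add: power_add)
    also have "\<dots> \<le> C * (exp (real (m + j) * norm z) * exp (- (norm z)\<^sup>2 / 2 + norm z * norm c))"
      by (intro mult_left_mono C mult_mono 1 2) auto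
    also have "\<dots> = C * exp (?a * norm z - (norm z)\<^sup>2 / 2)"
      by (simp add: algebra_simps flip: exp_add)
    also have "\<dots> \<le> C * exp (?a\<^sup>2 / 2)"
    proof -
      have "?a * norm z - (norm z)\<^sup>2 / 2 \<le> ?a\<^sup>2 / 2"
        using sum_squares_bound[of ?a "norm z"] by linarith
      then show ?thesis
        by (intro mult_left_mono C) simp
    qed
    finally show ?thesis .
  qed
  then show "bounded (range (\<lambda>z. norm z ^ m *\<^sub>R iter_partial bs (\<lambda>z. k * wave_packet c d z) z))"
    unfolding q(2) bounded_iff by blast
qed

section \<open>Basic facts on square-integrable functions\<close>

lemma L2_spaceD:
  assumes "f \<in> L2_space"
  shows L2_measurable: "f \<in> borel_measurable borel"
    and L2_integrable: "integrable lborel (\<lambda>z. (cmod (f z))\<^sup>2)"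
  using assms by (auto simp: L2_space_def)

lemma L2_spaceI:
  assumes "f \<in> borel_measurable borel" "(\<integral>\<^sup>+z. ennreal ((cmod (f z))\<^sup>2) \<partial>lborel) < \<infinity>"
  shows "f \<in> L2_space"
  unfolding L2_space_def using assms by (auto simp: integrable_iff_bounded)

lemma nn_integral_L2_norm:
  assumes "f \<in> L2_space"
  shows "(\<integral>\<^sup>+z. ennreal ((cmod (f z))\<^sup>2) \<partial>lborel) = ennreal ((L2_norm f)\<^sup>2)"
  unfolding L2_norm_def by (subst nn_integral_eq_integral[OF L2_integrable[OF assms]]) auto

lemma L2_norm_nonneg: "L2_norm f \<ge> 0"
  by (simp add: L2_norm_def)

lemma L2_norm_cong_AE:
  assumes "f \<in> borel_measurable borel" "g \<in> borel_measurable borel" "AE z in lborel. f z = g z"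
  shows "L2_norm f = L2_norm g"
  unfolding L2_norm_def
  using assms by (intro arg_cong[of _ _ sqrt] integral_cong_AE) auto

lemma L2_space_cong_AE:
  assumes "f \<in> L2_space" "g \<in> borel_measurable borel" "AE z in lborel. f z = g z"
  shows "g \<in> L2_space"
  using L2_integrable[OF assms(1)] L2_measurable[OF assms(1)] assms(2,3) unfolding L2_space_def
  by (auto elim!: integrable_cong_AE_imp)

lemma L2_mult_integrable:
  assumes f: "f \<in> L2_space" and g: "g \<in> L2_space"
  shows "integrable lborel (\<lambda>z. f z * g z)"
proof (rule Bochner_Integration.integrable_bound)
  show "integrable lborel (\<lambda>z. (cmod (f z))\<^sup>2 + (cmod (g z))\<^sup>2)"
    using L2_integrable[OF f] L2_integrable[OF g] by simp
  show "AE z in lborel. norm (f z * g z) \<le> norm ((cmod (f z))\<^sup>2 + (cmod (g z))\<^sup>2)"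
  proof (rule AE_I2)
    fix z
    have "0 \<le> cmod (f z) * cmod (g z)"
      by simp
    then have "cmod (f z) * cmod (g z) \<le> (cmod (f z))\<^sup>2 + (cmod (g z))\<^sup>2"
      using sum_squares_bound[of "cmod (f z)" "cmod (g z)"] by linarith
    then show "norm (f z * g z) \<le> norm ((cmod (f z))\<^sup>2 + (cmod (g z))\<^sup>2)"
      by (simp add: norm_mult)
  qed
qed (use L2_measurable[OF f] L2_measurable[OF g] in measurable)

lemma L2_diff:
  assumes f: "f \<in> L2_space" and g: "g \<in> L2_space"
  shows "(\<lambda>z. f z - g z) \<in> L2_space"
proof -
  have [measurable]: "f \<in> borel_measurable borel" "g \<in> borel_measurable borel"
    using f g by (auto intro: L2_measurable)
  have "integrable lborel (\<lambda>z. (cmod (f z - g z))\<^sup>2)"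
  proof (rule Bochner_Integration.integrable_bound)
    show "integrable lborel (\<lambda>z. 2 * (cmod (f z))\<^sup>2 + 2 * (cmod (g z))\<^sup>2)"
      using L2_integrable[OF f] L2_integrable[OF g] by simp
    show "AE z in lborel. norm ((cmod (f z - g z))\<^sup>2) \<le> norm (2 * (cmod (f z))\<^sup>2 + 2 * (cmod (g z))\<^sup>2)"
    proof (rule AE_I2)
      fix z
      have "(cmod (f z - g z))\<^sup>2 \<le> (cmod (f z) + cmod (g z))\<^sup>2"
        by (intro power_mono norm_triangle_ineq4) simp
      also have "\<dots> \<le> 2 * (cmod (f z))\<^sup>2 + 2 * (cmod (g z))\<^sup>2"
        using sum_squares_bound[of "cmod (f z)" "cmod (g z)"] by (simp add: power2_sum)
      finally show "norm ((cmod (f z - g z))\<^sup>2) \<le> norm (2 * (cmod (f z))\<^sup>2 + 2 * (cmod (g z))\<^sup>2)"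
        by simp
    qed
  qed measurable
  then show ?thesis
    by (simp add: L2_space_def)
qed

section \<open>Fourier multipliers\<close>

lemma gauss_L2:
  assumes "e > 0"
  shows "(\<lambda>z::'a::euclidean_space. complex_of_real (gauss e z)) \<in> L2_space"
proof (rule bounded_integrable_imp_L2)
  show "integrable lborel (\<lambda>z::'a. complex_of_real (gauss e z))"
    unfolding complex_of_real_integrable_eq by (rule integrable_gauss[OF assms])
  show "cmod (complex_of_real (gauss e z)) \<le> 1" for z :: 'a
    unfolding norm_of_real abs_of_pos[OF gauss_pos] by (rule gauss_le_1[OF assms])
qed

lemma wave_packet_0: "wave_packet 0 d z = exp (\<i> * complex_of_real (z \<bullet> d)) * gauss 1 z"
proof -
  have "- (z \<bullet> z) / 2 + z \<bullet> 0 = - (1/2) * (norm z)\<^sup>2"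
    by (simp add: power2_norm_eq_inner)
  then show ?thesis
    unfolding wave_packet_def gauss_def by (simp only: exp_add exp_of_real mult.commute)
qed

lemma wave_packet_translate:
  "complex_of_real (exp (- (c \<bullet> c) / 2)) * wave_packet c 0 z = gauss 1 (z - c)"
proof -
  have "- (1/2) * (norm (z - c))\<^sup>2 = - (c \<bullet> c) / 2 + (- (z \<bullet> z) / 2 + z \<bullet> c)"
    by (simp add: power2_norm_eq_inner inner_diff inner_commute field_simps)
  then show ?thesis
    unfolding wave_packet_def gauss_def by (simp only: exp_add exp_of_real of_real_mult inner_zero_right of_real_0 mult_zero_right exp_zero mult_1_right)
qed

lemma fourier_gauss_translate:
  "fourier (\<lambda>w. complex_of_real (gauss 1 (w - c))) z =
     gauss_hat 1 z * exp (- \<i> * complex_of_real (z \<bullet> (c::'a::euclidean_space)))"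
proof -
  let ?h = "\<lambda>w. exp (- \<i> * complex_of_real (w \<bullet> z)) * complex_of_real (gauss 1 w)"
  have "fourier (\<lambda>w. complex_of_real (gauss 1 (w - c))) z = (LINT w|lborel. exp (- \<i> * complex_of_real (c \<bullet> z)) * ?h (w - c))"
    unfolding fourier_def
    by (intro Bochner_Integration.integral_cong refl)
       (simp add: inner_diff_left algebra_simps flip: mult.assoc exp_add)
  also have "\<dots> = exp (- \<i> * complex_of_real (c \<bullet> z)) * (LINT w|lborel. ?h (w - c))"
    by (rule integral_mult_right_zero)
  also have "(LINT w|lborel. ?h (w - c)) = gauss_hat 1 z"
    using fourier_gauss(2)[of 1 z] by (subst integral_lborel_shift) (auto simp: fourier_def)
  finally show ?thesis
    by (simp add: inner_commute)
qed

text \<open>A square-integrable function times a Gaussian is integrable, and the hypothesis says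
  that the Fourier transform of this product vanishes. Injectivity applies, and the Gaussian has no
  zeros.\<close>

lemma L2_gauss_modulation_eq_0:
  fixes f :: "'a::euclidean_space \<Rightarrow> complex"
  assumes f: "f \<in> L2_space"
    and 0: "\<And>w. (LINT z|lborel. f z * (gauss 1 z * exp (- \<i> * complex_of_real (z \<bullet> w)))) = 0"
  shows "AE z in lborel. f z = 0"
proof -
  have "AE z in lborel. f z * gauss 1 z = 0"
  proof (rule fourier_eq_0_imp_AE_0)
    show "integrable lborel (\<lambda>z. f z * complex_of_real (gauss 1 z))"
      by (intro L2_mult_integrable f gauss_L2) simp
    show "fourier (\<lambda>z. f z * complex_of_real (gauss 1 z)) w = 0" for w
      using 0[of w] by (simp add: fourier_def mult_ac)
  qed
  then show ?thesis
    by eventually_elim (simp add: less_imp_neq[OF gauss_pos, symmetric])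
qed

text \<open>The modulated Gaussians of the previous criterion are themselves Schwartz, being wave
  packets with \<open>c = 0\<close>.\<close>

lemma L2_orthogonal_schwartz_eq_0:
  fixes f :: "'a::euclidean_space \<Rightarrow> complex"
  assumes f: "f \<in> L2_space" and 0: "\<And>\<phi>. \<phi> \<in> schwartz \<Longrightarrow> (LINT z|lborel. f z * \<phi> z) = 0"
  shows "AE z in lborel. f z = 0"
proof (rule L2_gauss_modulation_eq_0[OF f])
  fix w
  show "(LINT z|lborel. f z * (gauss 1 z * exp (- \<i> * complex_of_real (z \<bullet> w)))) = 0"
    using 0[OF wave_packet_schwartz[of 1 0 "-w"]] by (simp add: wave_packet_0 mult_ac)
qed

text \<open>The transform of a Gaussian translated by \<open>w\<close> is, up to a non-zero
  constant, the Gaussian modulated by \<open>w\<close>. Hence transforms of Schwartz functions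
  already include the family that separates points.\<close>

lemma L2_orthogonal_fourier_schwartz_eq_0:
  fixes f :: "'a::euclidean_space \<Rightarrow> complex"
  assumes f: "f \<in> L2_space" and 0: "\<And>\<phi>. \<phi> \<in> schwartz \<Longrightarrow> (LINT z|lborel. f z * fourier \<phi> z) = 0"
  shows "AE z in lborel. f z = 0"
proof (rule L2_gauss_modulation_eq_0[OF f])
  fix w
  have s: "complex_of_real (sqrt (2*pi) ^ DIM('a)) \<noteq> 0"
    by simp
  have "(LINT z|lborel. f z * fourier (\<lambda>z. complex_of_real (gauss 1 (z - w))) z) = 0"
    unfolding wave_packet_translate[symmetric] by (intro 0 wave_packet_schwartz)
  also have "(\<lambda>z. f z * fourier (\<lambda>z. complex_of_real (gauss 1 (z - w))) z) =
     (\<lambda>z. complex_of_real (sqrt (2*pi) ^ DIM('a)) * (f z * (gauss 1 z * exp (- \<i> * complex_of_real (z \<bullet> w)))))"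
    by (simp add: fourier_gauss_translate gauss_hat_def mult_ac)
  finally show "(LINT z|lborel. f z * (gauss 1 z * exp (- \<i> * complex_of_real (z \<bullet> w)))) = 0"
    using s by (simp only: integral_mult_right_zero mult_eq_0_iff) simp
qed

section \<open>The Fourier transform of square-integrable functions and its uniqueness\<close>

lemma L2_norm_power2: "(L2_norm f)\<^sup>2 = (LINT z|lborel. (cmod (f z))\<^sup>2)"
  unfolding L2_norm_def by (intro real_sqrt_pow2 integral_nonneg_AE) auto

lemma fourier_L2:
  fixes f :: "'a::euclidean_space \<Rightarrow> complex"
  assumes f: "integrable lborel f" and f2: "f \<in> L2_space"
  shows "fourier f \<in> L2_space" and "(L2_norm (fourier f))\<^sup>2 \<le> (2*pi) ^ DIM('a) * (L2_norm f)\<^sup>2"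
proof -
  have le: "(\<integral>\<^sup>+z. ennreal ((cmod (fourier f z))\<^sup>2) \<partial>lborel) \<le> ennreal ((2*pi) ^ DIM('a) * (L2_norm f)\<^sup>2)"
    using plancherel_le[OF f] by (simp add: nn_integral_L2_norm[OF f2] ennreal_mult)
  then show L2: "fourier f \<in> L2_space"
    using L2_measurable[OF f2] by (intro L2_spaceI) (auto intro: le_less_trans)
  show "(L2_norm (fourier f))\<^sup>2 \<le> (2*pi) ^ DIM('a) * (L2_norm f)\<^sup>2"
    using le unfolding nn_integral_L2_norm[OF L2] by (subst (asm) ennreal_le_iff) auto
qed

lemma L2_reflect:
  fixes f :: "'a::euclidean_space \<Rightarrow> complex"
  assumes f: "f \<in> L2_space"
  shows "(\<lambda>z. f (- z)) \<in> L2_space" and "L2_norm (\<lambda>z. f (- z)) = L2_norm f"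
proof -
  have [measurable]: "f \<in> borel_measurable borel"
    using f by (rule L2_measurable)
  have eq: "(\<integral>\<^sup>+z. ennreal ((cmod (f (- z)))\<^sup>2) \<partial>lborel) = (\<integral>\<^sup>+z. ennreal ((cmod (f z))\<^sup>2) \<partial>lborel)"
    using nn_integral_lborel_reflect[of "\<lambda>z. ennreal ((cmod (f z))\<^sup>2)" 0] by simp
  then show L2: "(\<lambda>z. f (- z)) \<in> L2_space"
    by (intro L2_spaceI) (auto simp: nn_integral_L2_norm[OF f])
  have "(L2_norm (\<lambda>z. f (- z)))\<^sup>2 = (L2_norm f)\<^sup>2"
    using eq unfolding nn_integral_L2_norm[OF f] nn_integral_L2_norm[OF L2] by simp
  then show "L2_norm (\<lambda>z. f (- z)) = L2_norm f"
    by (simp add: L2_norm_nonneg)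
qed

lemma has_fourier_L2_fourier:
  fixes u :: "'a::euclidean_space \<Rightarrow> complex"
  assumes u: "u \<in> schwartz"
  shows "has_fourier_L2 u (fourier u)"
  unfolding has_fourier_L2_def
proof (intro conjI ballI)
  fix \<phi> :: "'a \<Rightarrow> complex"
  assume "\<phi> \<in> schwartz"
  then show "(LINT z|lborel. u z * fourier \<phi> z) = (LINT w|lborel. fourier u w * \<phi> w)"
    using fourier_multiplication_formula[of u \<phi> 1] u by (simp add: schwartz_integrable)
qed (use u in \<open>auto intro: fourier_L2 schwartz_L2 schwartz_integrable\<close>)

lemma has_fourier_L2_unique:
  assumes "has_fourier_L2 u g" "has_fourier_L2 u h"
  shows "AE w in lborel. g w = h w"
proof -
  have L2: "g \<in> L2_space" "h \<in> L2_space"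
    using assms by (auto simp: has_fourier_L2_def)
  have "AE w in lborel. g w - h w = 0"
  proof (rule L2_orthogonal_schwartz_eq_0)
    fix \<phi> :: "'a \<Rightarrow> complex"
    assume \<phi>: "\<phi> \<in> schwartz"
    then have "(LINT w|lborel. (g w - h w) * \<phi> w) = (LINT w|lborel. g w * \<phi> w) - (LINT w|lborel. h w * \<phi> w)"
      by (simp add: left_diff_distrib L2_mult_integrable L2 schwartz_L2)
    then show "(LINT w|lborel. (g w - h w) * \<phi> w) = 0"
      using assms \<phi> unfolding has_fourier_L2_def by simp
  qed (intro L2_diff L2)
  then show ?thesis by simp
qed

lemma has_fourier_L2_inj:
  assumes "has_fourier_L2 u g" "has_fourier_L2 v g"
  shows "AE z in lborel. u z = v z"
proof -
  have L2: "u \<in> L2_space" "v \<in> L2_space"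
    using assms by (auto simp: has_fourier_L2_def)
  have "AE w in lborel. u w - v w = 0"
  proof (rule L2_orthogonal_fourier_schwartz_eq_0)
    fix \<phi> :: "'a \<Rightarrow> complex"
    assume \<phi>: "\<phi> \<in> schwartz"
    have "(LINT w|lborel. (u w - v w) * fourier \<phi> w) = (LINT w|lborel. u w * fourier \<phi> w) - (LINT w|lborel. v w * fourier \<phi> w)"
      by (simp add: left_diff_distrib L2_mult_integrable L2 schwartz_L2 schwartz_integrable fourier_L2 \<phi>)
    then show "(LINT w|lborel. (u w - v w) * fourier \<phi> w) = 0"
      using assms \<phi> by (simp add: has_fourier_L2_def)
  qed (intro L2_diff L2)
  then show ?thesis by simp
qed

lemma has_fourier_L2_cong_AE:
  assumes "has_fourier_L2 u g" "v \<in> borel_measurable borel" "h \<in> borel_measurable borel"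
    "AE z in lborel. u z = v z" "AE w in lborel. g w = h w"
  shows "has_fourier_L2 v h"
  unfolding has_fourier_L2_def
proof (intro conjI ballI)
  have L2: "u \<in> L2_space" "g \<in> L2_space"
    using assms by (auto simp: has_fourier_L2_def)
  show "v \<in> L2_space" "h \<in> L2_space"
    using assms L2 by (auto intro: L2_space_cong_AE)
  fix \<phi> :: "'a \<Rightarrow> complex"
  assume \<phi>: "\<phi> \<in> schwartz"
  note [measurable] = assms(2,3) L2[THEN L2_measurable] schwartz_measurable[OF \<phi>]
  have "(LINT z|lborel. v z * fourier \<phi> z) = (LINT z|lborel. u z * fourier \<phi> z)"
    using assms(4) by (intro integral_cong_AE) auto
  also have "\<dots> = (LINT w|lborel. g w * \<phi> w)"
    using assms(1) \<phi> by (simp add: has_fourier_L2_def)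
  also have "\<dots> = (LINT w|lborel. h w * \<phi> w)"
    using assms(5) by (intro integral_cong_AE) auto
  finally show "(LINT z|lborel. v z * fourier \<phi> z) = (LINT w|lborel. h w * \<phi> w)" .
qed

section \<open>Inverse transforms and multipliers of bounded sets\<close>

definition ifourier :: "('a::euclidean_space \<Rightarrow> complex) \<Rightarrow> 'a \<Rightarrow> complex" where
  "ifourier g z = fourier g (- z) / complex_of_real ((2*pi) ^ DIM('a))"

lemma ifourier_measurable[measurable]: "g \<in> borel_measurable borel \<Longrightarrow> ifourier g \<in> borel_measurable borel"
  unfolding ifourier_def[abs_def] by (intro borel_measurable_divide measurable_compose[OF _ fourier_measurable]) auto

text \<open>Parseval with \<open>g\<close> as the rough function shows that the inversion integral
  has \<open>g\<close> as its transform in the sense of duality. The integrability it asks for holds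
  because both transforms are square-integrable.\<close>

lemma ifourier_L2:
  fixes g :: "'a::euclidean_space \<Rightarrow> complex"
  assumes g: "integrable lborel g" and g2: "g \<in> L2_space"
  shows "ifourier g \<in> L2_space"
    and "(L2_norm (ifourier g))\<^sup>2 \<le> (L2_norm g)\<^sup>2 / (2*pi) ^ DIM('a)"
    and "has_fourier_L2 (ifourier g) g"
proof -
  let ?c = "(2*pi) ^ DIM('a)"
  note r = L2_reflect[OF fourier_L2(1)[OF g g2]]
  have eq: "(cmod (ifourier g z))\<^sup>2 = (1 / ?c\<^sup>2) * (cmod (fourier g (- z)))\<^sup>2" for z
    by (simp add: ifourier_def norm_divide power_divide norm_power norm_mult)
  have [measurable]: "g \<in> borel_measurable borel"
    using g by auto
  show L2: "ifourier g \<in> L2_space"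
    using L2_integrable[OF r(1)] unfolding L2_space_def by (simp add: eq)
  have "(L2_norm (ifourier g))\<^sup>2 = (1 / ?c\<^sup>2) * (L2_norm (\<lambda>z. fourier g (- z)))\<^sup>2"
    unfolding L2_norm_power2 eq by (rule integral_mult_right_zero)
  also have "\<dots> \<le> (1 / ?c\<^sup>2) * (?c * (L2_norm g)\<^sup>2)"
    unfolding r(2) by (intro mult_left_mono fourier_L2 g g2) simp
  also have "\<dots> = (L2_norm g)\<^sup>2 / ?c"
    by (simp add: power2_eq_square)
  finally show "(L2_norm (ifourier g))\<^sup>2 \<le> (L2_norm g)\<^sup>2 / (2*pi) ^ DIM('a)" .
  show "has_fourier_L2 (ifourier g) g"
    unfolding has_fourier_L2_def
  proof (intro conjI ballI L2 g2)
    fix \<phi> :: "'a \<Rightarrow> complex"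
    assume \<phi>: "\<phi> \<in> schwartz"
    obtain B where B: "\<And>z. cmod (\<phi> z) \<le> B"
      using schwartz_bounded[OF \<phi>] by blast
    have "(LINT z|lborel. fourier g (- z) * fourier \<phi> z) = ?c * (LINT w|lborel. g w * \<phi> w)"
      using \<phi> r(1) by (intro parseval[OF g _ _ B] L2_mult_integrable)
        (auto intro: schwartz_integrable schwartz_continuous fourier_L2 schwartz_L2)
    then show "(LINT z|lborel. ifourier g z * fourier \<phi> z) = (LINT w|lborel. g w * \<phi> w)"
      by (simp add: ifourier_def)
  qed
qed

text \<open>A bounded set has finite measure, and there a square-integrable function is integrable
  because \<open>x \<le> 1 + x\<^sup>2\<close>. This is where the truncation of the cones makes
  inverse transforms genuine integrals.\<close>

lemma L2_indicator_integrable: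
  fixes g :: "'a::euclidean_space \<Rightarrow> complex"
  assumes g: "g \<in> L2_space" and A: "A \<in> sets borel" "bounded A"
  shows "(\<lambda>w. indicator A w * g w) \<in> L2_space" and "integrable lborel (\<lambda>w. indicator A w * g w)"
proof -
  have [measurable]: "g \<in> borel_measurable borel"
    using g by (rule L2_measurable)
  have "integrable lborel (\<lambda>w. (cmod (indicator A w * g w))\<^sup>2)"
    using A by (intro Bochner_Integration.integrable_bound[OF L2_integrable[OF g]])
      (auto split: split_indicator)
  then show "(\<lambda>w. indicator A w * g w) \<in> L2_space"
    using A by (simp add: L2_space_def)
  have "emeasure lborel A < \<infinity>"
    using A by (intro emeasure_bounded_finite)
  then have "integrable lborel (\<lambda>w. indicator A w :: real)"
    using A by (simp add: integrable_indicator_iff)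
  then have "integrable lborel (\<lambda>w. indicator A w + (cmod (g w))\<^sup>2)"
    using L2_integrable[OF g] by simp
  then show "integrable lborel (\<lambda>w. indicator A w * g w)"
  proof (rule Bochner_Integration.integrable_bound)
    have "x \<le> 1 + x\<^sup>2" for x :: real
    proof -
      have "x \<le> (x\<^sup>2 + 1) / 2"
        using sum_squares_bound[of x 1] by simp
      also have "\<dots> \<le> 1 + x\<^sup>2"
        using zero_le_power2[of x] by argo
      finally show ?thesis .
    qed
    then show "AE w in lborel. norm (indicator A w * g w) \<le> norm (indicator A w + (cmod (g w))\<^sup>2)"
      by (auto split: split_indicator)
  qed (use A in measurable)
qed

text \<open>The inverse integral witnesses the existential under \<open>SOME\<close>. The chosen
  function may come with another transform \<open>h\<close> of \<open>u\<close>, but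
  \<open>h\<close> agrees with \<open>g\<close> almost everywhere, and functions with the same
  transform agree almost everywhere.\<close>

lemma multiplier_eq_ifourier:
  fixes u :: "'a::euclidean_space \<Rightarrow> complex"
  assumes u: "has_fourier_L2 u g" and A: "A \<in> sets borel" "bounded A"
  shows "multiplier A u \<in> L2_space"
    and "AE z in lborel. multiplier A u z = ifourier (\<lambda>w. indicator A w * g w) z"
proof -
  have g: "g \<in> L2_space"
    using u by (simp add: has_fourier_L2_def)
  let ?v = "ifourier (\<lambda>w. indicator A w * g w)"
  have v: "has_fourier_L2 ?v (\<lambda>w. indicator A w * g w)"
    by (intro ifourier_L2 L2_indicator_integrable g A)
  then have "\<exists>v. \<exists>g. has_fourier_L2 u g \<and> has_fourier_L2 v (\<lambda>w. indicator A w * g w)"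
    using u by blast
  then have "\<exists>h. has_fourier_L2 u h \<and> has_fourier_L2 (multiplier A u) (\<lambda>w. indicator A w * h w)"
    unfolding multiplier_def by (rule someI_ex)
  then obtain h where h: "has_fourier_L2 u h" "has_fourier_L2 (multiplier A u) (\<lambda>w. indicator A w * h w)"
    by blast
  show L2: "multiplier A u \<in> L2_space"
    using h by (simp add: has_fourier_L2_def)
  have "AE w in lborel. h w = g w"
    by (rule has_fourier_L2_unique[OF h(1) u])
  then have "AE w in lborel. indicator A w * h w = indicator A w * g w"
    by eventually_elim simp
  then have "has_fourier_L2 (multiplier A u) (\<lambda>w. indicator A w * g w)"
    using A L2_measurable[OF g] by (intro has_fourier_L2_cong_AE[OF h(2) L2_measurable[OF L2]]) auto
  then show "AE z in lborel. multiplier A u z = ?v z"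
    by (rule has_fourier_L2_inj[OF _ v])
qed

section \<open>The trilinear form\<close>

text \<open>The squared norm is kept in \<open>ennreal\<close>, where Tonelli and Cauchy-Schwarz
  apply to all measurable functions and infinite values are allowed.\<close>

definition sqint :: "('a::euclidean_space \<Rightarrow> ennreal) \<Rightarrow> ennreal" where
  "sqint f = (\<integral>\<^sup>+x. (f x)\<^sup>2 \<partial>lborel)"

text \<open>
  The argument \<open>- x - y\<close> in place of \<open>x - y\<close> makes the trilinear form below symmetric.
\<close>

definition nconv :: "('a::euclidean_space \<Rightarrow> ennreal) \<Rightarrow> ('a \<Rightarrow> ennreal) \<Rightarrow> 'a \<Rightarrow> ennreal" where
  "nconv f g x = (\<integral>\<^sup>+y. f y * g (- x - y) \<partial>lborel)"

definition trilin :: "('a::euclidean_space \<Rightarrow> ennreal) \<Rightarrow> ('a \<Rightarrow> ennreal) \<Rightarrow> ('a \<Rightarrow> ennreal) \<Rightarrow> ennreal" where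
  "trilin f g h = (\<integral>\<^sup>+x. f x * nconv g h x \<partial>lborel)"

lemma nconv_measurable[measurable]:
  assumes [measurable]: "f \<in> borel_measurable borel" "g \<in> borel_measurable borel"
  shows "nconv f g \<in> borel_measurable borel"
  unfolding nconv_def[abs_def] by measurable

lemma trilin_eq:
  assumes [measurable]: "f \<in> borel_measurable borel" "g \<in> borel_measurable borel" "h \<in> borel_measurable borel"
  shows "trilin f g h = (\<integral>\<^sup>+x. \<integral>\<^sup>+y. f x * g y * h (- x - y) \<partial>lborel \<partial>lborel)"
  unfolding trilin_def nconv_def by (simp add: nn_integral_cmult[symmetric] mult.assoc)

lemma nconv_commute:
  assumes [measurable]: "f \<in> borel_measurable borel" "g \<in> borel_measurable borel"
  shows "nconv f g x = nconv g f x"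
proof -
  have "nconv f g x = (\<integral>\<^sup>+y. f (- x - y) * g (- x - (- x - y)) \<partial>lborel)"
    unfolding nconv_def by (rule nn_integral_lborel_reflect[symmetric]) measurable
  then show ?thesis
    by (simp add: nconv_def mult.commute)
qed

lemma trilin_commute23:
  assumes "g \<in> borel_measurable borel" "h \<in> borel_measurable borel"
  shows "trilin f g h = trilin f h g"
  unfolding trilin_def nconv_commute[OF assms] ..

lemma trilin_commute12:
  assumes [measurable]: "f \<in> borel_measurable borel" "g \<in> borel_measurable borel" "h \<in> borel_measurable borel"
  shows "trilin f g h = trilin g f h"
proof -
  have "trilin f g h = (\<integral>\<^sup>+y. \<integral>\<^sup>+x. f x * g y * h (- x - y) \<partial>lborel \<partial>lborel)"
    by (subst trilin_eq) (auto intro!: lborel_pair.Fubini')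
  then show ?thesis
    by (subst (2) trilin_eq) (simp_all add: mult_ac minus_diff_commute)
qed

lemma trilin_le_nconv:
  assumes [measurable]: "f \<in> borel_measurable borel" "g \<in> borel_measurable borel" "h \<in> borel_measurable borel"
  shows "(trilin f g h)\<^sup>2 \<le> sqint f * sqint (nconv g h)"
  unfolding trilin_def sqint_def by (rule Cauchy_Schwarz_nn_integral) measurable

text \<open>Expanding the square and integrating in \<open>x\<close> innermost isolates the
  autocorrelation of \<open>g\<close>, on which the reflection argument below acts.\<close>

lemma sqint_nconv_eq:
  assumes [measurable]: "f \<in> borel_measurable borel" "g \<in> borel_measurable borel"
  shows "sqint (nconv f g) =
    (\<integral>\<^sup>+y. \<integral>\<^sup>+z. \<integral>\<^sup>+x. f y * f z * (g (- x - y) * g (- x - z)) \<partial>lborel \<partial>lborel \<partial>lborel)"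
proof -
  have "sqint (nconv f g) = (\<integral>\<^sup>+x. \<integral>\<^sup>+y. \<integral>\<^sup>+z. f y * f z * (g (- x - y) * g (- x - z)) \<partial>lborel \<partial>lborel \<partial>lborel)"
    unfolding sqint_def nconv_def power2_eq_square
    by (simp add: nn_integral_cmult[symmetric] nn_integral_multc[symmetric] mult_ac)
  also have "\<dots> = (\<integral>\<^sup>+y. \<integral>\<^sup>+x. \<integral>\<^sup>+z. f y * f z * (g (- x - y) * g (- x - z)) \<partial>lborel \<partial>lborel \<partial>lborel)"
    by (rule lborel_pair.Fubini') measurable
  also have "\<dots> = (\<integral>\<^sup>+y. \<integral>\<^sup>+z. \<integral>\<^sup>+x. f y * f z * (g (- x - y) * g (- x - z)) \<partial>lborel \<partial>lborel \<partial>lborel)"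
    by (intro nn_integral_cong lborel_pair.Fubini') measurable
  finally show ?thesis .
qed

text \<open>
  The identity \<open>\<parallel>v\<^sub>1 v\<^sub>2\<parallel> = \<parallel>v\<^sub>1 cnj v\<^sub>2\<parallel>\<close> on the Fourier side, by which the sign of a cone can be
  changed.
\<close>

lemma sqint_nconv_reflect:
  assumes [measurable]: "f \<in> borel_measurable borel" "g \<in> borel_measurable borel"
  shows "sqint (nconv f (\<lambda>y. g (- y))) = sqint (nconv f g)"
proof -
  have "(\<integral>\<^sup>+x. f y * f z * (g (- (- x - y)) * g (- (- x - z))) \<partial>lborel) =
    (\<integral>\<^sup>+x. f y * f z * (g (- x - y) * g (- x - z)) \<partial>lborel)" for y z
  proof -
    \<comment> \<open>Replacing \<open>x\<close> by \<open>- y - z - x\<close> turns the two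
      reflected arguments into the original ones with \<open>y\<close> and \<open>z\<close>
      exchanged, and the product of the two values of \<open>g\<close> is symmetric.\<close>
    have "(\<integral>\<^sup>+x. f y * f z * (g (- (- x - y)) * g (- (- x - z))) \<partial>lborel) =
      (\<integral>\<^sup>+x. f y * f z * (g (- (- (- y - z - x) - y)) * g (- (- (- y - z - x) - z))) \<partial>lborel)"
      by (rule nn_integral_lborel_reflect[symmetric]) measurable
    also have "\<dots> = (\<integral>\<^sup>+x. f y * f z * (g (- x - y) * g (- x - z)) \<partial>lborel)"
      by (intro nn_integral_cong) (simp add: algebra_simps)
    finally show ?thesis .
  qed
  then show ?thesis
    by (subst (1 2) sqint_nconv_eq) simp_all
qed

lemma sqint_reflect:
  assumes [measurable]: "f \<in> borel_measurable borel"
  shows "sqint (\<lambda>y. f (- y)) = sqint f"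
  using nn_integral_lborel_reflect[of "\<lambda>x. (f x)\<^sup>2" 0] by (simp add: sqint_def)

text \<open>For fixed \<open>x\<close> the integrand lives on one fibre. Cauchy-Schwarz against its
  indicator costs the measure \<open>K\<close> and leaves a convolution of squares, whose total
  integral factorises by Tonelli.\<close>

lemma sqint_nconv_le:
  fixes f g :: "'a::euclidean_space \<Rightarrow> ennreal"
  assumes [measurable]: "f \<in> borel_measurable borel" "g \<in> borel_measurable borel"
    and [measurable]: "A \<in> sets borel" "B \<in> sets borel"
    and f: "\<And>y. y \<notin> A \<Longrightarrow> f y = 0" and g: "\<And>y. y \<notin> B \<Longrightarrow> g y = 0"
    and K: "\<And>x. emeasure lborel {y \<in> A. x - y \<in> B} \<le> K"
  shows "sqint (nconv f g) \<le> K * sqint f * sqint g"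
proof -
  have "(nconv f g x)\<^sup>2 \<le> K * (\<integral>\<^sup>+y. (f y)\<^sup>2 * (g (- x - y))\<^sup>2 \<partial>lborel)" for x
  proof -
    let ?E = "{y \<in> A. - x - y \<in> B}"
    have E[measurable]: "?E \<in> sets borel" by measurable
    have "f y * g (- x - y) = indicator ?E y * (f y * g (- x - y))" for y
      using f[of y] g[of "- x - y"] by (auto split: split_indicator)
    then have "(nconv f g x)\<^sup>2 = (\<integral>\<^sup>+y. indicator ?E y * (f y * g (- x - y)) \<partial>lborel)\<^sup>2"
      by (simp add: nconv_def)
    also have "\<dots> \<le> (\<integral>\<^sup>+y. (indicator ?E y)\<^sup>2 \<partial>lborel) * (\<integral>\<^sup>+y. (f y * g (- x - y))\<^sup>2 \<partial>lborel)"
      by (rule Cauchy_Schwarz_nn_integral) measurable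
    also have "(\<integral>\<^sup>+y. (indicator ?E y)\<^sup>2 \<partial>lborel) = emeasure lborel ?E"
    proof -
      have "(indicator ?E y)\<^sup>2 = (indicator ?E y :: ennreal)" for y
        by (auto split: split_indicator)
      then show ?thesis by simp
    qed
    also have "\<dots> \<le> K" by (rule K)
    finally show ?thesis
      by (simp add: power_mult_distrib mult_right_mono)
  qed
  then have "sqint (nconv f g) \<le> (\<integral>\<^sup>+x. K * (\<integral>\<^sup>+y. (f y)\<^sup>2 * (g (- x - y))\<^sup>2 \<partial>lborel) \<partial>lborel)"
    unfolding sqint_def by (rule nn_integral_mono)
  also have "\<dots> = K * (\<integral>\<^sup>+x. \<integral>\<^sup>+y. (f y)\<^sup>2 * (g (- x - y))\<^sup>2 \<partial>lborel \<partial>lborel)"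
    by (rule nn_integral_cmult) measurable
  also have "(\<integral>\<^sup>+x. \<integral>\<^sup>+y. (f y)\<^sup>2 * (g (- x - y))\<^sup>2 \<partial>lborel \<partial>lborel) =
     (\<integral>\<^sup>+y. \<integral>\<^sup>+x. (f y)\<^sup>2 * (g (- x - y))\<^sup>2 \<partial>lborel \<partial>lborel)"
    by (rule lborel_pair.Fubini') measurable
  also have "\<dots> = (\<integral>\<^sup>+y. (f y)\<^sup>2 * sqint g \<partial>lborel)"
  proof (rule nn_integral_cong)
    fix y :: 'a
    have "(\<integral>\<^sup>+x. (f y)\<^sup>2 * (g (- x - y))\<^sup>2 \<partial>lborel) = (f y)\<^sup>2 * (\<integral>\<^sup>+x. (g (- x - y))\<^sup>2 \<partial>lborel)"
      by (rule nn_integral_cmult) measurable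
    also have "(\<integral>\<^sup>+x. (g (- x - y))\<^sup>2 \<partial>lborel) = (\<integral>\<^sup>+x. (g (- y - x))\<^sup>2 \<partial>lborel)"
      by (simp add: minus_diff_commute)
    also have "\<dots> = sqint g"
      unfolding sqint_def by (rule nn_integral_lborel_reflect) measurable
    finally show "(\<integral>\<^sup>+x. (f y)\<^sup>2 * (g (- x - y))\<^sup>2 \<partial>lborel) = (f y)\<^sup>2 * sqint g" .
  qed
  also have "\<dots> = sqint f * sqint g"
    unfolding sqint_def[of f] by (rule nn_integral_multc) measurable
  finally show ?thesis by (simp add: mult.assoc)
qed

text \<open>The square root on \<^typ>\<open>ennreal\<close>, except that \<open>esqrt \<infinity> = 0\<close>.\<close>

definition esqrt :: "ennreal \<Rightarrow> ennreal" where
  "esqrt x = ennreal (sqrt (enn2real x))"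

lemma esqrt_measurable[measurable]: "esqrt \<in> borel_measurable borel"
  unfolding esqrt_def[abs_def] by measurable

lemma esqrt_power2: "x < \<infinity> \<Longrightarrow> (esqrt x)\<^sup>2 = x"
  by (cases x) (auto simp: esqrt_def ennreal_power)

lemma ennreal_power2_mono_rev:
  fixes x y :: ennreal
  assumes "x\<^sup>2 \<le> y\<^sup>2"
  shows "x \<le> y"
proof (cases rule: ennreal2_cases[of x y])
  case (real_real r s)
  then show ?thesis
    using assms by (auto simp: ennreal_power intro: power2_le_imp_le)
next
  case (top_real r)
  then show ?thesis
    using assms by (auto simp: ennreal_power power_eq_top_ennreal top_unique)
qed auto

text \<open>
  If \<open>|snd x| \<le> \<rho>\<close> and \<open>snd y\<close> is within \<open>\<rho>\<close> of \<open>a\<close>, then \<open>snd (- x - y)\<close> is within \<open>2\<rho>\<close> of \<open>- a\<close>.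
  So \<open>h\<close> is localised together with \<open>g\<close>, and Cauchy--Schwarz in \<open>a\<close> loses only the factor 4 between
  the areas of the two discs.
\<close>

lemma trilin_localize:
  fixes f g h :: "spacetime \<Rightarrow> ennreal"
  assumes [measurable]: "f \<in> borel_measurable borel" "g \<in> borel_measurable borel" "h \<in> borel_measurable borel"
    and fin: "sqint f < \<infinity>" "sqint g < \<infinity>" "sqint h < \<infinity>" and K: "K < \<infinity>" and \<rho>: "\<rho> > 0"
    and f: "\<And>x. \<not> norm (snd x) \<le> \<rho> \<Longrightarrow> f x = 0"
    and loc: "\<And>a h'. h' \<in> borel_measurable borel \<Longrightarrow> (\<And>y. h' y \<le> h y) \<Longrightarrow>
       (trilin f (\<lambda>y. g y * indicator (cball a \<rho>) (snd y)) h')\<^sup>2 \<le>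
       K * sqint f * sqint (\<lambda>y. g y * indicator (cball a \<rho>) (snd y)) * sqint h'"
  shows "(trilin f g h)\<^sup>2 \<le> 4 * K * sqint f * sqint g * sqint h"
proof -
  let ?ga = "\<lambda>a y. g y * indicator (cball a \<rho>) (snd y)"
  let ?ha = "\<lambda>a y. h y * indicator (cball (- a) (2 * \<rho>)) (snd y)"
  define c where "c = emeasure lborel (cball (0 :: real^2) \<rho>)"
  have c: "emeasure lborel (cball (a :: real^2) \<rho>) = c" for a
    unfolding c_def using \<rho> by (simp add: emeasure_cball)
  have c4: "emeasure lborel (cball (a :: real^2) (2 * \<rho>)) = 4 * c" for a
    unfolding c_def using \<rho>
    by (simp add: emeasure_cball unit_ball_vol_nonneg power_mult_distrib mult_ac flip: ennreal_mult' ennreal_numeral)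
  have c0: "c \<noteq> 0" "c < \<infinity>"
    unfolding c_def using \<rho> by (auto simp: emeasure_cball unit_ball_vol_2)
  have ind: "(\<integral>\<^sup>+a. indicator (cball a \<rho>) \<xi> \<partial>lborel) = c" for \<xi> :: "real^2"
  proof -
    have "(\<integral>\<^sup>+a. indicator (cball a \<rho>) \<xi> \<partial>lborel) = (\<integral>\<^sup>+a. indicator (cball \<xi> \<rho>) a \<partial>lborel)"
      by (intro nn_integral_cong) (auto simp: dist_commute split: split_indicator)
    then show ?thesis by (simp add: c)
  qed
  have ind4: "(\<integral>\<^sup>+a. indicator (cball (- a) (2 * \<rho>)) \<xi> \<partial>lborel) = 4 * c" for \<xi> :: "real^2"
  proof -
    have "dist (- a) \<xi> = dist (- \<xi>) a" for a
      by (simp add: dist_norm norm_minus_commute add.commute)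
    then have "(\<integral>\<^sup>+a. indicator (cball (- a) (2 * \<rho>)) \<xi> \<partial>lborel) = (\<integral>\<^sup>+a. indicator (cball (- \<xi>) (2 * \<rho>)) a \<partial>lborel)"
      by (intro nn_integral_cong) (auto split: split_indicator)
    then show ?thesis by (simp add: c4)
  qed
  have [measurable]: "(\<lambda>(a, y). indicator (cball a \<rho>) (snd y) :: ennreal) \<in> borel_measurable (borel \<Otimes>\<^sub>M (borel :: spacetime measure))"
  proof -
    have "(\<lambda>(a, y). indicator (cball a \<rho>) (snd y) :: ennreal) = (\<lambda>p. indicator {p. dist (fst p) (snd (snd p)) \<le> \<rho>} p)"
      by (auto simp: fun_eq_iff split: split_indicator)
    also have "\<dots> \<in> borel_measurable (borel \<Otimes>\<^sub>M (borel :: spacetime measure))"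
      unfolding borel_prod by (intro borel_measurable_indicator borel_closed closed_Collect_le continuous_intros)
    finally show ?thesis .
  qed
  have [measurable]: "(\<lambda>(a, y). indicator (cball (- a) (2 * \<rho>)) (snd y) :: ennreal) \<in> borel_measurable (borel \<Otimes>\<^sub>M (borel :: spacetime measure))"
  proof -
    have "(\<lambda>(a, y). indicator (cball (- a) (2 * \<rho>)) (snd y) :: ennreal) = (\<lambda>p. indicator {p. dist (- fst p) (snd (snd p)) \<le> 2 * \<rho>} p)"
      by (auto simp: fun_eq_iff split: split_indicator)
    also have "\<dots> \<in> borel_measurable (borel \<Otimes>\<^sub>M (borel :: spacetime measure))"
      unfolding borel_prod by (intro borel_measurable_indicator borel_closed closed_Collect_le continuous_intros)
    finally show ?thesis .
  qed
  have [measurable]: "?ga a \<in> borel_measurable borel" "?ha a \<in> borel_measurable borel" for a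
    by measurable
  have prod: "f x * ?ga a y * ?ha a (- x - y) = f x * g y * h (- x - y) * indicator (cball a \<rho>) (snd y)" for a x y
  proof (cases "norm (snd x) \<le> \<rho> \<and> snd y \<in> cball a \<rho>")
    case True
    have "dist (- a) (snd (- x - y)) = norm (snd x + (snd y - a))"
      by (simp add: dist_norm algebra_simps)
    also have "\<dots> \<le> norm (snd x) + norm (snd y - a)"
      by (rule norm_triangle_ineq)
    also have "\<dots> \<le> 2 * \<rho>"
      using True by (simp add: dist_norm norm_minus_commute)
    finally show ?thesis
      using True by simp
  qed (use f[of x] in auto)
  \<comment> \<open>Average over the centres: the discs containing a given point have centres
    filling an area \<open>c\<close>, so the localised forms integrate to \<open>c\<close> times the
    original form.\<close>
  have "(\<integral>\<^sup>+a. trilin f (?ga a) (?ha a) \<partial>lborel) =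
    (\<integral>\<^sup>+a. \<integral>\<^sup>+x. \<integral>\<^sup>+y. f x * g y * h (- x - y) * indicator (cball a \<rho>) (snd y) \<partial>lborel \<partial>lborel \<partial>lborel)"
    by (subst trilin_eq) (simp_all only: prod, measurable)
  also have "\<dots> = (\<integral>\<^sup>+x. \<integral>\<^sup>+a. \<integral>\<^sup>+y. f x * g y * h (- x - y) * indicator (cball a \<rho>) (snd y) \<partial>lborel \<partial>lborel \<partial>lborel)"
    by (rule lborel_pair.Fubini') measurable
  also have "\<dots> = (\<integral>\<^sup>+x. \<integral>\<^sup>+y. \<integral>\<^sup>+a. f x * g y * h (- x - y) * indicator (cball a \<rho>) (snd y) \<partial>lborel \<partial>lborel \<partial>lborel)"
    by (intro nn_integral_cong lborel_pair.Fubini') measurable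
  also have "\<dots> = (\<integral>\<^sup>+x. \<integral>\<^sup>+y. f x * g y * h (- x - y) * c \<partial>lborel \<partial>lborel)"
    by (intro nn_integral_cong) (simp add: nn_integral_cmult ind)
  also have "\<dots> = trilin f g h * c"
    by (subst trilin_eq) (simp_all add: nn_integral_multc)
  finally have avg: "trilin f g h * c = (\<integral>\<^sup>+a. trilin f (?ga a) (?ha a) \<partial>lborel)" by simp

  have sqa: "sqint (?ga a) = (\<integral>\<^sup>+y. (g y)\<^sup>2 * indicator (cball a \<rho>) (snd y) \<partial>lborel)" for a
    unfolding sqint_def by (intro nn_integral_cong) (auto split: split_indicator)
  have sqb: "sqint (?ha a) = (\<integral>\<^sup>+y. (h y)\<^sup>2 * indicator (cball (- a) (2 * \<rho>)) (snd y) \<partial>lborel)" for a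
    unfolding sqint_def by (intro nn_integral_cong) (auto split: split_indicator)
  have [measurable]: "(\<lambda>a. sqint (?ga a)) \<in> borel_measurable borel" "(\<lambda>a. sqint (?ha a)) \<in> borel_measurable borel"
    unfolding sqa sqb by measurable
  have "sqint (?ga a) \<le> sqint g" "sqint (?ha a) \<le> sqint h" for a
    unfolding sqint_def by (auto intro!: nn_integral_mono split: split_indicator)
  then have fina: "sqint (?ga a) < \<infinity>" "sqint (?ha a) < \<infinity>" for a
    using fin by (auto intro: le_less_trans)
  have "(\<integral>\<^sup>+a. sqint (?ga a) \<partial>lborel) = (\<integral>\<^sup>+y. \<integral>\<^sup>+a. (g y)\<^sup>2 * indicator (cball a \<rho>) (snd y) \<partial>lborel \<partial>lborel)"
    unfolding sqa by (rule lborel_pair.Fubini') measurable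
  also have "\<dots> = (\<integral>\<^sup>+y. (g y)\<^sup>2 * c \<partial>lborel)"
    by (simp add: nn_integral_cmult ind)
  also have "\<dots> = sqint g * c"
    unfolding sqint_def by (rule nn_integral_multc) measurable
  finally have inta: "(\<integral>\<^sup>+a. sqint (?ga a) \<partial>lborel) = sqint g * c" .
  have "(\<integral>\<^sup>+a. sqint (?ha a) \<partial>lborel) = (\<integral>\<^sup>+y. \<integral>\<^sup>+a. (h y)\<^sup>2 * indicator (cball (- a) (2 * \<rho>)) (snd y) \<partial>lborel \<partial>lborel)"
    unfolding sqb by (rule lborel_pair.Fubini') measurable
  also have "\<dots> = (\<integral>\<^sup>+y. (h y)\<^sup>2 * (4 * c) \<partial>lborel)"
    by (simp add: nn_integral_cmult ind4)
  also have "\<dots> = sqint h * (4 * c)"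
    unfolding sqint_def by (rule nn_integral_multc) measurable
  finally have intb: "(\<integral>\<^sup>+a. sqint (?ha a) \<partial>lborel) = sqint h * (4 * c)" .

  \<comment> \<open>\<open>esqrt\<close> inverts squaring only at finite values, so finiteness of
    each factor has to be available.\<close>
  have Kf: "K * sqint f < \<infinity>"
    using K fin by (simp add: ennreal_mult_less_top)
  have "trilin f (?ga a) (?ha a) \<le> esqrt (K * sqint f) * (esqrt (sqint (?ga a)) * esqrt (sqint (?ha a)))" for a
  proof (rule ennreal_power2_mono_rev)
    have "(trilin f (?ga a) (?ha a))\<^sup>2 \<le> K * sqint f * sqint (?ga a) * sqint (?ha a)"
      by (rule loc) (auto split: split_indicator)
    also have "\<dots> = (esqrt (K * sqint f) * (esqrt (sqint (?ga a)) * esqrt (sqint (?ha a))))\<^sup>2"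
      unfolding power_mult_distrib esqrt_power2[OF Kf] esqrt_power2[OF fina(1)] esqrt_power2[OF fina(2)]
      by (simp add: mult.assoc)
    finally show "(trilin f (?ga a) (?ha a))\<^sup>2 \<le> (esqrt (K * sqint f) * (esqrt (sqint (?ga a)) * esqrt (sqint (?ha a))))\<^sup>2" .
  qed
  then have "trilin f g h * c \<le> (\<integral>\<^sup>+a. esqrt (K * sqint f) * (esqrt (sqint (?ga a)) * esqrt (sqint (?ha a))) \<partial>lborel)"
    unfolding avg by (rule nn_integral_mono)
  also have "\<dots> = esqrt (K * sqint f) * (\<integral>\<^sup>+a. esqrt (sqint (?ga a)) * esqrt (sqint (?ha a)) \<partial>lborel)"
    by (rule nn_integral_cmult) measurable
  finally have "(trilin f g h * c)\<^sup>2 \<le> (esqrt (K * sqint f) * (\<integral>\<^sup>+a. esqrt (sqint (?ga a)) * esqrt (sqint (?ha a)) \<partial>lborel))\<^sup>2"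
    by (rule power_mono) simp
  also have "\<dots> = K * sqint f * (\<integral>\<^sup>+a. esqrt (sqint (?ga a)) * esqrt (sqint (?ha a)) \<partial>lborel)\<^sup>2"
    by (simp add: power_mult_distrib esqrt_power2[OF Kf])
  also have "\<dots> \<le> K * sqint f * ((\<integral>\<^sup>+a. (esqrt (sqint (?ga a)))\<^sup>2 \<partial>lborel) * (\<integral>\<^sup>+a. (esqrt (sqint (?ha a)))\<^sup>2 \<partial>lborel))"
    by (intro mult_left_mono Cauchy_Schwarz_nn_integral) measurable
  also have "\<dots> = 4 * K * sqint f * sqint g * sqint h * c\<^sup>2"
    unfolding esqrt_power2[OF fina(1)] esqrt_power2[OF fina(2)] inta intb by (simp add: power2_eq_square mult_ac)
  finally have "(trilin f g h)\<^sup>2 * c\<^sup>2 \<le> 4 * K * sqint f * sqint g * sqint h * c\<^sup>2"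
    by (simp add: power_mult_distrib)
  \<comment> \<open>Cancelling a factor in \<open>ennreal\<close> requires it to be neither 0 nor
    infinite.\<close>
  moreover have "c\<^sup>2 \<noteq> 0" "c\<^sup>2 \<noteq> top"
    using c0 by (auto simp: power2_eq_square ennreal_mult_eq_top_iff)
  ultimately show ?thesis
    by (simp add: ennreal_mult_le_mult_iff mult.commute[of _ "c\<^sup>2"])
qed

section \<open>Thickened ellipses\<close>

lemma emeasure_le_diameter:
  fixes A :: "real set"
  assumes A: "A \<in> sets borel" and d: "\<And>y z. y \<in> A \<Longrightarrow> z \<in> A \<Longrightarrow> y \<le> z \<Longrightarrow> z - y \<le> d" "d \<ge> 0"
  shows "emeasure lborel A \<le> ennreal d"
proof (cases "A = {}")
  case False
  then obtain y0 where y0: "y0 \<in> A" by blast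
  have *: "z - d \<le> y" if "y \<in> A" "z \<in> A" for y z
    using d(1)[OF that] d(2) by (cases "y \<le> z") auto
  then have bdd: "bdd_below A"
    using y0 by (intro bdd_belowI)
  have "A \<subseteq> {Inf A .. Inf A + d}"
  proof
    fix z assume z: "z \<in> A"
    have "z - d \<le> Inf A"
      using False * z by (intro cInf_greatest)
    then show "z \<in> {Inf A .. Inf A + d}"
      using cInf_lower[OF z bdd] by auto
  qed
  then have "emeasure lborel A \<le> emeasure lborel {Inf A .. Inf A + d}"
    by (rule emeasure_mono) simp
  then show ?thesis using d(2) by simp
qed simp

lemma Basis_vec_2: "(Basis :: (real^2) set) = {axis 1 1, axis 2 1}"
  by (auto simp: Basis_vec_def UNIV_2)

lemma vector_measurable[measurable]: "(\<lambda>p. vector [fst p, snd p] :: real^2) \<in> borel \<rightarrow>\<^sub>M borel"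
proof (rule borel_measurable_continuous_onI)
  have eq: "(\<lambda>p. vector [fst p, snd p] :: real^2) = (\<lambda>p. fst p *\<^sub>R axis 1 1 + snd p *\<^sub>R axis 2 1)"
    by (auto simp: vec_eq_iff forall_2 axis_def fun_eq_iff)
  show "continuous_on UNIV (\<lambda>p. vector [fst p, snd p] :: real^2)"
    unfolding eq by (intro continuous_intros)
qed

text \<open>Lebesgue measure is determined by its values on boxes. The identification carries
  Tonelli's theorem from pairs of reals to \<open>real^2\<close>.\<close>

lemma distr_vector: "distr lborel borel (\<lambda>p. vector [fst p, snd p] :: real^2) = lborel"
proof (rule lborel_eqI[symmetric])
  fix l u :: "real^2"
  assume le: "\<And>b. b \<in> Basis \<Longrightarrow> l \<bullet> b \<le> u \<bullet> b"
  have *: "l $ 1 \<le> u $ 1" "l $ 2 \<le> u $ 2"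
    using le[of "axis 1 1"] le[of "axis 2 1"] by (auto simp: Basis_vec_2 inner_axis)
  have ne: "axis 1 1 \<noteq> (axis 2 1 :: real^2)"
    by (simp add: axis_eq_axis)
  have "emeasure (distr lborel borel (\<lambda>p. vector [fst p, snd p] :: real^2)) (box l u) =
     emeasure lborel ((\<lambda>p. vector [fst p, snd p] :: real^2) -` box l u)"
    by (subst emeasure_distr) auto
  also have "(\<lambda>p. vector [fst p, snd p] :: real^2) -` box l u = box (l$1, l$2) (u$1, u$2)"
    by (auto simp: box_def Basis_vec_2 Basis_prod_def inner_axis)
  also have "emeasure lborel (box (l$1, l$2) (u$1, u$2)) = ennreal ((u$1 - l$1) * (u$2 - l$2))"
    using * by (subst emeasure_lborel_box) (auto simp: Basis_prod_def)
  finally show "emeasure (distr lborel borel (\<lambda>p. vector [fst p, snd p] :: real^2)) (box l u) = (\<Prod>b\<in>Basis. (u - l) \<bullet> b)"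
    using ne by (simp add: Basis_vec_2 inner_axis)
qed simp

lemma emeasure_lborel_vec2:
  assumes [measurable]: "S \<in> sets (borel :: (real^2) measure)"
  shows "emeasure lborel S = (\<integral>\<^sup>+x. emeasure lborel {y. vector [x, y] \<in> S} \<partial>lborel)"
proof -
  let ?U = "\<lambda>p. vector [fst p, snd p] :: real^2"
  have "emeasure lborel S = emeasure lborel (?U -` S)"
    by (subst distr_vector[symmetric], subst emeasure_distr) auto
  also have "\<dots> = emeasure (lborel \<Otimes>\<^sub>M lborel) (?U -` S)"
    by (simp add: lborel_prod)
  also have "\<dots> = (\<integral>\<^sup>+x. emeasure lborel (Pair x -` (?U -` S)) \<partial>lborel)"
  proof (rule lborel.emeasure_pair_measure_alt)
    have "?U -` S \<in> sets lborel"
      using measurable_sets[OF vector_measurable assms] by simp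
    then show "?U -` S \<in> sets (lborel \<Otimes>\<^sub>M lborel)"
      unfolding lborel_prod .
  qed
  finally show ?thesis
    by (simp add: vimage_def)
qed

text \<open>The foci are 0 and \<open>p\<close>, and \<open>t\<close> is the nominal sum of the
  distances to them. \<open>R1\<close> and \<open>R2\<close> are the frequency bounds of the two
  cones, and the disc about \<open>a\<close> limits the extent along the major axis.\<close>

definition ellipse_shell :: "real \<Rightarrow> real \<Rightarrow> real \<Rightarrow> real \<Rightarrow> real \<Rightarrow> real^2 \<Rightarrow> real^2 \<Rightarrow> (real^2) set" where
  "ellipse_shell R1 R2 D \<rho> t a p =
     {\<xi>. norm \<xi> \<le> R1 \<and> norm (p - \<xi>) \<le> R2 \<and> norm (\<xi> - a) \<le> \<rho> \<and> \<bar>t - (norm \<xi> + norm (p - \<xi>))\<bar> \<le> D}"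

lemma closed_ellipse_shell: "closed (ellipse_shell R1 R2 D \<rho> t a p)"
  unfolding ellipse_shell_def by (intro closed_Collect_conj closed_Collect_le continuous_intros)

lemma ellipse_shell_measurable[measurable]: "ellipse_shell R1 R2 D \<rho> t a p \<in> sets borel"
  by (intro borel_closed closed_ellipse_shell)

lemma compact_ellipse_shell: "compact (ellipse_shell R1 R2 D \<rho> t a p)"
  unfolding compact_eq_bounded_closed
  using closed_ellipse_shell by (auto simp: ellipse_shell_def bounded_iff)

lemma norm_vec_2: "(norm (\<xi> :: real^2))\<^sup>2 = (\<xi>$1)\<^sup>2 + (\<xi>$2)\<^sup>2"
  by (simp add: norm_vec_def L2_set_def UNIV_2)

text \<open>
  On a line perpendicular to the axis both distances to the foci increase with the square of the
  coordinate, at rates at least \<open>1 / (2 * R1)\<close> and \<open>1 / (2 * R2)\<close> within the shell.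
\<close>

lemma ellipse_shell_slice:
  assumes y: "0 \<le> y" "y \<le> z"
    and vy: "vector [x, y] \<in> ellipse_shell R1 R2 D \<rho> t a (axis 1 r)"
    and vz: "vector [x, z] \<in> ellipse_shell R1 R2 D \<rho> t a (axis 1 r)"
  shows "z - y \<le> sqrt (4 * min R1 R2 * D)"
proof -
  let ?y = "vector [x, y] :: real^2" and ?z = "vector [x, z] :: real^2" and ?p = "axis 1 r :: real^2"
  define A B A' B' where "A = norm ?y" and "B = norm (?p - ?y)" and "A' = norm ?z" and "B' = norm (?p - ?z)"
  \<comment> \<open>Both foci lie on the first axis, so the squared distances to them increase by
    the same amount.\<close>
  have sq: "A'\<^sup>2 - A\<^sup>2 = z\<^sup>2 - y\<^sup>2" "B'\<^sup>2 - B\<^sup>2 = z\<^sup>2 - y\<^sup>2"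
    unfolding A_def B_def A'_def B'_def norm_vec_2 by (simp_all add: axis_def)
  have yz: "y\<^sup>2 \<le> z\<^sup>2"
    using y by (intro power_mono)
  have nn: "0 \<le> A" "0 \<le> B" "0 \<le> A'" "0 \<le> B'"
    by (auto simp: A_def B_def A'_def B'_def)
  have "A\<^sup>2 \<le> A'\<^sup>2" "B\<^sup>2 \<le> B'\<^sup>2"
    using sq yz by linarith+
  then have le: "A \<le> A'" "B \<le> B'"
    using nn by (blast intro: power2_le_imp_le)+
  have R: "A \<le> R1" "A' \<le> R1" "B \<le> R2" "B' \<le> R2" and D: "\<bar>t - (A + B)\<bar> \<le> D" "\<bar>t - (A' + B')\<bar> \<le> D"
    using vy vz by (auto simp: ellipse_shell_def A_def B_def A'_def B'_def)
  \<comment> \<open>The sum of the distances varies by at most \<open>2 * D\<close>, and both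
    increments are non-negative, so each of them is at most \<open>2 * D\<close>.\<close>
  have d: "A' - A \<le> 2 * D" "B' - B \<le> 2 * D"
    using D le by auto
  have "z\<^sup>2 - y\<^sup>2 = (A' - A) * (A' + A)"
    unfolding sq(1)[symmetric] by (simp add: power2_eq_square algebra_simps)
  also have "\<dots> \<le> (2 * D) * (2 * R1)"
    using d le R nn by (intro mult_mono) auto
  finally have 1: "z\<^sup>2 - y\<^sup>2 \<le> 4 * R1 * D" by (simp add: mult_ac)
  have "z\<^sup>2 - y\<^sup>2 = (B' - B) * (B' + B)"
    unfolding sq(2)[symmetric] by (simp add: power2_eq_square algebra_simps)
  also have "\<dots> \<le> (2 * D) * (2 * R2)"
    using d le R nn by (intro mult_mono) auto
  finally have 2: "z\<^sup>2 - y\<^sup>2 \<le> 4 * R2 * D" by (simp add: mult_ac)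
  have "(z - y)\<^sup>2 = (z - y) * (z - y)"
    by (simp add: power2_eq_square)
  also have "\<dots> \<le> (z - y) * (z + y)"
    using y by (intro mult_left_mono) auto
  also have "\<dots> = z\<^sup>2 - y\<^sup>2"
    by (simp add: power2_eq_square algebra_simps)
  also have "\<dots> \<le> 4 * min R1 R2 * D"
    using 1 2 by (simp add: min_def)
  finally show ?thesis
    by (rule real_le_rsqrt)
qed

text \<open>Tonelli over the lines perpendicular to the axis. The disc about \<open>a\<close> leaves
  an interval of length \<open>2 * \<rho>\<close> of such lines, and on each line the two half-lines
  contribute at most \<open>sqrt (4 * min R1 R2 * D)\<close> each; hence the factor 4.\<close>

lemma emeasure_ellipse_shell_axis:
  assumes \<rho>: "\<rho> \<ge> 0" and K: "0 \<le> min R1 R2 * D"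
  shows "emeasure lborel (ellipse_shell R1 R2 D \<rho> t a (axis 1 r)) \<le> ennreal (4 * \<rho> * sqrt (4 * min R1 R2 * D))"
proof -
  let ?S = "ellipse_shell R1 R2 D \<rho> t a (axis 1 r)" and ?k = "sqrt (4 * min R1 R2 * D)"
  have k: "?k \<ge> 0" using K by (simp add: mult.assoc)
  have "emeasure lborel {y. vector [x, y] \<in> ?S} \<le> ennreal (2 * ?k) * indicator {a$1 - \<rho> .. a$1 + \<rho>} x" for x
  proof (cases "x \<in> {a$1 - \<rho> .. a$1 + \<rho>}")
    case True
    have "(\<lambda>y. vector [x, y] :: real^2) = (\<lambda>p. vector [fst p, snd p]) \<circ> Pair x"
      by auto
    then have vm[measurable]: "(\<lambda>y. vector [x, y] :: real^2) \<in> borel \<rightarrow>\<^sub>M borel"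
      using measurable_comp[OF _ vector_measurable] by (simp add: borel_prod[symmetric])
    have S[measurable]: "{y. vector [x, y] \<in> ?S} \<in> sets borel"
      using measurable_sets[OF vm ellipse_shell_measurable] by (simp add: vimage_def)
    \<comment> \<open>Reflection in the axis fixes both foci and carries the lower half-line to the
      upper one. Only the centre of the disc changes, to its mirror image.\<close>
    have flip: "vector [x, - y] \<in> ellipse_shell R1 R2 D \<rho> t (vector [a$1, - a$2]) (axis 1 r)"
      if "vector [x, y] \<in> ?S" for y
    proof -
      have n: "norm (vector [u, - v] :: real^2) = norm (vector [u, v] :: real^2)" for u v
        by (simp add: norm_vec_def L2_set_def UNIV_2)
      have "axis 1 r - vector [x, - y] = (vector [r - x, - (- y)] :: real^2)" "axis 1 r - vector [x, y] = (vector [r - x, - y] :: real^2)"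
        "vector [x, - y] - vector [a$1, - a$2] = (vector [x - a$1, - (y - a$2)] :: real^2)" "vector [x, y] - a = vector [x - a$1, y - a$2]"
        by (simp_all add: vec_eq_iff forall_2 axis_def)
      then show ?thesis
        using that unfolding ellipse_shell_def mem_Collect_eq by (simp only: n)
    qed
    have "emeasure lborel {y. vector [x, y] \<in> ?S} \<le> emeasure lborel ({y. vector [x, y] \<in> ?S} \<inter> {0..} \<union> {y. vector [x, y] \<in> ?S} \<inter> {..0})"
      by (intro emeasure_mono) auto
    also have "\<dots> \<le> emeasure lborel ({y. vector [x, y] \<in> ?S} \<inter> {0..}) + emeasure lborel ({y. vector [x, y] \<in> ?S} \<inter> {..0})"
      by (intro emeasure_subadditive) auto
    also have "\<dots> \<le> ennreal ?k + ennreal ?k"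
    proof (rule add_mono)
      show "emeasure lborel ({y. vector [x, y] \<in> ?S} \<inter> {0..}) \<le> ennreal ?k"
        by (intro emeasure_le_diameter k) (auto intro: ellipse_shell_slice)
      show "emeasure lborel ({y. vector [x, y] \<in> ?S} \<inter> {..0}) \<le> ennreal ?k"
      proof (intro emeasure_le_diameter k)
        fix y z
        assume "y \<in> {y. vector [x, y] \<in> ?S} \<inter> {..0}" "z \<in> {y. vector [x, y] \<in> ?S} \<inter> {..0}" "y \<le> z"
        then have "- y - - z \<le> ?k"
          by (intro ellipse_shell_slice[OF _ _ flip flip]) auto
        then show "z - y \<le> ?k" by simp
      qed measurable
    qed
    also have "\<dots> = ennreal (2 * ?k)"
      using k by (simp flip: ennreal_plus)
    finally show ?thesis using True by simp
  next
    case False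
    have "vector [x, y] \<notin> ?S" for y
    proof
      assume "vector [x, y] \<in> ?S"
      then have "norm (vector [x, y] - a) \<le> \<rho>"
        by (simp add: ellipse_shell_def)
      then have "\<bar>x - a$1\<bar> \<le> \<rho>"
        using component_le_norm_cart[of "vector [x, y] - a" 1] by simp
      then show False
        using False by (simp add: abs_le_iff)
    qed
    then show ?thesis by simp
  qed
  then have "emeasure lborel ?S \<le> (\<integral>\<^sup>+x. ennreal (2 * ?k) * indicator {a$1 - \<rho> .. a$1 + \<rho>} x \<partial>lborel)"
    by (subst emeasure_lborel_vec2) (auto intro!: nn_integral_mono)
  also have "\<dots> = ennreal (2 * ?k) * ennreal (2 * \<rho>)"
    using \<rho> by (simp add: nn_integral_cmult_indicator)
  also have "\<dots> = ennreal (4 * \<rho> * ?k)"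
    using \<rho> k by (simp add: ennreal_mult[symmetric] mult_ac)
  finally show ?thesis .
qed

text \<open>An orthogonal map takes a vector on the first axis to \<open>p\<close>. It preserves the
  distances that define the shell as well as Lebesgue measure, and the disc pulls back to one
  centred at the preimage \<open>b\<close> of \<open>a\<close>.\<close>

lemma emeasure_ellipse_shell:
  assumes \<rho>: "\<rho> \<ge> 0" and K: "0 \<le> min R1 R2 * D"
  shows "emeasure lborel (ellipse_shell R1 R2 D \<rho> t a p) \<le> ennreal (4 * \<rho> * sqrt (4 * min R1 R2 * D))"
proof -
  have "norm (axis 1 (norm p) :: real^2) = norm p"
    by (simp add: norm_vec_def L2_set_def UNIV_2 axis_def)
  then obtain f :: "real^2 \<Rightarrow> real^2" where f: "orthogonal_transformation f" "f (axis 1 (norm p)) = p"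
    by (rule orthogonal_transformation_exists)
  obtain b where b: "f b = a"
    using orthogonal_transformation_surj[OF f(1)] by (metis surjD)
  have lin: "linear f" and n: "norm (f v) = norm v" for v
    using f(1) by (auto simp: orthogonal_transformation)
  let ?S = "ellipse_shell R1 R2 D \<rho> t b (axis 1 (norm p))"
  have mem: "f v \<in> ellipse_shell R1 R2 D \<rho> t a p \<longleftrightarrow> v \<in> ?S" for v
  proof -
    have "norm (p - f v) = norm (axis 1 (norm p) - v)"
      using n[of "axis 1 (norm p) - v"] by (simp only: linear_diff[OF lin] f(2))
    moreover have "norm (f v - a) = norm (v - b)"
      using n[of "v - b"] by (simp only: linear_diff[OF lin] b)
    ultimately show ?thesis
      by (simp add: ellipse_shell_def n)
  qed
  have img: "ellipse_shell R1 R2 D \<rho> t a p = f ` ?S"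
    using orthogonal_transformation_surj[OF f(1)] mem by (auto simp: image_iff) (metis surjD)
  have lm: "ellipse_shell R1 R2 D \<rho> t b q \<in> lmeasurable" for b q
    by (intro lmeasurable_compact compact_ellipse_shell)
  have em: "emeasure lborel (ellipse_shell R1 R2 D \<rho> t b q) = ennreal (measure lebesgue (ellipse_shell R1 R2 D \<rho> t b q))" for b q
    using emeasure_eq_measure2[OF lm[of b q]] by simp
  have "measure lebesgue (ellipse_shell R1 R2 D \<rho> t a p) = measure lebesgue ?S"
    unfolding img by (rule measure_orthogonal_image[OF f(1) lm])
  then have "emeasure lborel (ellipse_shell R1 R2 D \<rho> t a p) = emeasure lborel ?S"
    unfolding em by simp
  also have "\<dots> \<le> ennreal (4 * \<rho> * sqrt (4 * min R1 R2 * D))"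
    by (rule emeasure_ellipse_shell_axis[OF \<rho> K])
  finally show ?thesis .
qed

section \<open>Thickened null cones\<close>

lemma null_cone_iff:
  "p \<in> null_cone M s N L \<longleftrightarrow> norm (snd p) \<le> M * N \<and> \<bar>fst p - s * norm (snd p)\<bar> \<le> M * L"
  by (cases p) (simp add: null_cone_def)

lemma closed_null_cone: "closed (null_cone M s N L)"
proof -
  have "null_cone M s N L = {p. norm (snd p) \<le> M * N \<and> \<bar>fst p - s * norm (snd p)\<bar> \<le> M * L}"
    by (auto simp: null_cone_iff)
  then show ?thesis
    by (simp only:) (intro closed_Collect_conj closed_Collect_le continuous_intros)
qed

lemma null_cone_measurable[measurable]: "null_cone M s N L \<in> sets borel"
  by (intro borel_closed closed_null_cone)

lemma bounded_null_cone:
  assumes s: "s \<in> {1, -1}"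
  shows "bounded (null_cone M s N L)"
proof -
  have "norm p \<le> M * L + 2 * (M * N)" if "p \<in> null_cone M s N L" for p
  proof -
    have 1: "norm (snd p) \<le> M * N" and 2: "\<bar>fst p - s * norm (snd p)\<bar> \<le> M * L"
      using that by (auto simp: null_cone_def)
    have "\<bar>fst p\<bar> \<le> \<bar>fst p - s * norm (snd p)\<bar> + norm (snd p)"
      using s abs_triangle_ineq[of "fst p - s * norm (snd p)" "s * norm (snd p)"] by (auto simp: abs_mult)
    moreover have "norm p \<le> \<bar>fst p\<bar> + norm (snd p)"
      using norm_Pair_le[of "fst p" "snd p"] by simp
    ultimately show ?thesis using 1 2 by linarith
  qed
  then show ?thesis unfolding bounded_iff by blast
qed

lemma uminus_null_cone: "- p \<in> null_cone M s N L \<longleftrightarrow> p \<in> null_cone M (- s) N L"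
  by (cases p) (auto simp: null_cone_def abs_le_iff)

section \<open>Volumes by slicing in time\<close>

lemma emeasure_spacetime:
  assumes "E \<in> sets (borel :: spacetime measure)"
  shows "emeasure lborel E = (\<integral>\<^sup>+\<xi>. emeasure lborel {\<tau>. (\<tau>, \<xi>) \<in> E} \<partial>lborel)"
proof -
  have "E \<in> sets (lborel \<Otimes>\<^sub>M lborel)"
    unfolding lborel_prod using assms by simp
  from lborel_pair.emeasure_pair_measure_alt2[OF this] show ?thesis
    unfolding lborel_prod by (simp add: vimage_def)
qed

lemma cball_snd_measurable[measurable]: "{p :: spacetime. snd p \<in> cball a \<rho>} \<in> sets borel"
proof (rule borel_closed)
  show "closed {p :: spacetime. snd p \<in> cball a \<rho>}"
    by (simp add: dist_norm) (intro closed_Collect_le continuous_intros)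
qed

text \<open>Over a fixed frequency both cones confine the time variable to intervals, of lengths
  \<open>2 * M * L1\<close> and \<open>2 * M * L2\<close>, and the shorter one bounds the fibre. A
  non-empty fibre means that the intervals meet, which forces the frequency into an elliptic shell
  whose thickness is governed by the larger of \<open>L1\<close> and \<open>L2\<close>.\<close>

lemma emeasure_null_cone_inter:
  assumes M: "M \<ge> 1" and s: "s \<in> {1, -1}" and pos: "N1 > 0" "N2 > 0" "L1 > 0" "L2 > 0" "\<rho> > 0"
  shows "emeasure lborel {p \<in> null_cone M s N1 L1 \<inter> {p. snd p \<in> cball a \<rho>}. q - p \<in> null_cone M s N2 L2}
     \<le> ennreal (24 * M\<^sup>2 * \<rho> * min L1 L2 * sqrt (min N1 N2 * max L1 L2))"
proof -
  let ?E = "{p \<in> null_cone M s N1 L1 \<inter> {p. snd p \<in> cball a \<rho>}. q - p \<in> null_cone M s N2 L2}"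
  let ?D = "2 * M * max L1 L2" and ?l = "2 * M * min L1 L2"
  let ?S = "ellipse_shell (M * N1) (M * N2) ?D \<rho> (s * fst q) a (snd q)"
  have s2: "s * s = 1" and sa: "\<bar>s\<bar> = 1" using s by auto
  have E: "?E \<in> sets borel"
    by measurable
  have slice: "emeasure lborel {\<tau>. (\<tau>, \<xi>) \<in> ?E} \<le> ennreal ?l * indicator ?S \<xi>" for \<xi>
  proof (cases "{\<tau>. (\<tau>, \<xi>) \<in> ?E} = {}")
    case False
    then obtain \<tau> where "(\<tau>, \<xi>) \<in> ?E" by blast
    then have *: "norm \<xi> \<le> M * N1" "norm (snd q - \<xi>) \<le> M * N2" "norm (\<xi> - a) \<le> \<rho>"
      "\<bar>\<tau> - s * norm \<xi>\<bar> \<le> M * L1" "\<bar>fst q - \<tau> - s * norm (snd q - \<xi>)\<bar> \<le> M * L2"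
      by (auto simp: null_cone_iff dist_norm norm_minus_commute[of a])
    \<comment> \<open>Since \<open>s * s = 1\<close>, multiplying by \<open>s\<close> brings either
      sign to the same condition on the sum of distances.\<close>
    have "\<bar>s * fst q - (norm \<xi> + norm (snd q - \<xi>))\<bar> = \<bar>s * (s * fst q - (norm \<xi> + norm (snd q - \<xi>)))\<bar>"
      by (simp add: abs_mult sa)
    also have "s * (s * fst q - (norm \<xi> + norm (snd q - \<xi>))) = (s * s) * fst q - (s * norm \<xi> + s * norm (snd q - \<xi>))"
      by (simp add: algebra_simps)
    also have "\<bar>(s * s) * fst q - (s * norm \<xi> + s * norm (snd q - \<xi>))\<bar> \<le> M * L1 + M * L2"
      using *(4,5) unfolding s2 by (simp add: abs_le_iff)
    also have "\<dots> \<le> M * max L1 L2 + M * max L1 L2"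
      using M by (intro add_mono mult_left_mono) auto
    finally have S: "\<xi> \<in> ?S"
      using * by (simp add: ellipse_shell_def)
    have "emeasure lborel {\<tau>. (\<tau>, \<xi>) \<in> ?E} \<le> ennreal ?l"
    proof (cases "L1 \<le> L2")
      case True
      have "{\<tau>. (\<tau>, \<xi>) \<in> ?E} \<subseteq> {s * norm \<xi> - M * L1 .. s * norm \<xi> + M * L1}"
        by (auto simp: null_cone_iff abs_le_iff)
      then have "emeasure lborel {\<tau>. (\<tau>, \<xi>) \<in> ?E} \<le> emeasure lborel {s * norm \<xi> - M * L1 .. s * norm \<xi> + M * L1}"
        by (rule emeasure_mono) simp
      then show ?thesis
        using True M pos by (simp add: mult_ac)
    next
      case False
      let ?c = "fst q - s * norm (snd q - \<xi>)"
      have "{\<tau>. (\<tau>, \<xi>) \<in> ?E} \<subseteq> {?c - M * L2 .. ?c + M * L2}"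
        by (auto simp: null_cone_iff abs_le_iff)
      then have "emeasure lborel {\<tau>. (\<tau>, \<xi>) \<in> ?E} \<le> emeasure lborel {?c - M * L2 .. ?c + M * L2}"
        by (rule emeasure_mono) simp
      then show ?thesis
        using False M pos by (simp add: mult_ac)
    qed
    then show ?thesis using S by simp
  qed (simp only: emeasure_empty zero_le)
  have "emeasure lborel ?E \<le> (\<integral>\<^sup>+\<xi>. ennreal ?l * indicator ?S \<xi> \<partial>lborel)"
    unfolding emeasure_spacetime[OF E] by (intro nn_integral_mono slice)
  also have "\<dots> = ennreal ?l * emeasure lborel ?S"
    by (simp add: nn_integral_cmult_indicator)
  also have "\<dots> \<le> ennreal ?l * ennreal (4 * \<rho> * sqrt (4 * min (M * N1) (M * N2) * ?D))"
    using M pos by (intro mult_left_mono emeasure_ellipse_shell) auto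
  also have "\<dots> = ennreal (?l * (4 * \<rho> * sqrt (4 * min (M * N1) (M * N2) * ?D)))"
    using M pos by (subst ennreal_mult) auto
  also have "\<dots> \<le> ennreal (24 * M\<^sup>2 * \<rho> * min L1 L2 * sqrt (min N1 N2 * max L1 L2))"
  proof (rule ennreal_leI)
    let ?Q = "min N1 N2 * max L1 L2"
    have Q: "?Q \<ge> 0" using pos by auto
    have "min (M * N1) (M * N2) = M * min N1 N2"
      using M by (simp add: min_mult_distrib_left)
    then have "4 * min (M * N1) (M * N2) * ?D = 8 * M\<^sup>2 * ?Q"
      by (simp add: power2_eq_square)
    \<comment> \<open>\<open>sqrt 8\<close> is rounded up to 3; with the 2 of the fibre length and
      the 4 of the shell estimate this gives 24.\<close>
    also have "\<dots> \<le> (3 * M)\<^sup>2 * ?Q"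
      using Q by (intro mult_right_mono) (auto simp: power_mult_distrib)
    finally have "sqrt (4 * min (M * N1) (M * N2) * ?D) \<le> sqrt ((3 * M)\<^sup>2 * ?Q)"
      by (rule real_sqrt_le_mono)
    also have "\<dots> = 3 * M * sqrt ?Q"
      using M by (simp add: real_sqrt_mult)
    finally have "?l * (4 * \<rho> * sqrt (4 * min (M * N1) (M * N2) * ?D)) \<le> ?l * (4 * \<rho> * (3 * M * sqrt ?Q))"
      using M pos by (intro mult_left_mono) auto
    also have "\<dots> = 24 * M\<^sup>2 * \<rho> * min L1 L2 * sqrt ?Q"
      by (simp add: power2_eq_square)
    finally show "?l * (4 * \<rho> * sqrt (4 * min (M * N1) (M * N2) * ?D)) \<le> 24 * M\<^sup>2 * \<rho> * min L1 L2 * sqrt ?Q" .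
  qed
  finally show ?thesis .
qed

text \<open>Height times area of the disc, with no gain from curvature: the source of the fourth
  quantity.\<close>

lemma emeasure_null_cone_cball:
  assumes M: "M \<ge> 1" and pos: "L > 0" "\<rho> > 0"
  shows "emeasure lborel (null_cone M s N L \<inter> {p. snd p \<in> cball a \<rho>}) \<le> ennreal (2 * M * L * (pi * \<rho>\<^sup>2))"
proof -
  let ?E = "null_cone M s N L \<inter> {p. snd p \<in> cball a \<rho>}"
  have E: "?E \<in> sets borel"
    by measurable
  have slice: "emeasure lborel {\<tau>. (\<tau>, \<xi>) \<in> ?E} \<le> ennreal (2 * M * L) * indicator (cball a \<rho>) \<xi>" for \<xi>
  proof (cases "\<xi> \<in> cball a \<rho>")
    case True
    have "{\<tau>. (\<tau>, \<xi>) \<in> ?E} \<subseteq> {s * norm \<xi> - M * L .. s * norm \<xi> + M * L}"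
      by (auto simp: null_cone_iff abs_le_iff)
    then have "emeasure lborel {\<tau>. (\<tau>, \<xi>) \<in> ?E} \<le> emeasure lborel {s * norm \<xi> - M * L .. s * norm \<xi> + M * L}"
      by (rule emeasure_mono) simp
    then show ?thesis
      using True M pos by (simp add: mult_ac)
  next
    case False
    then have "{\<tau>. (\<tau>, \<xi>) \<in> ?E} = {}" by auto
    then show ?thesis by (simp only: emeasure_empty zero_le)
  qed
  have "emeasure lborel ?E \<le> (\<integral>\<^sup>+\<xi>. ennreal (2 * M * L) * indicator (cball a \<rho>) \<xi> \<partial>lborel)"
    unfolding emeasure_spacetime[OF E] by (intro nn_integral_mono slice)
  also have "\<dots> = ennreal (2 * M * L) * ennreal (pi * \<rho>\<^sup>2)"
    using pos by (simp add: nn_integral_cmult_indicator emeasure_cball unit_ball_vol_2)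
  also have "\<dots> = ennreal (2 * M * L * (pi * \<rho>\<^sup>2))"
    using M pos by (subst ennreal_mult) auto
  finally show ?thesis .
qed

section \<open>Trilinear estimates\<close>

lemma indicator_cball_snd_measurable[measurable]:
  "(\<lambda>p :: spacetime. indicator (cball a \<rho>) (snd p) :: ennreal) \<in> borel_measurable borel"
proof -
  have "(\<lambda>p :: spacetime. indicator (cball a \<rho>) (snd p) :: ennreal) = indicator {p. snd p \<in> cball a \<rho>}"
    by (auto simp: fun_eq_iff indicator_def)
  then show ?thesis
    by (simp only: borel_measurable_indicator cball_snd_measurable)
qed

text \<open>For opposite signs \<open>g\<close> is reflected, which moves its support to the other
  cone and preserves \<open>sqint g\<close>. Localising \<open>f\<close> alone confines the whole
  intersection to a disc.\<close>

lemma nconv_null_cone_le: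
  assumes M: "M \<ge> 1" and s: "s1 \<in> {1, -1}" "s2 \<in> {1, -1}"
    and pos: "N1 > 0" "N2 > 0" "L1 > 0" "L2 > 0" "\<rho> > 0"
    and [measurable]: "f \<in> borel_measurable borel" "g \<in> borel_measurable borel"
    and f: "\<And>p. p \<notin> null_cone M s1 N1 L1 \<Longrightarrow> f p = 0" "\<And>p. snd p \<notin> cball a \<rho> \<Longrightarrow> f p = 0"
    and g: "\<And>p. p \<notin> null_cone M s2 N2 L2 \<Longrightarrow> g p = 0"
  shows "sqint (nconv f g) \<le> ennreal (24 * M\<^sup>2 * \<rho> * min L1 L2 * sqrt (min N1 N2 * max L1 L2)) * sqint f * sqint g"
proof -
  have same: "sqint (nconv f g') \<le> ennreal (24 * M\<^sup>2 * \<rho> * min L1 L2 * sqrt (min N1 N2 * max L1 L2)) * sqint f * sqint g'"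
    if [measurable]: "g' \<in> borel_measurable borel" and g': "\<And>p. p \<notin> null_cone M s1 N2 L2 \<Longrightarrow> g' p = 0" for g'
  proof (rule sqint_nconv_le)
    show "null_cone M s1 N1 L1 \<inter> {p. snd p \<in> cball a \<rho>} \<in> sets borel" by measurable
    show "null_cone M s1 N2 L2 \<in> sets borel" by measurable
  qed (use f g' emeasure_null_cone_inter[OF M s(1) pos] in auto)
  show ?thesis
  proof (cases "s1 = s2")
    case True
    then show ?thesis using g by (intro same) auto
  next
    case False
    then have s': "s1 = - s2" using s by auto
    have "sqint (nconv f (\<lambda>p. g (- p))) \<le> ennreal (24 * M\<^sup>2 * \<rho> * min L1 L2 * sqrt (min N1 N2 * max L1 L2)) * sqint f * sqint (\<lambda>p. g (- p))"
    proof (rule same)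
      show "g (- p) = 0" if "p \<notin> null_cone M s1 N2 L2" for p
        using that uminus_null_cone[of p M s2 N2 L2] by (intro g) (simp add: s')
    qed measurable
    then show ?thesis
      by (simp add: sqint_nconv_reflect sqint_reflect)
  qed
qed

text \<open>The general bound with \<open>UNIV\<close> as the support of \<open>g\<close>: the
  measure of the support of \<open>f\<close> alone controls every fibre.\<close>

lemma nconv_null_cone_le_cball:
  assumes M: "M \<ge> 1" and pos: "L > 0" "\<rho> > 0"
    and [measurable]: "f \<in> borel_measurable borel" "g \<in> borel_measurable borel"
    and f: "\<And>p. p \<notin> null_cone M s N L \<Longrightarrow> f p = 0" "\<And>p. snd p \<notin> cball a \<rho> \<Longrightarrow> f p = 0"
  shows "sqint (nconv f g) \<le> ennreal (2 * M * L * (pi * \<rho>\<^sup>2)) * sqint f * sqint g"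
proof (rule sqint_nconv_le)
  show "null_cone M s N L \<inter> {p. snd p \<in> cball a \<rho>} \<in> sets borel" by measurable
  show "emeasure lborel {y \<in> null_cone M s N L \<inter> {p. snd p \<in> cball a \<rho>}. x - y \<in> UNIV} \<le> ennreal (2 * M * L * (pi * \<rho>\<^sup>2))" for x
    using emeasure_null_cone_cball[OF M pos, of s N a] by (simp only: UNIV_I simp_thms Collect_mem_eq)
qed (use f in auto)

lemma trilin_le_of_nconv_le:
  assumes "f \<in> borel_measurable borel" "g \<in> borel_measurable borel" "h \<in> borel_measurable borel"
    and "sqint (nconv g h) \<le> K * sqint g * sqint h"
  shows "(trilin f g h)\<^sup>2 \<le> K * sqint f * sqint g * sqint h"
proof -
  have "(trilin f g h)\<^sup>2 \<le> sqint f * (K * sqint g * sqint h)"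
    by (rule order_trans[OF trilin_le_nconv mult_left_mono]) (use assms in auto)
  then show ?thesis by (simp add: mult_ac)
qed

text \<open>The factor 4 arises only when the functions are localised to discs; the other cases are
  padded so that all share one constant.\<close>

lemma le_4_mult: "(x :: ennreal) \<le> K * a * b * c \<Longrightarrow> x \<le> 4 * K * a * b * c"
  using mult_right_mono[of 1 4 "K * a * b * c"] by (simp add: mult.assoc)

text \<open>Indexing the functions makes each estimate available for every assignment of the three
  roles, so the symmetry of the form can be used by permuting indices.\<close>

locale cone_functions =
  fixes M :: real and s :: "nat \<Rightarrow> real" and N L :: "nat \<Rightarrow> real" and f :: "nat \<Rightarrow> spacetime \<Rightarrow> ennreal"
  assumes M: "M \<ge> 1" and s: "\<And>i. s i \<in> {1, -1}" and N: "\<And>i. N i > 0" and L: "\<And>i. L i > 0"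
    and f_measurable[measurable]: "\<And>i. f i \<in> borel_measurable borel"
    and fin: "\<And>i. sqint (f i) < \<infinity>"
    and supp: "\<And>i p. p \<notin> null_cone M (s i) (N i) (L i) \<Longrightarrow> f i p = 0"
begin

lemma supp_norm: "\<not> norm (snd p) \<le> M * N i \<Longrightarrow> f i p = 0"
  by (rule supp) (simp add: null_cone_iff)

lemma MN_pos: "M * N i > 0"
  using M N[of i] by simp

text \<open>If the smallest frequency belongs to \<open>f j\<close> or \<open>f k\<close>, a disc
  about 0 already contains its spatial support, and that function is placed first in the
  convolution. Only the case of \<open>f i\<close> calls for localisation.\<close>

lemma trilin_le_1:
  fixes i j k :: nat
  defines "r \<equiv> min (N i) (min (N j) (N k))"
  shows "(trilin (f i) (f j) (f k))\<^sup>2 \<le>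
    4 * ennreal (24 * M\<^sup>2 * (M * r) * min (L j) (L k) * sqrt (min (N j) (N k) * max (L j) (L k))) *
    sqint (f i) * sqint (f j) * sqint (f k)"
proof -
  let ?K = "\<lambda>r. ennreal (24 * M\<^sup>2 * (M * r) * min (L j) (L k) * sqrt (min (N j) (N k) * max (L j) (L k)))"
  consider "r = N j" | "r = N k" | "r = N i"
    unfolding r_def by linarith
  then show ?thesis
  proof cases
    case 1
    have "sqint (nconv (f j) (f k)) \<le> ?K (N j) * sqint (f j) * sqint (f k)"
      by (rule nconv_null_cone_le[where a=0 and ?s1.0="s j" and ?s2.0="s k"])
         (use M s N L MN_pos supp supp_norm in auto)
    then show ?thesis
      unfolding 1 by (intro le_4_mult trilin_le_of_nconv_le) auto
  next
    case 2
    have "sqint (nconv (f k) (f j)) \<le> ennreal (24 * M\<^sup>2 * (M * N k) * min (L k) (L j) * sqrt (min (N k) (N j) * max (L k) (L j))) * sqint (f k) * sqint (f j)"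
      by (rule nconv_null_cone_le[where a=0 and ?s1.0="s k" and ?s2.0="s j"])
         (use M s N L MN_pos supp supp_norm in auto)
    then have "(trilin (f i) (f k) (f j))\<^sup>2 \<le> ?K (N k) * sqint (f i) * sqint (f k) * sqint (f j)"
      unfolding min.commute[of "L k"] max.commute[of "L k"] min.commute[of "N k"]
      by (intro trilin_le_of_nconv_le) auto
    then show ?thesis
      unfolding 2 by (intro le_4_mult) (simp add: trilin_commute23[of "f j" "f k"] mult_ac)
  next
    case 3
    show ?thesis
      unfolding 3
    proof (rule trilin_localize[where \<rho> = "M * N i"])
      fix a :: "real^2" and h' :: "spacetime \<Rightarrow> ennreal"
      assume h'[measurable]: "h' \<in> borel_measurable borel" and le: "\<And>y. h' y \<le> f k y"
      have h0: "h' p = 0" if "p \<notin> null_cone M (s k) (N k) (L k)" for p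
        using le[of p] supp[OF that] by simp
      let ?g = "\<lambda>y. f j y * indicator (cball a (M * N i)) (snd y)"
      have [measurable]: "?g \<in> borel_measurable borel" by measurable
      have "sqint (nconv ?g h') \<le> ?K (N i) * sqint ?g * sqint h'"
        by (rule nconv_null_cone_le[where a=a and ?s1.0="s j" and ?s2.0="s k"])
           (use M s N L MN_pos supp h0 in auto)
      then show "(trilin (f i) ?g h')\<^sup>2 \<le> ?K (N i) * sqint (f i) * sqint ?g * sqint h'"
        by (intro trilin_le_of_nconv_le) auto
    qed (use fin MN_pos supp_norm in auto)
  qed
qed

text \<open>The function \<open>f j\<close> supplies both the thickness and the disc. The hypothesis
  ensures that the minimum of the three frequencies is attained at \<open>i\<close> or
  \<open>j\<close>; if at \<open>i\<close>, \<open>f j\<close> is localised first.\<close>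

lemma trilin_le_2_aux:
  fixes i j k :: nat
  assumes "N i \<le> N k"
  shows "(trilin (f i) (f j) (f k))\<^sup>2 \<le>
    4 * ennreal (2 * M * L j * (pi * (M * min (N i) (N j))\<^sup>2)) * sqint (f i) * sqint (f j) * sqint (f k)"
proof (cases "N j \<le> N i")
  case True
  have "sqint (nconv (f j) (f k)) \<le> ennreal (2 * M * L j * (pi * (M * N j)\<^sup>2)) * sqint (f j) * sqint (f k)"
    by (rule nconv_null_cone_le_cball[where a=0 and s="s j" and N="N j"])
       (use M L MN_pos supp supp_norm in auto)
  then show ?thesis
    using True by (intro le_4_mult trilin_le_of_nconv_le) auto
next
  case False
  then have eq: "min (N i) (N j) = N i" by simp
  show ?thesis
    unfolding eq
  proof (rule trilin_localize[where \<rho> = "M * N i"])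
    fix a :: "real^2" and h' :: "spacetime \<Rightarrow> ennreal"
    assume h'[measurable]: "h' \<in> borel_measurable borel"
    let ?g = "\<lambda>y. f j y * indicator (cball a (M * N i)) (snd y)"
    have [measurable]: "?g \<in> borel_measurable borel" by measurable
    have "sqint (nconv ?g h') \<le> ennreal (2 * M * L j * (pi * (M * N i)\<^sup>2)) * sqint ?g * sqint h'"
      by (rule nconv_null_cone_le_cball[where a=a and s="s j" and N="N j"])
         (use M L MN_pos supp in auto)
    then show "(trilin (f i) ?g h')\<^sup>2 \<le> ennreal (2 * M * L j * (pi * (M * N i)\<^sup>2)) * sqint (f i) * sqint ?g * sqint h'"
      by (intro trilin_le_of_nconv_le) auto
  qed (use fin MN_pos supp_norm in auto)
qed

text \<open>Exchanging \<open>f i\<close> and \<open>f k\<close> provides the ordering required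
  above while \<open>f j\<close>, whose thickness appears in the bound, keeps its place.\<close>

lemma trilin_le_2:
  fixes i j k :: nat
  shows "(trilin (f i) (f j) (f k))\<^sup>2 \<le>
    4 * ennreal (2 * M * L j * (pi * (M * min (N i) (min (N j) (N k)))\<^sup>2)) * sqint (f i) * sqint (f j) * sqint (f k)"
proof (cases "N i \<le> N k")
  case True
  then have "min (N i) (min (N j) (N k)) = min (N i) (N j)" by auto
  then show ?thesis
    using trilin_le_2_aux[OF True, of j] by simp
next
  case False
  then have "min (N i) (min (N j) (N k)) = min (N k) (N j)" by auto
  moreover have "trilin (f i) (f j) (f k) = trilin (f k) (f j) (f i)"
    by (metis trilin_commute12 trilin_commute23 f_measurable)
  ultimately show ?thesis
    using trilin_le_2_aux[of k i j] False by (simp add: mult_ac)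
qed

end

section \<open>From multipliers to the trilinear form\<close>

definition cconv :: "('a::euclidean_space \<Rightarrow> complex) \<Rightarrow> ('a \<Rightarrow> complex) \<Rightarrow> 'a \<Rightarrow> complex" where
  "cconv f g x = (LINT y|lborel. f y * g (x - y))"

lemma integrable_cconv_kernel:
  fixes f g :: "'a::euclidean_space \<Rightarrow> complex"
  assumes f: "integrable lborel f" and g: "integrable lborel g"
  shows "integrable (lborel \<Otimes>\<^sub>M lborel) (\<lambda>(y, x). f y * g (x - y))"
proof (rule lborel_pair.Fubini_integrable)
  have [measurable]: "f \<in> borel_measurable borel" "g \<in> borel_measurable borel"
    using f g by auto
  show "(\<lambda>(y, x). f y * g (x - y)) \<in> borel_measurable (lborel \<Otimes>\<^sub>M lborel)"
    by measurable
  have "(LINT x|lborel. norm (case (y, x) of (y, x) \<Rightarrow> f y * g (x - y))) = cmod (f y) * (LINT x|lborel. cmod (g x))" for y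
  proof -
    have "complex_of_real (LINT x|lborel. cmod (g (x - y))) = complex_of_real (LINT x|lborel. cmod (g x))"
      using integral_lborel_shift[of "\<lambda>x. complex_of_real (cmod (g x))" y] by simp
    then show ?thesis
      by (simp add: norm_mult)
  qed
  then show "integrable lborel (\<lambda>y. LINT x|lborel. norm (case (y, x) of (y, x) \<Rightarrow> f y * g (x - y)))"
    using f by simp
  show "AE y in lborel. integrable lborel (\<lambda>x. case (y, x) of (y, x) \<Rightarrow> f y * g (x - y))"
    using integrable_lborel_shift[OF g] by simp
qed

lemma integrable_cconv:
  assumes "integrable lborel f" "integrable lborel g"
  shows "integrable lborel (cconv f g)"
  unfolding cconv_def[abs_def] by (rule lborel_pair.integrable_snd[OF integrable_cconv_kernel[OF assms]])

lemma integral_cconv: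
  assumes f: "integrable lborel f" and g: "integrable lborel g"
  shows "(LINT x|lborel. cconv f g x) = (LINT x|lborel. f x) * (LINT x|lborel. g x)"
proof -
  have "(LINT x|lborel. cconv f g x) = (LINT y|lborel. LINT x|lborel. f y * g (x - y))"
    unfolding cconv_def by (rule lborel_pair.Fubini_integral[OF integrable_cconv_kernel[OF f g]])
  then show ?thesis
    using g by (simp add: integral_lborel_shift)
qed

text \<open>The character is multiplicative, so it can be distributed over the two factors; what
  remains is the total integral of a convolution.\<close>

lemma fourier_cconv:
  assumes f: "integrable lborel f" and g: "integrable lborel g"
  shows "fourier (cconv f g) w = fourier f w * fourier g w"
proof -
  let ?e = "\<lambda>x. exp (- \<i> * complex_of_real (x \<bullet> w))"
  have eq: "?e x * cconv f g x = cconv (\<lambda>x. ?e x * f x) (\<lambda>x. ?e x * g x) x" for x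
  proof -
    have *: "?e x * (f y * g (x - y)) = ?e y * f y * (?e (x - y) * g (x - y))" for y
    proof -
      have "?e x = ?e y * ?e (x - y)"
        by (simp add: inner_diff_left algebra_simps flip: exp_add)
      then show ?thesis by (simp add: mult_ac)
    qed
    show ?thesis
      unfolding cconv_def integral_mult_right_zero[symmetric] * ..
  qed
  show ?thesis
    unfolding fourier_def eq by (rule integral_cconv[OF integrable_mult_exp[OF f] integrable_mult_exp[OF g]])
qed

text \<open>The argument \<open>- x\<close> reconciles ordinary convolution with the symmetric
  convention of \<open>nconv\<close>.\<close>

lemma cmod_cconv_le_nconv:
  assumes [measurable]: "f \<in> borel_measurable borel" "g \<in> borel_measurable borel"
  shows "ennreal (cmod (cconv f g x)) \<le> nconv (\<lambda>x. ennreal (cmod (f x))) (\<lambda>x. ennreal (cmod (g x))) (- x)"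
  unfolding cconv_def nconv_def
  by (rule order_trans[OF norm_integral_le_nn_integral]) (simp add: norm_mult ennreal_mult)

lemma nconv_power2_le:
  assumes [measurable]: "f \<in> borel_measurable borel" "g \<in> borel_measurable borel"
  shows "(nconv f g x)\<^sup>2 \<le> sqint f * sqint g"
proof -
  have "(nconv f g x)\<^sup>2 \<le> sqint f * (\<integral>\<^sup>+y. (g (- x - y))\<^sup>2 \<partial>lborel)"
    unfolding nconv_def sqint_def by (rule Cauchy_Schwarz_nn_integral) measurable
  also have "(\<integral>\<^sup>+y. (g (- x - y))\<^sup>2 \<partial>lborel) = sqint g"
    unfolding sqint_def by (rule nn_integral_lborel_reflect) measurable
  finally show ?thesis .
qed

lemma sqint_cmod: "f \<in> L2_space \<Longrightarrow> sqint (\<lambda>x. ennreal (cmod (f x))) = ennreal ((L2_norm f)\<^sup>2)"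
  by (simp add: sqint_def ennreal_power flip: nn_integral_L2_norm)

text \<open>The convolution is integrable, and Cauchy-Schwarz bounds it pointwise by the product of
  the norms; a bounded integrable function is square-integrable.\<close>

lemma cconv_L2:
  assumes f: "integrable lborel f" "f \<in> L2_space" and g: "integrable lborel g" "g \<in> L2_space"
  shows "cconv f g \<in> L2_space"
proof (rule bounded_integrable_imp_L2)
  have [measurable]: "f \<in> borel_measurable borel" "g \<in> borel_measurable borel"
    using f g by auto
  show "integrable lborel (cconv f g)"
    by (rule integrable_cconv[OF f(1) g(1)])
  show "cmod (cconv f g x) \<le> L2_norm f * L2_norm g" for x
  proof -
    have "(ennreal (cmod (cconv f g x)))\<^sup>2 \<le> (nconv (\<lambda>x. ennreal (cmod (f x))) (\<lambda>x. ennreal (cmod (g x))) (- x))\<^sup>2"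
      by (intro power_mono cmod_cconv_le_nconv) auto
    also have "\<dots> \<le> ennreal ((L2_norm f)\<^sup>2) * ennreal ((L2_norm g)\<^sup>2)"
      using nconv_power2_le[of "\<lambda>x. ennreal (cmod (f x))" "\<lambda>x. ennreal (cmod (g x))"] by (simp add: sqint_cmod f g)
    also have "\<dots> = (ennreal (L2_norm f * L2_norm g))\<^sup>2"
      by (simp add: ennreal_power L2_norm_nonneg power_mult_distrib ennreal_mult)
    finally have "ennreal (cmod (cconv f g x)) \<le> ennreal (L2_norm f * L2_norm g)"
      by (rule ennreal_power2_mono_rev)
    then show ?thesis
      by (simp add: L2_norm_nonneg)
  qed
qed

lemma ifourier_mult:
  fixes f g :: "'a::euclidean_space \<Rightarrow> complex"
  assumes f: "integrable lborel f" and g: "integrable lborel g"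
  shows "ifourier f z * ifourier g z = ifourier (\<lambda>x. cconv f g x / complex_of_real ((2*pi) ^ DIM('a))) z"
proof -
  have "fourier (\<lambda>x. cconv f g x / complex_of_real ((2*pi) ^ DIM('a))) w = fourier (cconv f g) w / complex_of_real ((2*pi) ^ DIM('a))" for w
    unfolding fourier_def by (subst integral_divide_zero[symmetric]) simp
  then show ?thesis
    by (simp add: ifourier_def fourier_cconv[OF f g])
qed

text \<open>The product need not be Schwartz, so its transform is found from inversion: each factor
  is almost everywhere the inverse transform of an integrable truncation, and the product of inverse
  transforms is that of the normalised convolution.\<close>

lemma has_fourier_L2_multiplier_mult:
  fixes u1 u2 :: "'a::euclidean_space \<Rightarrow> complex"
  assumes u: "has_fourier_L2 u1 g1" "has_fourier_L2 u2 g2"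
    and A: "A1 \<in> sets borel" "bounded A1" "A2 \<in> sets borel" "bounded A2"
  shows "has_fourier_L2 (\<lambda>z. multiplier A1 u1 z * multiplier A2 u2 z)
    (\<lambda>x. cconv (\<lambda>w. indicator A1 w * g1 w) (\<lambda>w. indicator A2 w * g2 w) x / complex_of_real ((2*pi) ^ DIM('a)))"
proof -
  let ?h1 = "\<lambda>w. indicator A1 w * g1 w" and ?h2 = "\<lambda>w. indicator A2 w * g2 w"
  let ?G = "\<lambda>x. cconv ?h1 ?h2 x / complex_of_real ((2*pi) ^ DIM('a))"
  have g: "g1 \<in> L2_space" "g2 \<in> L2_space"
    using u by (auto simp: has_fourier_L2_def)
  note h1 = L2_indicator_integrable[OF g(1) A(1,2)] and h2 = L2_indicator_integrable[OF g(2) A(3,4)]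
  note m1 = multiplier_eq_ifourier[OF u(1) A(1,2)] and m2 = multiplier_eq_ifourier[OF u(2) A(3,4)]
  have G1: "integrable lborel ?G"
    by (intro integrable_divide_zero impI integrable_cconv h1 h2)
  have "cconv ?h1 ?h2 \<in> L2_space"
    by (intro cconv_L2 h1 h2)
  then have G2: "?G \<in> L2_space"
    by (auto simp: L2_space_def norm_divide power_divide intro!: borel_measurable_divide)
  show ?thesis
  proof (rule has_fourier_L2_cong_AE[OF ifourier_L2(3)[OF G1 G2]])
    show "(\<lambda>z. multiplier A1 u1 z * multiplier A2 u2 z) \<in> borel_measurable borel"
      using m1(1) m2(1) by (intro borel_measurable_times L2_measurable)
    show "AE z in lborel. ifourier ?G z = multiplier A1 u1 z * multiplier A2 u2 z"
      using m1(2) m2(2) by eventually_elim (simp only: ifourier_mult[OF h1(2) h2(2)])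
  qed (use L2_measurable[OF G2] in auto)
qed

text \<open>Duality: test the trilinear form with the restricted convolution itself and divide by
  its squared norm. The division is legitimate because this norm is finite, the convolution being
  bounded and \<open>A\<close> of finite measure.\<close>

lemma sqint_restricted_nconv_le:
  fixes f g :: "'a::euclidean_space \<Rightarrow> ennreal"
  assumes [measurable]: "f \<in> borel_measurable borel" "g \<in> borel_measurable borel"
    and fin: "sqint f < \<infinity>" "sqint g < \<infinity>"
    and A[measurable]: "A \<in> sets borel" and bA: "bounded A"
    and bound: "\<And>k. k \<in> borel_measurable borel \<Longrightarrow> sqint k < \<infinity> \<Longrightarrow> (\<And>x. x \<notin> A \<Longrightarrow> k x = 0) \<Longrightarrow>
      (trilin k f g)\<^sup>2 \<le> K * sqint k * sqint f * sqint g"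
  shows "sqint (\<lambda>x. indicator A x * nconv f g x) \<le> K * sqint f * sqint g"
proof -
  let ?k = "\<lambda>x. indicator A x * nconv f g x"
  have [measurable]: "?k \<in> borel_measurable borel" by measurable
  have "sqint ?k \<le> (\<integral>\<^sup>+x. sqint f * sqint g * indicator A x \<partial>lborel)"
    unfolding sqint_def[of ?k]
    by (intro nn_integral_mono) (auto simp: nconv_power2_le split: split_indicator)
  also have "\<dots> = sqint f * sqint g * emeasure lborel A"
    by (simp add: nn_integral_cmult_indicator)
  also have "\<dots> < \<infinity>"
    using fin emeasure_bounded_finite[OF bA] by (simp add: ennreal_mult_less_top)
  finally have k_fin: "sqint ?k < \<infinity>" .
  have "trilin ?k f g = sqint ?k"
    unfolding trilin_def sqint_def
    by (intro nn_integral_cong) (auto simp: power2_eq_square split: split_indicator)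
  then have "(sqint ?k)\<^sup>2 \<le> K * sqint ?k * sqint f * sqint g"
    using bound[of ?k] k_fin by simp
  then have "sqint ?k * sqint ?k \<le> sqint ?k * (K * sqint f * sqint g)"
    by (simp add: power2_eq_square mult_ac)
  then show ?thesis
    using k_fin by (cases "sqint ?k = 0") (auto simp: ennreal_mult_le_mult_iff)
qed

text \<open>The form is tested with functions supported on the reflection of \<open>A0\<close>, as
  dictated by the sign in \<open>nconv\<close>. The two input transforms each contribute
  \<open>(2*pi) ^ DIM('a)\<close> and the inverse transform of the output removes one such
  factor.\<close>

lemma multiplier_mult_bound:
  fixes u1 u2 :: "'a::euclidean_space \<Rightarrow> complex"
  assumes u: "u1 \<in> schwartz" "u2 \<in> schwartz"
    and A: "A0 \<in> sets borel" "bounded A0" "A1 \<in> sets borel" "bounded A1" "A2 \<in> sets borel" "bounded A2"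
    and K: "K \<ge> 0"
    and bound: "\<And>f0 f1 f2. f0 \<in> borel_measurable borel \<Longrightarrow> f1 \<in> borel_measurable borel \<Longrightarrow> f2 \<in> borel_measurable borel \<Longrightarrow>
      sqint f0 < \<infinity> \<Longrightarrow> sqint f1 < \<infinity> \<Longrightarrow> sqint f2 < \<infinity> \<Longrightarrow>
      (\<And>x. - x \<notin> A0 \<Longrightarrow> f0 x = 0) \<Longrightarrow> (\<And>x. x \<notin> A1 \<Longrightarrow> f1 x = 0) \<Longrightarrow> (\<And>x. x \<notin> A2 \<Longrightarrow> f2 x = 0) \<Longrightarrow>
      (trilin f0 f1 f2)\<^sup>2 \<le> ennreal K * sqint f0 * sqint f1 * sqint f2"
  defines "w \<equiv> multiplier A0 (\<lambda>z. multiplier A1 u1 z * multiplier A2 u2 z)"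
  shows "w \<in> L2_space" and "(L2_norm w)\<^sup>2 \<le> (2*pi) ^ DIM('a) * K * (L2_norm u1)\<^sup>2 * (L2_norm u2)\<^sup>2"
proof -
  let ?c = "(2*pi) ^ DIM('a)"
  have c1: "?c \<ge> 1"
    using pi_ge_two by (intro one_le_power) simp
  define h1 h2 where "h1 = (\<lambda>w. indicator A1 w * fourier u1 w)" and "h2 = (\<lambda>w. indicator A2 w * fourier u2 w)"
  define G where "G = (\<lambda>x. cconv h1 h2 x / complex_of_real ?c)"
  have F: "fourier u1 \<in> L2_space" "fourier u2 \<in> L2_space"
    using u by (auto intro: fourier_L2 schwartz_L2 schwartz_integrable)
  have h: "h1 \<in> L2_space" "integrable lborel h1" "h2 \<in> L2_space" "integrable lborel h2"
    unfolding h1_def h2_def by (intro L2_indicator_integrable F A)+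
  have h0: "x \<notin> A1 \<Longrightarrow> h1 x = 0" "x \<notin> A2 \<Longrightarrow> h2 x = 0" for x
    by (auto simp: h1_def h2_def)
  have [measurable]: "h1 \<in> borel_measurable borel" "h2 \<in> borel_measurable borel" "cconv h1 h2 \<in> borel_measurable borel"
    using h integrable_cconv[OF h(2,4)] by auto
  note [measurable] = A(1,3,5)
  have p: "has_fourier_L2 (\<lambda>z. multiplier A1 u1 z * multiplier A2 u2 z) G"
    unfolding G_def h1_def h2_def by (intro has_fourier_L2_multiplier_mult has_fourier_L2_fourier u A)
  note w = multiplier_eq_ifourier[OF p A(1,2), folded w_def]
  show "w \<in> L2_space" by (rule w)
  have G: "G \<in> L2_space"
    using p by (simp add: has_fourier_L2_def)
  let ?k = "\<lambda>w. indicator A0 w * G w"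
  note k = L2_indicator_integrable[OF G A(1,2)]
  have "L2_norm w = L2_norm (ifourier ?k)"
    using w(2) by (intro L2_norm_cong_AE L2_measurable w(1) ifourier_L2 k)
  then have 1: "(L2_norm w)\<^sup>2 \<le> (L2_norm ?k)\<^sup>2 / ?c"
    using ifourier_L2(2)[OF k(2,1)] by simp
  let ?a1 = "\<lambda>x. ennreal (cmod (h1 x))" and ?a2 = "\<lambda>x. ennreal (cmod (h2 x))"
  have "ennreal ((L2_norm ?k)\<^sup>2) \<le> sqint (\<lambda>x. indicator (uminus -` A0) (- x) * nconv ?a1 ?a2 (- x))"
    unfolding sqint_cmod[OF k(1), symmetric] sqint_def
  proof (intro nn_integral_mono power_mono)
    fix x
    \<comment> \<open>The denominator of \<open>G\<close> is at least 1 and is dropped, so the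
      resulting power of \<open>2*pi\<close> is not optimised.\<close>
    have "cmod (G x) \<le> cmod (cconv h1 h2 x)"
      using c1 by (simp add: G_def norm_divide norm_power norm_mult divide_le_eq mult_left_le_one_le mult_right_le_one_le mult_le_cancel_left1)
    then have "ennreal (cmod (G x)) \<le> ennreal (cmod (cconv h1 h2 x))"
      by (rule ennreal_leI)
    also have "\<dots> \<le> nconv ?a1 ?a2 (- x)"
      by (rule cmod_cconv_le_nconv) measurable
    finally show "ennreal (cmod (indicator A0 x * G x)) \<le> indicator (uminus -` A0) (- x) * nconv ?a1 ?a2 (- x)"
      by (auto split: split_indicator)
  qed simp
  also have "\<dots> = sqint (\<lambda>x. indicator (uminus -` A0) x * nconv ?a1 ?a2 x)"
    by (rule sqint_reflect) measurable
  also have "\<dots> \<le> ennreal K * sqint ?a1 * sqint ?a2"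
  proof (rule sqint_restricted_nconv_le)
    show "uminus -` A0 \<in> sets borel"
      using measurable_sets[OF borel_measurable_uminus[OF measurable_ident] A(1)] by simp
    show "bounded (uminus -` A0)"
      using A(2) unfolding bounded_iff by (metis norm_minus_cancel vimageE)
    show "(trilin k ?a1 ?a2)\<^sup>2 \<le> ennreal K * sqint k * sqint ?a1 * sqint ?a2"
      if "k \<in> borel_measurable borel" "sqint k < \<infinity>" "\<And>x. x \<notin> uminus -` A0 \<Longrightarrow> k x = 0" for k
      using that by (intro bound) (auto simp: sqint_cmod h h0)
  qed (auto simp: sqint_cmod h)
  also have "\<dots> = ennreal (K * (L2_norm h1)\<^sup>2 * (L2_norm h2)\<^sup>2)"
    using K by (simp add: sqint_cmod h ennreal_mult)
  finally have 2: "(L2_norm ?k)\<^sup>2 \<le> K * (L2_norm h1)\<^sup>2 * (L2_norm h2)\<^sup>2"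
    using K by (subst (asm) ennreal_le_iff) auto
  have ind: "(L2_norm (\<lambda>w. indicator B w * fourier v w))\<^sup>2 \<le> ?c * (L2_norm v)\<^sup>2"
    if v: "v \<in> schwartz" and B: "B \<in> sets borel" "bounded B" for v :: "'a \<Rightarrow> complex" and B
  proof -
    have Fv: "fourier v \<in> L2_space"
      using v by (intro fourier_L2 schwartz_L2 schwartz_integrable)
    have "(L2_norm (\<lambda>w. indicator B w * fourier v w))\<^sup>2 \<le> (L2_norm (fourier v))\<^sup>2"
      unfolding L2_norm_power2
      by (intro integral_mono L2_integrable Fv L2_indicator_integrable B) (auto split: split_indicator)
    also have "\<dots> \<le> ?c * (L2_norm v)\<^sup>2"
      using v by (intro fourier_L2 schwartz_L2 schwartz_integrable)
    finally show ?thesis .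
  qed
  have "(L2_norm h1)\<^sup>2 * (L2_norm h2)\<^sup>2 \<le> (?c * (L2_norm u1)\<^sup>2) * (?c * (L2_norm u2)\<^sup>2)"
    unfolding h1_def h2_def by (intro mult_mono ind u A) auto
  then have "K * ((L2_norm h1)\<^sup>2 * (L2_norm h2)\<^sup>2) \<le> K * ((?c * (L2_norm u1)\<^sup>2) * (?c * (L2_norm u2)\<^sup>2))"
    using K by (rule mult_left_mono)
  with 2 have "(L2_norm ?k)\<^sup>2 \<le> K * ((?c * (L2_norm u1)\<^sup>2) * (?c * (L2_norm u2)\<^sup>2))"
    by (simp add: mult.assoc)
  then have "(L2_norm ?k)\<^sup>2 / ?c \<le> K * ((?c * (L2_norm u1)\<^sup>2) * (?c * (L2_norm u2)\<^sup>2)) / ?c"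
    by (rule divide_right_mono) simp
  with 1 have "(L2_norm w)\<^sup>2 \<le> K * ((?c * (L2_norm u1)\<^sup>2) * (?c * (L2_norm u2)\<^sup>2)) / ?c"
    by (rule order_trans)
  also have "\<dots> = ?c * K * (L2_norm u1)\<^sup>2 * (L2_norm u2)\<^sup>2"
    by simp
  finally show "(L2_norm w)\<^sup>2 \<le> ?c * K * (L2_norm u1)\<^sup>2 * (L2_norm u2)\<^sup>2" .
qed

section \<open>The bilinear estimate\<close>

lemma power2_powr_half: "x \<ge> 0 \<Longrightarrow> (x powr (1/2))\<^sup>2 = (x :: real)"
  by (simp add: powr_half_sqrt)

lemma power2_powr_quarter: "x \<ge> 0 \<Longrightarrow> (x powr (1/4))\<^sup>2 = sqrt (x :: real)"
proof -
  assume x: "x \<ge> 0"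
  have "(x powr (1/4))\<^sup>2 = x powr (1/4 + 1/4)"
    by (simp only: powr_add power2_eq_square)
  then show ?thesis using x by (simp add: powr_half_sqrt)
qed

definition cone_quantities :: "real \<Rightarrow> real \<Rightarrow> real \<Rightarrow> real \<Rightarrow> real \<Rightarrow> real \<Rightarrow> real set" where
  "cone_quantities N0 N1 N2 L0 L1 L2 =
     { (min N0 (min N1 N2) * min L1 L2) powr (1/2) * (min N1 N2 * max L1 L2) powr (1/4),
       (min N0 (min N1 N2) * min L0 L1) powr (1/2) * (min N0 N1 * max L0 L1) powr (1/4),
       (min N0 (min N1 N2) * min L0 L2) powr (1/2) * (min N0 N2 * max L0 L2) powr (1/4),
       ((min N0 (min N1 N2))\<^sup>2 * min L0 (min L1 L2)) powr (1/2) }"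

text \<open>The trilinear bounds concern squares. Squaring the quantities removes the powers 1/2 and
  leaves a square root in place of the powers 1/4, matching the volume estimates.\<close>

lemma cone_quantities_power2:
  assumes "Q \<in> cone_quantities N0 N1 N2 L0 L1 L2"
    and pos: "N0 > 0" "N1 > 0" "N2 > 0" "L0 > 0" "L1 > 0" "L2 > 0"
  shows "Q\<^sup>2 \<in> { min N0 (min N1 N2) * min L1 L2 * sqrt (min N1 N2 * max L1 L2),
       min N0 (min N1 N2) * min L0 L1 * sqrt (min N0 N1 * max L0 L1),
       min N0 (min N1 N2) * min L0 L2 * sqrt (min N0 N2 * max L0 L2),
       (min N0 (min N1 N2))\<^sup>2 * min L0 (min L1 L2) }"
proof -
  have a: "((n * l) powr (1/2) * x powr (1/4))\<^sup>2 = n * l * sqrt x" if "n * l \<ge> 0" "x \<ge> 0" for n l x :: real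
    unfolding power_mult_distrib using that by (simp only: power2_powr_half power2_powr_quarter)
  have b: "(x powr (1/2))\<^sup>2 = x" if "x \<ge> 0" for x :: real
    using that by (rule power2_powr_half)
  show ?thesis
    using assms(1) unfolding cone_quantities_def
  proof (elim insertE emptyE)
    assume "Q = (min N0 (min N1 N2) * min L1 L2) powr (1/2) * (min N1 N2 * max L1 L2) powr (1/4)"
    then show ?thesis using pos by (simp add: a)
  next
    assume "Q = (min N0 (min N1 N2) * min L0 L1) powr (1/2) * (min N0 N1 * max L0 L1) powr (1/4)"
    then show ?thesis using pos by (simp add: a)
  next
    assume "Q = (min N0 (min N1 N2) * min L0 L2) powr (1/2) * (min N0 N2 * max L0 L2) powr (1/4)"
    then show ?thesis using pos by (simp add: a)
  next
    assume "Q = ((min N0 (min N1 N2))\<^sup>2 * min L0 (min L1 L2)) powr (1/2)"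
    then show ?thesis using pos by (simp add: b)
  qed
qed

text \<open>The constant is the 24 of the volume bound times the 4 of localisation. One of the three
  factors \<open>M\<close> comes from the radius \<open>M * r\<close> of the discs, the other two
  from the volume bound.\<close>

lemma trilin_le_cone_quantities:
  assumes "cone_functions M s N L f" and Q: "Q \<in> cone_quantities (N 0) (N 1) (N 2) (L 0) (L 1) (L 2)"
  shows "(trilin (f 0) (f 1) (f 2))\<^sup>2 \<le> ennreal (96 * M^3 * Q\<^sup>2) * sqint (f 0) * sqint (f 1) * sqint (f 2)"
proof -
  interpret cone_functions M s N L f by fact
  let ?r = "min (N 0) (min (N 1) (N 2))"
  have four: "4 * ennreal x = ennreal (4 * x)" if "x \<ge> 0" for x
    using that by (simp add: ennreal_mult)
  have r: "?r > 0" "min (N 2) (min (N 0) (N 1)) = ?r" "min (N 1) (min (N 0) (N 2)) = ?r" "min (N 0) (min (N 2) (N 1)) = ?r"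
    using N by (auto simp: min_def)
  have M0: "M > 0" using M by simp
  have est1: "(trilin (f i) (f j) (f k))\<^sup>2 \<le>
      ennreal (96 * M^3 * (min (N i) (min (N j) (N k)) * min (L j) (L k) * sqrt (min (N j) (N k) * max (L j) (L k)))) *
      sqint (f i) * sqint (f j) * sqint (f k)" for i j k
  proof -
    let ?m = "min (N i) (min (N j) (N k))"
    have "4 * ennreal (24 * M\<^sup>2 * (M * ?m) * min (L j) (L k) * sqrt (min (N j) (N k) * max (L j) (L k))) =
      ennreal (4 * (24 * M\<^sup>2 * (M * ?m) * min (L j) (L k) * sqrt (min (N j) (N k) * max (L j) (L k))))"
      using M0 N[of i] N[of j] N[of k] L[of j] L[of k] by (intro four) auto
    also have "4 * (24 * M\<^sup>2 * (M * ?m) * min (L j) (L k) * sqrt (min (N j) (N k) * max (L j) (L k))) =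
      96 * M^3 * (?m * min (L j) (L k) * sqrt (min (N j) (N k) * max (L j) (L k)))"
      by (simp add: power2_eq_square power3_eq_cube)
    finally show ?thesis
      using trilin_le_1[of i j k] by simp
  qed
  have est2: "(trilin (f i) (f j) (f k))\<^sup>2 \<le>
      ennreal (96 * M^3 * ((min (N i) (min (N j) (N k)))\<^sup>2 * L j)) * sqint (f i) * sqint (f j) * sqint (f k)" for i j k
  proof -
    let ?m = "min (N i) (min (N j) (N k))"
    have "4 * ennreal (2 * M * L j * (pi * (M * ?m)\<^sup>2)) = ennreal (4 * (2 * M * L j * (pi * (M * ?m)\<^sup>2)))"
      using M0 L[of j] by (intro four) auto
    also have "\<dots> \<le> ennreal (96 * M^3 * (?m\<^sup>2 * L j))"
    proof (rule ennreal_leI)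
      have "4 * (2 * M * L j * (pi * (M * ?m)\<^sup>2)) = (8 * pi) * (M^3 * (?m\<^sup>2 * L j))"
        by (simp add: power2_eq_square power3_eq_cube)
      \<comment> \<open>The disc estimate has the smaller constant \<open>8 * pi\<close>, which is
        below 32, and is raised to the common one.\<close>
      also have "\<dots> \<le> 96 * (M^3 * (?m\<^sup>2 * L j))"
        using M0 L[of j] pi_less_4 by (intro mult_right_mono) auto
      finally show "4 * (2 * M * L j * (pi * (M * ?m)\<^sup>2)) \<le> 96 * M^3 * (?m\<^sup>2 * L j)"
        by simp
    qed
    finally show ?thesis
      using trilin_le_2[of i j k] by (elim order_trans) (intro mult_right_mono; simp)
  qed
  \<comment> \<open>The first slot of \<open>est1\<close> holds the function whose thickness does
    not enter, the middle slot of \<open>est2\<close> the one whose thickness does. These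
    permutations put the required function there.\<close>
  have p: "trilin (f 2) (f 0) (f 1) = trilin (f 0) (f 1) (f 2)" "trilin (f 1) (f 0) (f 2) = trilin (f 0) (f 1) (f 2)"
    "trilin (f 0) (f 2) (f 1) = trilin (f 0) (f 1) (f 2)"
    by (metis trilin_commute12 trilin_commute23 f_measurable)+
  have "Q\<^sup>2 \<in> { ?r * min (L 1) (L 2) * sqrt (min (N 1) (N 2) * max (L 1) (L 2)),
       ?r * min (L 0) (L 1) * sqrt (min (N 0) (N 1) * max (L 0) (L 1)),
       ?r * min (L 0) (L 2) * sqrt (min (N 0) (N 2) * max (L 0) (L 2)),
       ?r\<^sup>2 * min (L 0) (min (L 1) (L 2)) }"
    by (rule cone_quantities_power2[OF Q N N N L L L])
  then consider
      "Q\<^sup>2 = ?r * min (L 1) (L 2) * sqrt (min (N 1) (N 2) * max (L 1) (L 2))"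
    | "Q\<^sup>2 = ?r * min (L 0) (L 1) * sqrt (min (N 0) (N 1) * max (L 0) (L 1))"
    | "Q\<^sup>2 = ?r * min (L 0) (L 2) * sqrt (min (N 0) (N 2) * max (L 0) (L 2))"
    | "Q\<^sup>2 = ?r\<^sup>2 * min (L 0) (min (L 1) (L 2))"
    by blast
  then show ?thesis
  proof cases
    case 1
    show ?thesis unfolding 1 by (rule est1[of 0 1 2])
  next
    case 2
    show ?thesis unfolding 2 using est1[of 2 0 1] unfolding p r by (simp only: mult_ac)
  next
    case 3
    show ?thesis unfolding 3 using est1[of 1 0 2] unfolding p r by (simp only: mult_ac)
  next
    case 4
    consider "min (L 0) (min (L 1) (L 2)) = L 1" | "min (L 0) (min (L 1) (L 2)) = L 0" | "min (L 0) (min (L 1) (L 2)) = L 2"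
      by linarith
    then show ?thesis
    proof cases
      case 1
      show ?thesis unfolding 4 1 by (rule est2[of 0 1 2])
    next
      case 2
      show ?thesis unfolding 4 2 using est2[of 1 0 2] unfolding p r by (simp only: mult_ac)
    next
      case 3
      show ?thesis unfolding 4 3 using est2[of 0 2 1] unfolding p r by (simp only: mult_ac)
    qed
  qed
qed

theorem theorem2p1:
  fixes M :: real
  assumes "M \<ge> 1"
  shows "\<exists>C::real. C > 0 \<and> (\<forall>N0>0. \<forall>N1>0. \<forall>N2>0. \<forall>L0>0. \<forall>L1>0. \<forall>L2>0.
    \<forall>s0\<in>{1, -1}. \<forall>s1\<in>{1, -1}. \<forall>s2\<in>{1, -1}.
    \<forall>Q\<in>{ (min N0 (min N1 N2) * min L1 L2) powr (1/2) * (min N1 N2 * max L1 L2) powr (1/4),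
          (min N0 (min N1 N2) * min L0 L1) powr (1/2) * (min N0 N1 * max L0 L1) powr (1/4),
          (min N0 (min N1 N2) * min L0 L2) powr (1/2) * (min N0 N2 * max L0 L2) powr (1/4),
          ((min N0 (min N1 N2))\<^sup>2 * min L0 (min L1 L2)) powr (1/2) }.
    \<forall>u1\<in>schwartz. \<forall>u2\<in>schwartz.
      (let w = multiplier (null_cone M s0 N0 L0)
                 (\<lambda>z. multiplier (null_cone M s1 N1 L1) u1 z * multiplier (null_cone M s2 N2 L2) u2 z)
       in w \<in> L2_space \<and> L2_norm w \<le> C * Q * L2_norm u1 * L2_norm u2))"
proof -
  \<comment> \<open>The square root of the constant in the squared estimate: a power of
    \<open>2*pi\<close> from Fourier normalisation and \<open>96 * M^3\<close> from
    geometry.\<close>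
  define C where "C = sqrt ((2*pi) ^ DIM(spacetime) * (96 * M^3))"
  have M0: "M > 0" using assms by simp
  have "C > 0" unfolding C_def using M0 by simp
  have C2: "C\<^sup>2 = (2*pi) ^ DIM(spacetime) * (96 * M^3)"
    unfolding C_def using M0 by (intro real_sqrt_pow2) simp
  have main: "let w = multiplier (null_cone M s0 N0 L0)
                 (\<lambda>z. multiplier (null_cone M s1 N1 L1) u1 z * multiplier (null_cone M s2 N2 L2) u2 z)
       in w \<in> L2_space \<and> L2_norm w \<le> C * Q * L2_norm u1 * L2_norm u2"
    if pos: "N0 > 0" "N1 > 0" "N2 > 0" "L0 > 0" "L1 > 0" "L2 > 0"
      and s: "s0 \<in> {1, -1}" "s1 \<in> {1, -1}" "s2 \<in> {1, -1}"
      and Q: "Q \<in> cone_quantities N0 N1 N2 L0 L1 L2" and u: "u1 \<in> schwartz" "u2 \<in> schwartz"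
    for N0 N1 N2 L0 L1 L2 s0 s1 s2 Q :: real and u1 u2
  proof -
    define w where "w = multiplier (null_cone M s0 N0 L0)
                 (\<lambda>z. multiplier (null_cone M s1 N1 L1) u1 z * multiplier (null_cone M s2 N2 L2) u2 z)"
    have tri: "(trilin f0 f1 f2)\<^sup>2 \<le> ennreal (96 * M^3 * Q\<^sup>2) * sqint f0 * sqint f1 * sqint f2"
      if f: "f0 \<in> borel_measurable borel" "f1 \<in> borel_measurable borel" "f2 \<in> borel_measurable borel"
        "sqint f0 < \<infinity>" "sqint f1 < \<infinity>" "sqint f2 < \<infinity>"
        "\<And>x. - x \<notin> null_cone M s0 N0 L0 \<Longrightarrow> f0 x = 0" "\<And>x. x \<notin> null_cone M s1 N1 L1 \<Longrightarrow> f1 x = 0"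
        "\<And>x. x \<notin> null_cone M s2 N2 L2 \<Longrightarrow> f2 x = 0"
      for f0 f1 f2 :: "spacetime \<Rightarrow> ennreal"
    proof -
      \<comment> \<open>The locale indexes by all natural numbers, so the third value is repeated
        from index 2 on.\<close>
      define sel :: "real \<Rightarrow> real \<Rightarrow> real \<Rightarrow> nat \<Rightarrow> real" where "sel = (\<lambda>a b c i. if i = 0 then a else if i = 1 then b else c)"
      define f where "f i = (if i = 0 then f0 else if i = 1 then f1 else f2)" for i :: nat
      \<comment> \<open>\<open>f0\<close> vanishes off the reflection of the output cone, which is
        the cone of opposite sign; hence \<open>- s0\<close>.\<close>
      have "cone_functions M (sel (- s0) s1 s2) (sel N0 N1 N2) (sel L0 L1 L2) f"
        by unfold_locales (use assms pos s that in \<open>auto simp: sel_def f_def uminus_null_cone\<close>)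
      from trilin_le_cone_quantities[OF this, of Q] Q show ?thesis
        by (simp add: sel_def f_def)
    qed
    have K: "0 \<le> 96 * M^3 * Q\<^sup>2" using M0 by simp
    have bound: "w \<in> L2_space" "(L2_norm w)\<^sup>2 \<le> (2*pi) ^ DIM(spacetime) * (96 * M^3 * Q\<^sup>2) * (L2_norm u1)\<^sup>2 * (L2_norm u2)\<^sup>2"
      unfolding w_def
      by (rule multiplier_mult_bound[OF u null_cone_measurable bounded_null_cone[OF s(1)] null_cone_measurable
            bounded_null_cone[OF s(2)] null_cone_measurable bounded_null_cone[OF s(3)] K]; rule tri; assumption)+
    have "Q \<ge> 0"
      using Q by (auto simp: cone_quantities_def)
    note bound(2)
    also have "(2*pi) ^ DIM(spacetime) * (96 * M^3 * Q\<^sup>2) * (L2_norm u1)\<^sup>2 * (L2_norm u2)\<^sup>2 = C\<^sup>2 * Q\<^sup>2 * (L2_norm u1)\<^sup>2 * (L2_norm u2)\<^sup>2"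
      unfolding C2 by (simp only: mult.assoc)
    also have "\<dots> = (C * Q * L2_norm u1 * L2_norm u2)\<^sup>2"
      by (simp only: power_mult_distrib)
    finally have "L2_norm w \<le> C * Q * L2_norm u1 * L2_norm u2"
    proof (rule power2_le_imp_le)
      show "0 \<le> C * Q * L2_norm u1 * L2_norm u2"
        using \<open>C > 0\<close> \<open>Q \<ge> 0\<close> by (intro mult_nonneg_nonneg L2_norm_nonneg) auto
    qed
    then show ?thesis
      using bound(1) by (simp add: Let_def w_def)
  qed
  show ?thesis
    unfolding cone_quantities_def[symmetric]
    by (intro exI[of _ C] conjI \<open>C > 0\<close> allI impI ballI; rule main; assumption)
qed

end
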